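(* Let $a,b$ be coprime positive integers and let $X$ be the set ${\mathsf{HNC}}(a,b)$ of homogeneous $a,b$-noncrossing partitions of $[a+b-1]$. Then the triple $(X, C, X(q))$ exhibits the cyclic sieving phenomenon, where $C = \mathbb{Z}_{a+b-1}$ acts on $X$ by rotation and \[ X(q) = {\mathsf{Cat}}_q(a,b) = \frac{1}{[a+b]_q}\begin{bmatrix} a+b \\ a,\, b\end{bmatrix}_q \] is the $q$-rational Catalan number.
   Context: An $a,b$-Dyck path is a lattice path of unit north ($N$) and east ($E$) steps from $(0,0)$ to $(b,a)$ staying above the line $y = \frac{a}{b}x$. Given such a path $D$, label its interior lattice points from southwest to northeast with $1, 2, \dots, a+b-1$ (labels considered to lie slightly below their lattice points), and fire a laser (a line segment of slope $\frac{a}{b}$ going northeast until it hits $D$) from every lattice point of $D$ at the south end of a north step. The set partition $\overline{\pi}(D)$ of $[a+b-1]$ declares $i \sim j$ iff labels $i$ and $j$ are not separated by laser fire; it is noncrossing. The set of homogeneous $a,b$-noncrossing partitions is ${\mathsf{HNC}}(a,b) = \{\overline{\pi}(D) : D \text{ an } a,b\text{-Dyck path}\}$; it is closed under the rotation $i \mapsto i+1 \pmod{a+b-1}$. Here $[n]_q = 1 + q + \cdots + q^{n-1}$, $[n]_q! = [1]_q[2]_q\cdots[n]_q$, and $\begin{bmatrix} a+b \\ a,\, b\end{bmatrix}_q = \frac{[a+b]_q!}{[a]_q![b]_q!}$. For a finite set $X$ with an action of a cyclic group $C = \langle c\rangle$ and $X(q) \in \mathbb{N}[q]$, the triple $(X,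 C, X(q))$ exhibits the cyclic sieving phenomenon if for every $d \ge 0$, $X(\zeta^d) = |\{x \in X : c^d . x = x\}|$, where $\zeta$ is a root of unity of multiplicative order $|C|$. *)

theory Defs
  imports
    "HOL-Analysis.Analysis"
    "HOL-Computational_Algebra.Computational_Algebra"
begin

section \<open>Rational Dyck paths\<close>

datatype step = North | East

definition lattice_pt :: "step list \<Rightarrow> nat \<Rightarrow> real \<times> real" where
  "lattice_pt D i =
     (real (count_list (take i D) East), real (count_list (take i D) North))"

definition dyck_path :: "nat \<Rightarrow> nat \<Rightarrow> step list \<Rightarrow> bool" where
  "dyck_path a b D \<longleftrightarrow>
     count_list D North = a \<and> count_list D East = b \<and>
     (\<forall>i \<le> length D. snd (lattice_pt D i) \<ge> real a / real b * fst (lattice_pt D i))"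

definition path_trace :: "step list \<Rightarrow> (real \<times> real) set" where
  "path_trace D = (\<Union>i < length D. closed_segment (lattice_pt D i) (lattice_pt D (Suc i)))"

section \<open>Lasers and the homogeneous noncrossing partition of a path\<close>

text \<open>
  A laser contains its starting point and runs in direction \<open>(b, a)\<close> up to and including the
  first point, other than the starting point, at which it meets the path.
\<close>

definition laser :: "nat \<Rightarrow> nat \<Rightarrow> step list \<Rightarrow> nat \<Rightarrow> (real \<times> real) set" where
  "laser a b D i =
     {lattice_pt D i + t *\<^sub>R (real b, real a) | t.
        0 \<le> t \<and> (\<forall>s. 0 < s \<and> s < t \<longrightarrow> lattice_pt D i + s *\<^sub>R (real b, real a) \<notin> path_trace D)}"

definition laser_fire :: "nat \<Rightarrow> nat \<Rightarrow> step list \<Rightarrow> (real \<times> real) set" where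
  "laser_fire a b D = (\<Union>i \<in> {i. i < length D \<and> D ! i = North}. laser a b D i)"

text \<open>The closed region bounded by the path and the line \<open>y = (a / b) x\<close>.\<close>

definition region_below :: "nat \<Rightarrow> nat \<Rightarrow> step list \<Rightarrow> (real \<times> real) set" where
  "region_below a b D =
     {(x, y). real a / real b * x \<le> y \<and> (\<exists>y' \<ge> y. (x, y') \<in> path_trace D)}"

definition label_pt :: "step list \<Rightarrow> real \<Rightarrow> nat \<Rightarrow> real \<times> real" where
  "label_pt D \<epsilon> i = lattice_pt D i - (0, \<epsilon>)"

text \<open>
  Labels lie slightly below their lattice points, i.e. at distance \<open>\<epsilon>\<close> for all sufficiently small
  \<open>\<epsilon> > 0\<close>. Two labels are not separated if they can be joined inside the region under the
  path without meeting any laser.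
\<close>

definition not_separated :: "nat \<Rightarrow> nat \<Rightarrow> step list \<Rightarrow> nat \<Rightarrow> nat \<Rightarrow> bool" where
  "not_separated a b D i j \<longleftrightarrow>
     (\<forall>\<^sub>F \<epsilon> in at_right 0.
        connected_component (region_below a b D - laser_fire a b D)
          (label_pt D \<epsilon> i) (label_pt D \<epsilon> j))"

definition hom_partition :: "nat \<Rightarrow> nat \<Rightarrow> step list \<Rightarrow> nat set set" where
  "hom_partition a b D =
     {1..a + b - 1} //
       {(i, j). i \<in> {1..a + b - 1} \<and> j \<in> {1..a + b - 1} \<and> not_separated a b D i j}"

definition HNC :: "nat \<Rightarrow> nat \<Rightarrow> nat set set set" where
  "HNC a b = {hom_partition a b D | D. dyck_path a b D}"

text \<open>The rotation \<open>1 \<mapsto> 2 \<mapsto> \<dots> \<mapsto> n \<mapsto> 1\<close>, acting on set partitions blockwise.\<close>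

definition rotate_partition :: "nat \<Rightarrow> nat set set \<Rightarrow> nat set set" where
  "rotate_partition n \<pi> = (\<lambda>B. (\<lambda>i. i mod n + 1) ` B) ` \<pi>"

section \<open>The rational q-Catalan number\<close>

definition q_int :: "nat \<Rightarrow> int poly" where
  "q_int n = (\<Sum>i<n. monom 1 i)"

definition q_fact :: "nat \<Rightarrow> int poly" where
  "q_fact n = (\<Prod>k=1..n. q_int k)"

text \<open>
  The quotients are formed in the field of rational functions; that the result is a
  polynomial is not presupposed.
\<close>

definition q_binomial :: "nat \<Rightarrow> nat \<Rightarrow> int poly fract" where
  "q_binomial a b = to_fract (q_fact (a + b)) / (to_fract (q_fact a) * to_fract (q_fact b))"

definition q_Cat :: "nat \<Rightarrow> nat \<Rightarrow> int poly fract" where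
  "q_Cat a b = 1 / to_fract (q_int (a + b)) * q_binomial a b"

section \<open>Cyclic sieving\<close>

text \<open>An action of the cyclic group of order \<open>n\<close> on \<open>X\<close>, given by the action \<open>c\<close> of a generator.\<close>

definition cyclic_action :: "nat \<Rightarrow> ('x \<Rightarrow> 'x) \<Rightarrow> 'x set \<Rightarrow> bool" where
  "cyclic_action n c X \<longleftrightarrow> n > 0 \<and> bij_betw c X X \<and> (\<forall>x\<in>X. (c ^^ n) x = x)"

definition primitive_root_of_unity :: "nat \<Rightarrow> complex \<Rightarrow> bool" where
  "primitive_root_of_unity n \<zeta> \<longleftrightarrow> n > 0 \<and> \<zeta> ^ n = 1 \<and> (\<forall>k. 0 < k \<and> k < n \<longrightarrow> \<zeta> ^ k \<noteq> 1)"

text \<open>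
  The polynomial \<open>P\<close> witnesses that the rational function \<open>F\<close> lies in \<open>\<nat>[q]\<close>;
  it is uniquely determined by \<open>F\<close>.
\<close>

definition cyclic_sieving :: "'x set \<Rightarrow> nat \<Rightarrow> ('x \<Rightarrow> 'x) \<Rightarrow> int poly fract \<Rightarrow> bool" where
  "cyclic_sieving X n c F \<longleftrightarrow>
     finite X \<and> cyclic_action n c X \<and>
     (\<exists>P :: nat poly. F = to_fract (map_poly int P) \<and>
        (\<forall>\<zeta> d. primitive_root_of_unity n \<zeta> \<longrightarrow>
           poly (map_poly of_nat P) (\<zeta> ^ d) = of_nat (card {x \<in> X. (c ^^ d) x = x})))"

end

theory Submission
  imports Defs
begin

text \<open>
  Give a lattice point \<open>(x, y)\<close> the height \<open>b y - a x\<close>, so that lasers are horizontal. Walking from a label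
  to the left until the path is met, and then down to the laser below, shows that two labels are
  joined iff the same index is, for both, the last earlier one of smaller height.

  This rule makes sense for any periodic word of North and East steps. If \<open>n = a + b - 1 = e p\<close>
  with \<open>e \<ge> 2\<close>, the partitions invariant under rotation by \<open>p\<close> correspond to all words of period
  \<open>p\<close> that have, per \<open>n\<close> letters, either \<open>a\<close> North steps (no block is fixed) or \<open>a - 1\<close> North steps (one
  block is fixed, it consists of the record lows). To recover the word from the partition, put North
  where an element has no equivalent one among its \<open>p\<close> predecessors. So there are
  \<open>p choose (a div e)\<close> invariant partitions if \<open>a mod e \<le> 1\<close>, and none otherwise; this is also the value
  of the \<open>q\<close>-Catalan polynomial at a root of unity of order \<open>e\<close>. For \<open>e = 1\<close> the cycle lemma applies.

  The coefficients of \<open>(1 - q) / (1 - q ^ (a + b))\<close> times the Gaussian binomial are nonnegative: the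
  Gaussian binomial is unimodal, which settles the lower half, and the quotient is palindromic.
\<close>

section \<open>Partitions from height functions\<close>

text \<open>Rotating a partition is not shifting its Dyck word: the word is cut at index 1, and in
  general \<open>dyck_rotate\<close> must also move a North step. With words indexed by all integers
  the rule commutes with shifts, so a word of period \<open>p\<close> gives an invariant partition
  at once. The obstacle is that many words of period \<open>n\<close> can give the same partition;
  injectivity returns for words of a period \<open>p\<close> with \<open>2 * p \<le> n\<close>,
  which is why \<open>e = 1\<close> is treated apart.

  The period is \<open>a + b - 1\<close> and not \<open>a + b\<close> because the last step of a
  path is always East and no label sits at its end. Without it the heights gain \<open>a\<close> per
  period. The two possible numbers of North steps come from the blocks: the partition of a path has
  \<open>a\<close> blocks, and in a periodic word each block has one North step per \<open>n\<close>
  letters, at its first element, except the block of record lows, which has none.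

  Values at roots of unity do not show that the coefficients are nonnegative. That part is
  independent of the combinatorics of paths and uses an action of \<open>sl2\<close> on functions on
  the subsets of \<open>{..<N}\<close>.\<close>

definition prev_low :: "(int \<Rightarrow> int) \<Rightarrow> int \<Rightarrow> int \<Rightarrow> bool" where
  "prev_low g k i \<longleftrightarrow> k < i \<and> g k < g i \<and> (\<forall>l. k < l \<and> l < i \<longrightarrow> g i \<le> g l)"

text \<open>Quantifying over \<open>k\<close>, instead of asking for a common \<open>k\<close>, puts
  all indices without a \<open>prev_low\<close> into one class. These are the record lows.\<close>

definition same_low :: "(int \<Rightarrow> int) \<Rightarrow> int \<Rightarrow> int \<Rightarrow> bool" where
  "same_low g i j \<longleftrightarrow> (\<forall>k. prev_low g k i \<longleftrightarrow> prev_low g k j)"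

text \<open>The shift by \<open>t * n\<close> wraps indices around the cycle. When \<open>g\<close>
  changes by a constant over \<open>n\<close> steps, shifting only one argument is already
  symmetric, see \<open>per_equiv_low_rel\<close>.\<close>

definition low_rel :: "int \<Rightarrow> (int \<Rightarrow> int) \<Rightarrow> int \<Rightarrow> int \<Rightarrow> bool" where
  "low_rel n g i j \<longleftrightarrow> (\<exists>t. same_low g i (j + t * n))"

lemma prev_low_unique: "prev_low g k i \<Longrightarrow> prev_low g k' i \<Longrightarrow> k = k'"
  unfolding prev_low_def by (meson linorder_neqE not_le)

lemma prev_low_exists:
  assumes "k < i" "g k < g i"
  obtains m where "k \<le> m" "prev_low g m i"
proof -
  let ?S = "{m \<in> {k..<i}. g m < g i}"
  have fin: "finite ?S" by (rule finite_subset[of _ "{k..<i}"]) auto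
  have ne: "?S \<noteq> {}" using assms by auto
  have M: "Max ?S \<in> ?S" using Max_in[OF fin ne] .
  have "g i \<le> g l" if "Max ?S < l" "l < i" for l
  proof (rule ccontr)
    assume "\<not> g i \<le> g l"
    then have "l \<in> ?S" using that M by auto
    then show False using Max_ge[OF fin] that by fastforce
  qed
  then have "prev_low g (Max ?S) i" using M unfolding prev_low_def by auto
  then show ?thesis using that M by auto
qed

lemma prev_low_ge: "prev_low g m i \<Longrightarrow> k < i \<Longrightarrow> g k < g i \<Longrightarrow> k \<le> m"
  unfolding prev_low_def by (meson not_le)

text \<open>Because \<open>g k < g i \<le> g (k + 1)\<close>, the class of \<open>i\<close> begins
  right after \<open>k\<close>: its first member is \<open>k + 1\<close>, and the step into it goes
  up.\<close>

lemma prev_low_Suc: "prev_low g k i \<Longrightarrow> prev_low g k (k + 1)"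
  unfolding prev_low_def by (cases "k + 1 = i") (auto intro: less_le_trans)

lemma same_low_refl [simp]: "same_low g i i"
  by (simp add: same_low_def)

lemma same_low_sym: "same_low g i j \<Longrightarrow> same_low g j i"
  unfolding same_low_def by blast

lemma same_low_trans: "same_low g i j \<Longrightarrow> same_low g j k \<Longrightarrow> same_low g i k"
  unfolding same_low_def by blast

lemma same_low_iff: "prev_low g k i \<Longrightarrow> same_low g i j \<longleftrightarrow> prev_low g k j"
  unfolding same_low_def using prev_low_unique by blast

text \<open>Only the values between \<open>k\<close> and \<open>i\<close> matter, so agreement up to
  a constant on that window suffices. This compares pieces of two words that agree only
  locally.\<close>

lemma prev_low_transfer:
  assumes "\<And>l. k \<le> l \<Longrightarrow> l \<le> i \<Longrightarrow> g' (l + s) = g l + d"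
  shows "prev_low g' (k + s) (i + s) \<longleftrightarrow> prev_low g k i"
proof (cases "k < i")
  case True
  have "(\<forall>l. k + s < l \<and> l < i + s \<longrightarrow> g' (i + s) \<le> g' l) \<longleftrightarrow> (\<forall>l. k < l \<and> l < i \<longrightarrow> g' (i + s) \<le> g' (l + s))"
    by (metis add_less_cancel_right diff_add_cancel)
  also have "\<dots> \<longleftrightarrow> (\<forall>l. k < l \<and> l < i \<longrightarrow> g i \<le> g l)"
    using assms True by auto
  finally show ?thesis using assms True by (auto simp: prev_low_def)
qed (auto simp: prev_low_def)

lemma same_low_shift:
  assumes "\<And>l. g' (l + s) = g l + d"
  shows "same_low g' (i + s) (j + s) \<longleftrightarrow> same_low g i j"
proof -
  have "\<And>k i. prev_low g' (k + s) (i + s) \<longleftrightarrow> prev_low g k i"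
    using assms by (intro prev_low_transfer) auto
  then show ?thesis unfolding same_low_def by (metis diff_add_cancel)
qed

lemma same_low_shift_mult:
  assumes "\<And>l. g (l + n) = g l + d"
  shows "same_low g (i + t * n) (j + t * n) \<longleftrightarrow> same_low g i j"
proof (induction t rule: int_induct[where k = 0])
  case (step1 t)
  then show ?case
    using same_low_shift[of g n g d "i + t * n" "j + t * n"] assms by (simp add: algebra_simps)
next
  case (step2 t)
  then show ?case
    using same_low_shift[of g n g d "i + (t - 1) * n" "j + (t - 1) * n"] assms by (simp add: algebra_simps)
qed simp

lemma low_rel_shift:
  assumes "\<And>l. g' (l + s) = g l + d"
  shows "low_rel n g' (i + s) (j + s) \<longleftrightarrow> low_rel n g i j"
proof -
  have "same_low g' (i + s) (j + s + t * n) \<longleftrightarrow> same_low g i (j + t * n)" for t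
    using same_low_shift[of g' s g d i "j + t * n", OF assms] by (simp add: algebra_simps)
  then show ?thesis unfolding low_rel_def by simp
qed

text \<open>For \<open>n > 0\<close>, these are the equivalence relations on residues modulo
  \<open>n\<close>, lifted to the integers so that rotation becomes translation.\<close>

definition per_equiv :: "int \<Rightarrow> (int \<Rightarrow> int \<Rightarrow> bool) \<Rightarrow> bool" where
  "per_equiv n R \<longleftrightarrow> (\<forall>i. R i i) \<and> (\<forall>i j. R i j \<longrightarrow> R j i) \<and>
     (\<forall>i j k. R i j \<longrightarrow> R j k \<longrightarrow> R i k) \<and> (\<forall>i. R i (i + n))"

lemma per_equiv_low_rel:
  assumes "\<And>l. g (l + n) = g l + d"
  shows "per_equiv n (low_rel n g)"
proof -
  note sh = same_low_shift_mult[of g n d, OF assms]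
  have "low_rel n g i i" for i unfolding low_rel_def by (rule exI[of _ 0]) simp
  moreover have "low_rel n g j i" if ij: "low_rel n g i j" for i j
  proof -
    obtain t where "same_low g i (j + t * n)" using ij unfolding low_rel_def by blast
    then have "same_low g (i + (-t) * n) j"
      using sh[of i "-t" "j + t * n"] by (simp add: algebra_simps)
    then show ?thesis unfolding low_rel_def using same_low_sym by blast
  qed
  moreover have "low_rel n g i k" if ij: "low_rel n g i j" and jk: "low_rel n g j k" for i j k
  proof -
    obtain t where t: "same_low g i (j + t * n)" using ij unfolding low_rel_def by blast
    obtain t' where "same_low g j (k + t' * n)" using jk unfolding low_rel_def by blast
    then have "same_low g (j + t * n) (k + (t' + t) * n)"
      using sh[of j t "k + t' * n"] by (simp add: algebra_simps)
    then show ?thesis unfolding low_rel_def using t same_low_trans by blast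
  qed
  moreover have "low_rel n g i (i + n)" for i
    unfolding low_rel_def by (rule exI[of _ "-1"]) simp
  ultimately show ?thesis unfolding per_equiv_def by blast
qed

lemma per_equiv_mult:
  assumes "per_equiv n R"
  shows "R i (i + t * n)"
proof (induction t rule: int_induct[where k = 0])
  case base
  then show ?case using assms by (simp add: per_equiv_def)
next
  case (step1 t)
  then show ?case using assms unfolding per_equiv_def by (metis add.assoc add.commute distrib_right mult_1)
next
  case (step2 t)
  have "i + (t - 1) * n + n = i + t * n" by (simp add: algebra_simps)
  then show ?case using assms step2 unfolding per_equiv_def by metis
qed

lemma per_equiv_cong:
  assumes "per_equiv n R"
  shows "R (i + t * n) (j + t' * n) \<longleftrightarrow> R i j"
  using per_equiv_mult[OF assms, of i t] per_equiv_mult[OF assms, of j t'] assms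
  unfolding per_equiv_def by meson

lemma per_equiv_shift: "per_equiv n R \<Longrightarrow> per_equiv n (\<lambda>i j. R (i + s) (j + s))"
proof -
  assume R: "per_equiv n R"
  have "R (i + s) (i + n + s)" for i
    using R[unfolded per_equiv_def] by (metis add.assoc add.commute)
  then show ?thesis using R unfolding per_equiv_def by blast
qed

definition cyc_part :: "nat \<Rightarrow> (int \<Rightarrow> int \<Rightarrow> bool) \<Rightarrow> nat set set" where
  "cyc_part n R = {1..n} // {(i, j). i \<in> {1..n} \<and> j \<in> {1..n} \<and> R (int i) (int j)}"

definition block :: "nat \<Rightarrow> (int \<Rightarrow> int \<Rightarrow> bool) \<Rightarrow> int \<Rightarrow> nat set" where
  "block n R i = {j \<in> {1..n}. R i (int j)}"

lemma cyc_part_eq_image: "cyc_part n R = (\<lambda>i. block n R (int i)) ` {1..n}"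
  unfolding cyc_part_def block_def quotient_def by auto

definition residue :: "nat \<Rightarrow> int \<Rightarrow> nat" where
  "residue n i = nat ((i - 1) mod int n) + 1"

lemma residue_in: "n > 0 \<Longrightarrow> residue n i \<in> {1..n}"
  unfolding residue_def
  using pos_mod_bound[of "int n" "i - 1"] pos_mod_sign[of "int n" "i - 1"]
  by (simp add: nat_less_iff Suc_leI)

lemma residue_cong: "n > 0 \<Longrightarrow> int (residue n i) = i + (- ((i - 1) div int n)) * int n"
proof -
  assume "n > 0"
  then have "int (residue n i) = (i - 1) mod int n + 1"
    unfolding residue_def using pos_mod_sign[of "int n" "i - 1"] by auto
  also have "\<dots> = (i - 1) - (i - 1) div int n * int n + 1"
    by (simp add: minus_div_mult_eq_mod)
  finally show ?thesis by simp
qed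

lemma block_eq_iff:
  assumes "per_equiv (int n) R" "n > 0"
  shows "block n R i = block n R j \<longleftrightarrow> R i j"
proof
  assume eq: "block n R i = block n R j"
  have "R i (int (residue n i))"
    using residue_cong[OF assms(2)] per_equiv_mult[OF assms(1)] by metis
  then have "residue n i \<in> block n R i" using residue_in[OF assms(2)] by (simp add: block_def)
  then have "R j (int (residue n i))" unfolding eq by (simp add: block_def)
  then show "R i j" using \<open>R i (int (residue n i))\<close> assms(1) unfolding per_equiv_def by meson
next
  assume "R i j"
  then show "block n R i = block n R j" using assms(1) unfolding block_def per_equiv_def by blast
qed

lemma block_in_cyc_part:
  assumes "per_equiv (int n) R" "n > 0"
  shows "block n R i \<in> cyc_part n R"
proof -
  have "R i (int (residue n i))"
    using residue_cong[OF assms(2)] per_equiv_mult[OF assms(1)] by metis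
  then have "block n R i = block n R (int (residue n i))" using block_eq_iff[OF assms] by blast
  then show ?thesis using residue_in[OF assms(2)] unfolding cyc_part_eq_image by blast
qed

lemma cyc_part_eq_blocks:
  assumes "per_equiv (int n) R" "n > 0"
  shows "cyc_part n R = range (block n R)"
  using block_in_cyc_part[OF assms] unfolding cyc_part_eq_image by blast

text \<open>Every integer has a representative in \<open>{1..n}\<close>, so the partition determines
  the relation on all integers. This gives \<open>cyc_part_inject\<close>.\<close>

lemma cyc_part_rel_iff:
  assumes "per_equiv (int n) R" "n > 0"
  shows "R i j \<longleftrightarrow> (\<exists>B \<in> cyc_part n R. residue n i \<in> B \<and> residue n j \<in> B)"
proof -
  have r: "R i (int (residue n i))" for i
    using residue_cong[OF assms(2)] per_equiv_mult[OF assms(1)] by metis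
  note e = assms(1)[unfolded per_equiv_def]
  note ri = residue_in[OF assms(2)]
  show ?thesis
  proof
    assume "R i j"
    then have "R i (int (residue n j))" using r e by meson
    then have "residue n i \<in> block n R i \<and> residue n j \<in> block n R i"
      using r ri by (simp add: block_def)
    then show "\<exists>B \<in> cyc_part n R. residue n i \<in> B \<and> residue n j \<in> B"
      using block_in_cyc_part[OF assms] by blast
  next
    assume "\<exists>B \<in> cyc_part n R. residue n i \<in> B \<and> residue n j \<in> B"
    then obtain k where "R k (int (residue n i))" "R k (int (residue n j))"
      unfolding cyc_part_eq_image block_def by auto
    then show "R i j" using r e by meson
  qed
qed

lemma cyc_part_inject:
  assumes "per_equiv (int n) R" "per_equiv (int n) S" "n > 0"
  shows "cyc_part n R = cyc_part n S \<longleftrightarrow> R = S"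
  using cyc_part_rel_iff[OF assms(1,3)] cyc_part_rel_iff[OF assms(2,3)] by (auto intro!: ext)

lemma rotate_cyc_part:
  assumes "per_equiv (int n) R" "n > 0"
  shows "rotate_partition n (cyc_part n R) = cyc_part n (\<lambda>i j. R (i - 1) (j - 1))"
proof -
  let ?S = "\<lambda>i j. R (i - 1) (j - 1)"
  have S: "per_equiv (int n) ?S" using per_equiv_shift[OF assms(1), of "-1"] by simp
  have im: "(\<lambda>i. i mod n + 1) ` block n R i = block n ?S (i + 1)" for i
  proof
    show "(\<lambda>i. i mod n + 1) ` block n R i \<subseteq> block n ?S (i + 1)"
    proof
      fix x assume "x \<in> (\<lambda>i. i mod n + 1) ` block n R i"
      then obtain j where j: "j \<in> {1..n}" "R i (int j)" "x = j mod n + 1" by (auto simp: block_def)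
      have "int (j mod n) = int j + (- (int j div int n)) * int n"
        by (simp add: zmod_int minus_div_mult_eq_mod)
      then have "R i (int (j mod n))"
        using j(2) per_equiv_cong[OF assms(1), of i 0 "int j" "- (int j div int n)"] by simp
      moreover have "x \<in> {1..n}" using j assms(2) by (simp add: Suc_leI)
      ultimately show "x \<in> block n ?S (i + 1)" using j by (simp add: block_def)
    qed
    show "block n ?S (i + 1) \<subseteq> (\<lambda>i. i mod n + 1) ` block n R i"
    proof
      fix x assume "x \<in> block n ?S (i + 1)"
      then have x: "x \<in> {1..n}" "R i (int x - 1)" by (auto simp: block_def)
      show "x \<in> (\<lambda>i. i mod n + 1) ` block n R i"
      \<comment> \<open>The element 1 comes from \<open>n\<close>, which is congruent to the index
        0.\<close>
      proof (cases "x = 1")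
        case True
        have "R i (0 + 1 * int n)" using x True per_equiv_cong[OF assms(1), of i 0 0 1] by simp
        then have "n \<in> block n R i" using assms(2) by (simp add: block_def)
        then show ?thesis using True by (intro image_eqI[of _ _ n]) auto
      next
        case False
        then have "x - 1 \<in> block n R i" using x by (auto simp: block_def of_nat_diff)
        then show ?thesis using x False by (intro image_eqI[of _ _ "x - 1"]) auto
      qed
    qed
  qed
  have "rotate_partition n (cyc_part n R) = range (\<lambda>i. block n ?S (i + 1))"
    unfolding rotate_partition_def cyc_part_eq_blocks[OF assms] image_image im ..
  also have "\<dots> = range (block n ?S)"
    by (auto simp: image_iff) (metis diff_add_cancel)
  finally show ?thesis using cyc_part_eq_blocks[OF S assms(2)] by simp
qed

lemma rotate_cyc_part_funpow:
  assumes "per_equiv (int n) R" "n > 0"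
  shows "(rotate_partition n ^^ d) (cyc_part n R) = cyc_part n (\<lambda>i j. R (i - int d) (j - int d))"
proof (induction d)
  case (Suc d)
  have S: "per_equiv (int n) (\<lambda>i j. R (i - int d) (j - int d))"
    using per_equiv_shift[OF assms(1), of "- int d"] by simp
  show ?case using Suc rotate_cyc_part[OF S assms(2)] by (simp add: algebra_simps)
qed simp

section \<open>Periodic words\<close>

lemma int_fun_const:
  fixes f :: "int \<Rightarrow> 'a"
  assumes "\<And>i. f i = f (i - 1)"
  shows "f i = f j"
proof -
  have "f i = f 0" for i
  proof (induction i rule: int_induct[where k = 0])
    case (step1 i)
    then show ?case using assms[of "i + 1"] by simp
  next
    case (step2 i)
    then show ?case using assms[of i] by simp
  qed simp
  then show ?thesis by metis
qed

definition periodic :: "int \<Rightarrow> (int \<Rightarrow> bool) \<Rightarrow> bool" where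
  "periodic m u \<longleftrightarrow> (\<forall>i. u (i + m) = u i)"

definition ones :: "(int \<Rightarrow> bool) \<Rightarrow> int \<Rightarrow> int" where
  "ones u m = (\<Sum>k\<in>{1..m}. of_bool (u k))"

definition periodic_ext :: "int \<Rightarrow> (int \<Rightarrow> bool) \<Rightarrow> int \<Rightarrow> bool" where
  "periodic_ext m u i = u ((i - 1) mod m + 1)"

lemma periodic_periodic_ext: "periodic m (periodic_ext m u)"
  by (simp add: periodic_def periodic_ext_def) (metis add_diff_eq add.commute mod_add_self2)

lemma periodic_ext_eq: "1 \<le> i \<Longrightarrow> i \<le> m \<Longrightarrow> periodic_ext m u i = u i"
  by (simp add: periodic_ext_def)

lemma periodic_mult: "periodic m u \<Longrightarrow> u (i + t * m) = u i"
proof (induction t rule: int_induct[where k = 0])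
  case (step1 t)
  have "i + (t + 1) * m = i + t * m + m" by (simp add: algebra_simps)
  then show ?case using step1 unfolding periodic_def by metis
next
  case (step2 t)
  have "i + t * m = i + (t - 1) * m + m" by (simp add: algebra_simps)
  then show ?case using step2 unfolding periodic_def by metis
qed simp

lemma periodic_mod: "periodic m u \<Longrightarrow> u ((i - 1) mod m + 1) = u i"
proof -
  assume p: "periodic m u"
  have "(i - 1) mod m + 1 = i + (- ((i - 1) div m)) * m"
    by (simp add: minus_div_mult_eq_mod[symmetric])
  then show ?thesis using periodic_mult[OF p] by metis
qed

lemma ones_step: "1 \<le> i \<Longrightarrow> ones u i = ones u (i - 1) + of_bool (u i)"
proof -
  assume "1 \<le> i"
  then have "{1..i} = insert i {1..i - 1}" by auto
  then show ?thesis unfolding ones_def by simp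
qed

lemma ones_0 [simp]: "ones u 0 = 0"
  by (simp add: ones_def)

lemma ones_card: "ones u m = int (card {k \<in> {1..m}. u k})"
  unfolding ones_def by (simp add: sum_of_bool_eq Int_def)

lemma card_words:
  assumes "m > 0"
  shows "card {u. periodic m u \<and> ones u m = int c} = nat m choose c"
    and "finite {u. periodic m u \<and> ones u m = int c}"
proof -
  let ?W = "{u. periodic m u \<and> ones u m = int c}"
  let ?S = "{B. B \<subseteq> {1..m} \<and> card B = c}"
  have bij: "bij_betw (\<lambda>u. {k \<in> {1..m}. u k}) ?W ?S"
  proof (rule bij_betwI[where g = "\<lambda>B. periodic_ext m (\<lambda>k. k \<in> B)"])
    show "(\<lambda>u. {k \<in> {1..m}. u k}) \<in> ?W \<rightarrow> ?S" by (auto simp: ones_card)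
    show "(\<lambda>B. periodic_ext m (\<lambda>k. k \<in> B)) \<in> ?S \<rightarrow> ?W"
    proof
      fix B assume B: "B \<in> ?S"
      have "{k \<in> {1..m}. periodic_ext m (\<lambda>k. k \<in> B) k} = B" using B by (auto simp: periodic_ext_eq)
      then show "periodic_ext m (\<lambda>k. k \<in> B) \<in> ?W"
        using B periodic_periodic_ext[of m "\<lambda>k. k \<in> B"] by (simp add: ones_card)
    qed
    show "periodic_ext m (\<lambda>k. k \<in> {k \<in> {1..m}. u k}) = u" if "u \<in> ?W" for u
    proof
      fix i
      have "(i - 1) mod m + 1 \<in> {1..m}"
        using assms by (simp add: add1_zle_eq)
      then show "periodic_ext m (\<lambda>k. k \<in> {k \<in> {1..m}. u k}) i = u i"
        using that periodic_mod[of m u i] by (simp add: periodic_ext_def)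
    qed
    show "{k \<in> {1..m}. periodic_ext m (\<lambda>k. k \<in> B) k} = B" if "B \<in> ?S" for B
      using that by (auto simp: periodic_ext_eq)
  qed
  have cS: "card ?S = nat m choose c" using n_subsets[of "{1..m}" c] by simp
  have fS: "finite ?S" by (rule finite_subset[of _ "Pow {1..m}"]) auto
  show "card ?W = nat m choose c" using bij_betw_same_card[OF bij] cS by simp
  show "finite ?W" using bij_betw_finite[OF bij] fS by simp
qed

lemma coprime_int_add: "coprime a b \<Longrightarrow> coprime (int a + int b) (int a)"
  using gcd_add1[of "int b" "int a"] by (simp add: coprime_iff_gcd_eq_1 ac_simps)

lemma residue_eq_zero:
  fixes k k' t m :: int
  assumes "k = k' + t * m" "0 \<le> k" "k < m" "0 \<le> k'" "k' < m"
  shows "t = 0"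
proof -
  have "k = (k' + t * m) mod m" using mod_pos_pos_trivial[OF assms(2,3)] by (simp only: assms(1))
  also have "\<dots> = k'" using assms(4,5) by simp
  finally have "t * m = 0" using assms(1) by linarith
  then show ?thesis using assms by simp
qed

lemma periodic_multiple: "periodic p u \<Longrightarrow> periodic (e * p) u"
  unfolding periodic_def[of "e * p"] using periodic_mult[of p u _ e] by simp

definition first_word :: "int \<Rightarrow> (int \<Rightarrow> int \<Rightarrow> bool) \<Rightarrow> int \<Rightarrow> bool" where
  "first_word p R i \<longleftrightarrow> (\<forall>k. i - p \<le> k \<and> k < i \<longrightarrow> \<not> R k i)"

lemma periodic_first_word:
  assumes "\<And>i j. R (i + m) (j + m) \<longleftrightarrow> R i j"
  shows "periodic m (first_word p R)"
  unfolding periodic_def first_word_def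
proof (rule allI)
  fix i
  show "(\<forall>k. i + m - p \<le> k \<and> k < i + m \<longrightarrow> \<not> R k (i + m)) \<longleftrightarrow> (\<forall>k. i - p \<le> k \<and> k < i \<longrightarrow> \<not> R k i)"
  proof
    assume *: "\<forall>k. i + m - p \<le> k \<and> k < i + m \<longrightarrow> \<not> R k (i + m)"
    show "\<forall>k. i - p \<le> k \<and> k < i \<longrightarrow> \<not> R k i"
    proof (intro allI impI)
      fix k assume "i - p \<le> k \<and> k < i"
      then show "\<not> R k i" using spec[OF *, of "k + m"] assms[of k i] by auto
    qed
  next
    assume *: "\<forall>k. i - p \<le> k \<and> k < i \<longrightarrow> \<not> R k i"
    show "\<forall>k. i + m - p \<le> k \<and> k < i + m \<longrightarrow> \<not> R k (i + m)"
    proof (intro allI impI)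
      fix k assume "i + m - p \<le> k \<and> k < i + m"
      then show "\<not> R k (i + m)" using spec[OF *, of "k - m"] assms[of "k - m" i] by auto
    qed
  qed
qed

lemma shift_invariant_mult:
  fixes R :: "int \<Rightarrow> int \<Rightarrow> bool"
  assumes "\<And>i j. R (i + s) (j + s) \<longleftrightarrow> R i j"
  shows "R (i + t * s) (j + t * s) \<longleftrightarrow> R i j"
proof (induction t rule: int_induct[where k = 0])
  case (step1 t)
  then show ?case using assms[of "i + t * s" "j + t * s"] by (simp add: algebra_simps)
next
  case (step2 t)
  then show ?case using assms[of "i + (t - 1) * s" "j + (t - 1) * s"] by (simp add: algebra_simps)
qed simp

section \<open>Heights of North-East words\<close>

locale rational_slope =
  fixes a b :: nat
  assumes a_pos: "a > 0" and b_pos: "b > 0" and coprime_ab: "coprime a b"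
begin

abbreviation n :: int where "n \<equiv> int a + int b - 1"

lemma n_pos: "n > 0" using a_pos b_pos by linarith

text \<open>In a word \<open>u\<close>, the letter \<open>u i\<close> is the step that ends at index \<open>i\<close>; \<open>True\<close> stands for North.\<close>

definition step_height :: "bool \<Rightarrow> int" where
  "step_height x = (if x then int b else - int a)"

text \<open>The two branches make \<open>height_step\<close> hold at every integer. Negative indices
  are needed because a \<open>prev_low\<close> may lie to the left of any fixed window.\<close>

definition height :: "(int \<Rightarrow> bool) \<Rightarrow> int \<Rightarrow> int" where
  "height u i = (if 0 \<le> i then \<Sum>k\<in>{1..i}. step_height (u k) else - (\<Sum>k\<in>{i + 1..0}. step_height (u k)))"

lemma height_0 [simp]: "height u 0 = 0"
  by (simp add: height_def)

lemma height_step: "height u i = height u (i - 1) + step_height (u i)"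
proof -
  consider "i \<ge> 1" | "i = 0" | "i < 0" by linarith
  then show ?thesis
  proof cases
    case 1
    then have "{1..i} = insert i {1..i - 1}" by auto
    then show ?thesis using 1 by (simp add: height_def)
  next
    case 2
    then show ?thesis by (simp add: height_def)
  next
    case 3
    then have "{i..0} = insert i {i + 1..0}" by auto
    then show ?thesis using 3 by (simp add: height_def)
  qed
qed

lemma height_less_iff: "height u (i - 1) < height u i \<longleftrightarrow> u i"
  using height_step[of u i] a_pos b_pos by (auto simp: step_height_def)

abbreviation "low u \<equiv> prev_low (height u)"
abbreviation "same u \<equiv> same_low (height u)"

lemma word_iff_prev_low: "u i \<longleftrightarrow> low u (i - 1) i"
  using height_less_iff[of u i] by (auto simp: prev_low_def)

text \<open>Among \<open>i\<close> steps, \<open>ones u i\<close> go up by \<open>b\<close> and the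
  others down by \<open>a\<close>. Modulo \<open>a + b\<close> only \<open>- a * i\<close> remains,
  which is how coprimality enters.\<close>

lemma height_ones: "0 \<le> i \<Longrightarrow> height u i = (int a + int b) * ones u i - int a * i"
proof (induction i rule: int_ge_induct)
  case (step i)
  then show ?case using height_step[of u "i + 1"] ones_step[of "i + 1" u]
    by (auto simp: step_height_def algebra_simps)
qed simp

lemma height_agree:
  assumes "x \<le> y" "\<And>k. x < k \<Longrightarrow> k \<le> y \<Longrightarrow> w (k + s) = u k"
  shows "height w (y + s) = height u y + (height w (x + s) - height u x)"
  using assms
proof (induction y rule: int_ge_induct)
  case (step y)
  have e: "w (y + 1 + s) = u (y + 1)" using step.prems[of "y + 1"] step.hyps by simp
  have IH: "height w (y + s) = height u y + (height w (x + s) - height u x)" using step by simp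
  have "height w (y + 1 + s) = height w (y + s) + step_height (u (y + 1))"
    using height_step[of w "y + 1 + s"] e by (simp add: algebra_simps)
  then show ?case using IH height_step[of u "y + 1"] by simp
qed simp

lemma height_shift: "height (\<lambda>i. u (i + r)) i = height u (i + r) - height u r"
proof -
  let ?f = "\<lambda>i. height (\<lambda>i. u (i + r)) i - height u (i + r)"
  have "?f i = ?f (i - 1)" for i
    using height_step[of "\<lambda>i. u (i + r)" i] height_step[of u "i + r"] by (simp add: algebra_simps)
  then have "?f i = ?f 0" by (rule int_fun_const)
  then show ?thesis by simp
qed

lemma height_periodic: "periodic m u \<Longrightarrow> height u (i + m) = height u i + height u m"
proof -
  assume "periodic m u"
  then have "(\<lambda>i. u (i + m)) = u" by (simp add: periodic_def)
  then show ?thesis using height_shift[of u m i] by simp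
qed

lemma height_periodic_mult: "periodic m u \<Longrightarrow> height u (i + t * m) = height u i + t * height u m"
proof (induction t rule: int_induct[where k = 0])
  case (step1 t)
  then show ?case using height_periodic[of m u "i + t * m"] by (simp add: algebra_simps)
next
  case (step2 t)
  then show ?case using height_periodic[of m u "i + (t - 1) * m"] by (simp add: algebra_simps)
qed simp

lemma prev_low_periodic:
  assumes "periodic m u"
  shows "low u (k + t * m) (i + t * m) \<longleftrightarrow> low u k i"
  by (rule prev_low_transfer) (simp add: height_periodic_mult[OF assms])

definition word_rel :: "(int \<Rightarrow> bool) \<Rightarrow> int \<Rightarrow> int \<Rightarrow> bool" where
  "word_rel u = low_rel n (height u)"

lemma per_equiv_word_rel: "periodic n u \<Longrightarrow> per_equiv n (word_rel u)"
  unfolding word_rel_def by (rule per_equiv_low_rel) (rule height_periodic)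

lemma same_word_rel: "same u i j \<Longrightarrow> word_rel u i j"
  unfolding word_rel_def low_rel_def by (intro exI[of _ 0]) simp

lemma word_rel_shift: "word_rel (\<lambda>i. u (i + r)) i j \<longleftrightarrow> word_rel u (i + r) (j + r)"
  unfolding word_rel_def
  by (rule low_rel_shift[symmetric, where d = "height u r"]) (simp add: height_shift)

section \<open>Dyck words, their partitions and rotations\<close>

definition is_dyck :: "(int \<Rightarrow> bool) \<Rightarrow> bool" where
  "is_dyck u \<longleftrightarrow> periodic n u \<and> ones u n = int a \<and> (\<forall>i\<in>{1..n}. 0 < height u i)"

text \<open>Strictness comes from coprimality: a height 0 at \<open>i\<close> forces
  \<open>a + b dvd i\<close>, impossible for \<open>1 \<le> i \<le> n < a + b\<close>.\<close>

lemma is_dyckI: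
  assumes "periodic n u" "ones u n = int a" "\<And>i. 1 \<le> i \<Longrightarrow> i \<le> n \<Longrightarrow> 0 \<le> height u i"
  shows "is_dyck u"
proof -
  have "height u i \<noteq> 0" if i: "1 \<le> i" "i \<le> n" for i
  proof
    assume "height u i = 0"
    then have "(int a + int b) * ones u i = int a * i" using i height_ones[of i u] by simp
    moreover have "coprime (int a + int b) (int a)"
      by (rule coprime_int_add[OF coprime_ab])
    ultimately have "int a + int b dvd i"
      by (metis coprime_dvd_mult_right_iff dvd_triv_left)
    then show False using i zdvd_imp_le[of "int a + int b" i] by linarith
  qed
  then show ?thesis using assms unfolding is_dyck_def by force
qed

lemma is_dyckD:
  assumes "is_dyck u"
  shows "periodic n u" "height u n = int a" "\<And>i. 1 \<le> i \<Longrightarrow> i \<le> n \<Longrightarrow> 0 < height u i"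
  using assms height_ones[of n u] n_pos unfolding is_dyck_def by (auto simp: algebra_simps)

lemma ones_eq_if_height: "height u n = int a \<Longrightarrow> ones u n = int a"
proof -
  assume "height u n = int a"
  then have "(int a + int b) * ones u n = (int a + int b) * int a"
    using height_ones[of n u] n_pos by (simp add: algebra_simps)
  then show ?thesis using a_pos by simp
qed

lemma dyck_prev_low:
  assumes "is_dyck u" "1 \<le> i" "i \<le> n"
  obtains k where "0 \<le> k" "k < i" "low u k i"
proof -
  have "height u 0 < height u i" using is_dyckD(3)[OF assms] by simp
  then obtain k where "0 \<le> k" "low u k i" using prev_low_exists[of 0 i "height u"] assms by auto
  then show ?thesis using that by (simp add: prev_low_def)
qed

text \<open>Within \<open>{1..n}\<close> every index has its \<open>prev_low\<close> in
  \<open>{0..<n}\<close>, since the height 0 at index 0 is smaller. Two such values congruent modulo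
  \<open>n\<close> are equal, so no wrap-around occurs.\<close>

lemma dyck_rel_iff:
  assumes "is_dyck u" "1 \<le> i" "i \<le> n" "1 \<le> j" "j \<le> n"
  shows "word_rel u i j \<longleftrightarrow> same u i j"
proof
  assume "word_rel u i j"
  then obtain t where t: "same u i (j + t * n)" unfolding word_rel_def low_rel_def by auto
  obtain k where k: "0 \<le> k" "k < i" "low u k i" using dyck_prev_low[OF assms(1-3)] by auto
  obtain k' where k': "0 \<le> k'" "k' < j" "low u k' j" using dyck_prev_low[OF assms(1,4,5)] by auto
  have "low u (k' + t * n) (j + t * n)"
    using k' prev_low_periodic[OF is_dyckD(1)[OF assms(1)]] by simp
  then have "k = k' + t * n" using t k same_low_iff prev_low_unique by blast
  then have "t = 0" using k k' assms by (intro residue_eq_zero[of k k' t n]) auto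
  then show "same u i j" using t by simp
next
  assume "same u i j"
  then show "word_rel u i j" by (rule same_word_rel)
qed

text \<open>If \<open>k\<close> is the \<open>prev_low\<close> of \<open>i\<close>, then the block
  of \<open>i\<close> starts at \<open>k + 1\<close>, and a North step at \<open>i\<close> means
  \<open>k = i - 1\<close>. Hence the North steps are the block minima and the partition determines
  the Dyck word.\<close>

lemma dyck_first_iff:
  assumes "is_dyck u" "1 \<le> i" "i \<le> n"
  shows "u i \<longleftrightarrow> (\<forall>k. 1 \<le> k \<and> k < i \<longrightarrow> \<not> word_rel u k i)"
proof
  assume "u i"
  then have p: "low u (i - 1) i" using word_iff_prev_low by simp
  show "\<forall>k. 1 \<le> k \<and> k < i \<longrightarrow> \<not> word_rel u k i"
  proof (intro allI impI notI)
    fix k assume k: "1 \<le> k \<and> k < i" "word_rel u k i"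
    then have "same u k i" using dyck_rel_iff[OF assms(1)] assms by simp
    then have "low u (i - 1) k" using p by (simp add: same_low_def)
    then show False using k by (simp add: prev_low_def)
  qed
next
  assume *: "\<forall>k. 1 \<le> k \<and> k < i \<longrightarrow> \<not> word_rel u k i"
  obtain k where k: "0 \<le> k" "k < i" "low u k i" using dyck_prev_low[OF assms] by auto
  have "same u (k + 1) i" using prev_low_Suc[OF k(3)] same_low_iff k(3) by blast
  then have "word_rel u (k + 1) i" using dyck_rel_iff[OF assms(1), of "k + 1" i] k assms by simp
  then have "\<not> k + 1 < i" using * k(1) by auto
  then have "k = i - 1" using k(2) by simp
  then show "u i" using k word_iff_prev_low by simp
qed

text \<open>
  If \<open>f\<close> is the least element of the block of \<open>n\<close>, then \<open>f\<close> loses its North step to the new first element.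
  Up to a shift of the index, heights grow by \<open>b\<close> before \<open>f\<close> and drop by \<open>a\<close> from \<open>f\<close> on.
\<close>

lemma dyck_rotate:
  assumes u: "is_dyck u"
  obtains v where "is_dyck v" "\<And>i j. word_rel v i j \<longleftrightarrow> word_rel u (i - 1) (j - 1)"
proof -
  let ?h = "height u"
  note per = is_dyckD(1)[OF u] and hn = is_dyckD(2)[OF u] and hpos = is_dyckD(3)[OF u]
  obtain f0 where f0: "0 \<le> f0" "f0 < n" "prev_low ?h f0 n"
    using dyck_prev_low[OF u, of n] n_pos by auto
  define f where "f = f0 + 1"
  have f: "1 \<le> f" "f \<le> n" "prev_low ?h (f - 1) n" using f0 by (auto simp: f_def)
  have uf: "u f" using prev_low_Suc[OF f(3)] word_iff_prev_low[of u f] by simp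
  have ge: "int a \<le> ?h l" if "f \<le> l" "l \<le> n" for l
    using f(3) that hn unfolding prev_low_def by (cases "l = n") auto
  have lt: "?h (f - 1) < int a" using f(3) hn by (simp add: prev_low_def)
  have hf: "?h f = ?h (f - 1) + int b" using height_step[of u f] uf by (simp add: step_height_def)
  define v where "v = periodic_ext n (\<lambda>i. if i = 1 then True else if i - 1 = f then False else u (i - 1))"
  let ?k = "height v"
  have perv: "periodic n v" unfolding v_def by (rule periodic_periodic_ext)
  have v1: "v 1" unfolding v_def using n_pos by (subst periodic_ext_eq) auto
  have vi: "v (i + 1) = (if i = f then False else u i)" if "1 \<le> i" "i + 1 \<le> n" for i
    unfolding v_def using that by (subst periodic_ext_eq) auto
  have k1: "?k 1 = int b" using height_step[of v 1] v1 by (simp add: step_height_def)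
  have kk: "?k (i + 1) = (if i < f then ?h i + int b else ?h i - int a)" if "0 \<le> i" "i \<le> n - 1" for i
    using that
  proof (induction i rule: int_ge_induct)
    case base
    then show ?case using k1 f by simp
  next
    case (step i)
    have IH: "?k (i + 1) = (if i < f then ?h i + int b else ?h i - int a)" using step by simp
    have s: "?k (i + 1 + 1) = ?k (i + 1) + step_height (v (i + 1 + 1))"
      using height_step[of v "i + 1 + 1"] by (simp only: add_diff_cancel_right')
    have vv: "v (i + 1 + 1) = (if i + 1 = f then False else u (i + 1))" using vi[of "i + 1"] step by simp
    have hs: "?h (i + 1) = ?h i + step_height (u (i + 1))" using height_step[of u "i + 1"] by simp
    show ?case
    proof (cases "i + 1 = f")
      case True
      then show ?thesis using IH s vv hs uf by (simp add: step_height_def)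
    next
      case False
      then show ?thesis using IH s vv hs by auto
    qed
  qed
  have kn: "?k n = int a"
  proof (cases "f = n")
    case True
    then have "?k n = ?h (n - 1) + int b" using kk[of "n - 1"] n_pos by simp
    then show ?thesis using hf True hn by simp
  next
    case False
    then have "f \<le> n - 1" using f by simp
    have "\<not> u n"
    proof
      assume "u n"
      then have "prev_low ?h (n - 1) n" using word_iff_prev_low[of u n] by simp
      then show False using f(3) prev_low_unique False by fastforce
    qed
    then have "?h n = ?h (n - 1) - int a" using height_step[of u n] by (simp add: step_height_def)
    then show ?thesis using kk[of "n - 1"] \<open>f \<le> n - 1\<close> n_pos hn by simp
  qed
  have hnn: "0 \<le> ?h i" if "0 \<le> i" "i \<le> n" for i
    using hpos[of i] that by (cases "i = 0") auto
  have dv: "is_dyck v"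
  proof (rule is_dyckI[OF perv ones_eq_if_height[OF kn]])
    fix i assume "1 \<le> i" "i \<le> n"
    then show "0 \<le> ?k i" using kk[of "i - 1"] hnn[of "i - 1"] ge[of "i - 1"] by auto
  qed
  \<comment> \<open>\<open>new\<close> is the rotation of \<open>{1..n}\<close>, and
    \<open>newk\<close> is what it does to \<open>prev_low\<close>: for the block of
    \<open>n\<close> it becomes 0, as this block now contains 1; every other one moves by
    one.\<close>
  define new where "new = (\<lambda>i. if i = n then 1 else i + 1 :: int)"
  define newk where "newk = (\<lambda>k. if k = f - 1 then 0 else k + 1 :: int)"
  have new_in: "1 \<le> new i" "new i \<le> n" if "1 \<le> i" "i \<le> n" for i using that n_pos by (auto simp: new_def)
  have key: "prev_low ?k (newk k) (new i)" if i: "1 \<le> i" "i \<le> n" and k: "0 \<le> k" "prev_low ?h k i" for i k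
  proof (cases "i = n")
    case True
    then have "k = f - 1" using k f prev_low_unique by blast
    then show ?thesis using True v1 word_iff_prev_low[of v 1] by (simp add: newk_def new_def)
  next
    case ni: False
    then have i': "i \<le> n - 1" using i by simp
    have ki: "k < i" using k by (simp add: prev_low_def)
    show ?thesis
    proof (cases "i < f")
      case True
      have "prev_low ?k (k + 1) (i + 1)"
        using prev_low_transfer[of k i ?k 1 ?h "int b"] kk True k i' by simp
      then show ?thesis using ki True ni by (simp add: newk_def new_def)
    next
      case fi: False
      \<comment> \<open>From \<open>f\<close> on the heights are at least \<open>a\<close>, which
        exceeds the height at \<open>f - 1\<close>; so a \<open>prev_low\<close> cannot lie further
        left than \<open>f - 1\<close>.\<close>
      then have "?h (f - 1) < ?h i" using lt ge[of i] i by simp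
      then have kf: "f - 1 \<le> k" using prev_low_ge[OF k(2)] fi by simp
      show ?thesis
      proof (cases "k = f - 1")
        case False
        then have "prev_low ?k (k + 1) (i + 1)"
          using prev_low_transfer[of k i ?k 1 ?h "- int a"] kk kf k i' f by simp
        then show ?thesis using False ni by (simp add: newk_def new_def)
      next
        case True
        have pos: "0 < ?k (i + 1)" using is_dyckD(3)[OF dv, of "i + 1"] i i' by simp
        have ki1: "?k (i + 1) = ?h i - int a" using kk[of i] i i' fi by simp
        \<comment> \<open>It bounds \<open>?k (i + 1)\<close> by \<open>?h (f - 1) + b - a\<close>,
          which is less than \<open>b\<close>, while the heights of \<open>v\<close> at
          \<open>1..f\<close> are at least \<open>b\<close>.\<close>
        have hif: "?h i \<le> ?h f"
          using k(2) True fi unfolding prev_low_def by (cases "i = f") auto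
        have "?k (i + 1) \<le> ?k l" if l: "0 < l" "l < i + 1" for l
        proof (cases "l - 1 < f")
          case True
          then have "?k l = ?h (l - 1) + int b" using kk[of "l - 1"] l i' by simp
          moreover have "0 \<le> ?h (l - 1)" using hnn[of "l - 1"] l i by simp
          ultimately show ?thesis using ki1 hif hf lt by simp
        next
          case False
          then have "?k l = ?h (l - 1) - int a" using kk[of "l - 1"] l i' by simp
          moreover have "?h i \<le> ?h (l - 1)" using k(2) False l kf \<open>k = f - 1\<close> by (simp add: prev_low_def)
          ultimately show ?thesis using ki1 by simp
        qed
        then have "prev_low ?k 0 (i + 1)" using pos i by (simp add: prev_low_def)
        then show ?thesis using True ni by (simp add: newk_def new_def)
      qed
    qed
  qed
  have same: "same_low ?k (new i) (new j) \<longleftrightarrow> same_low ?h i j"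
    if i: "1 \<le> i" "i \<le> n" and j: "1 \<le> j" "j \<le> n" for i j
  proof -
    obtain k where k: "0 \<le> k" "k < i" "prev_low ?h k i" using dyck_prev_low[OF u i] by auto
    obtain l where l: "0 \<le> l" "l < j" "prev_low ?h l j" using dyck_prev_low[OF u j] by auto
    have kl: "prev_low ?k (newk k) (new i)" "prev_low ?k (newk l) (new j)" using key i j k l by auto
    have "same_low ?k (new i) (new j) \<longleftrightarrow> newk k = newk l"
      using same_low_iff[OF kl(1)] kl(2) prev_low_unique by metis
    also have "\<dots> \<longleftrightarrow> k = l" using k l by (auto simp: newk_def)
    also have "\<dots> \<longleftrightarrow> same_low ?h i j" using same_low_iff[OF k(3)] l(3) prev_low_unique by metis
    finally show ?thesis .
  qed
  have "word_rel v i j \<longleftrightarrow> word_rel u (i - 1) (j - 1)" for i j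
  proof -
    define old where "old = (\<lambda>i. (i - 2) mod n + 1)"
    have old_in: "1 \<le> old i" "old i \<le> n" for i
      using n_pos pos_mod_bound[OF n_pos, of "i - 2"] pos_mod_sign[OF n_pos, of "i - 2"] unfolding old_def by linarith+
    have old_eq: "\<exists>t. old i = (i - 1) + t * n" for i
      by (rule exI[of _ "- ((i - 2) div n)"]) (simp add: old_def minus_div_mult_eq_mod[symmetric])
    have new_eq: "\<exists>t. new (old i) = i + t * n" for i
    proof -
      obtain t where "old i = (i - 1) + t * n" using old_eq by blast
      then show ?thesis
        by (cases "old i = n") (auto simp: new_def intro: exI[of _ t] exI[of _ "t - 1"] simp: algebra_simps)
    qed
    obtain t t' where t: "new (old i) = i + t * n" "new (old j) = j + t' * n" using new_eq by blast
    obtain s s' where s: "old i = (i - 1) + s * n" "old j = (j - 1) + s' * n" using old_eq by blast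
    have "word_rel v i j \<longleftrightarrow> word_rel v (new (old i)) (new (old j))"
      unfolding t using per_equiv_cong[OF per_equiv_word_rel[OF perv]] by simp
    also have "\<dots> \<longleftrightarrow> same_low ?k (new (old i)) (new (old j))"
      using dyck_rel_iff[OF dv] new_in old_in by simp
    also have "\<dots> \<longleftrightarrow> same_low ?h (old i) (old j)" using same old_in by simp
    also have "\<dots> \<longleftrightarrow> word_rel u (old i) (old j)" using dyck_rel_iff[OF u] old_in by simp
    also have "\<dots> \<longleftrightarrow> word_rel u (i - 1) (j - 1)"
      unfolding s using per_equiv_cong[OF per_equiv_word_rel[OF per]] by simp
    finally show ?thesis .
  qed
  then show ?thesis using that dv by blast
qed

lemma dyck_rotate_any:
  assumes "is_dyck u"
  obtains v where "is_dyck v" "\<And>i j. word_rel v i j \<longleftrightarrow> word_rel u (i + s) (j + s)"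
proof -
  have nat: "\<exists>v. is_dyck v \<and> (\<forall>i j. word_rel v i j \<longleftrightarrow> word_rel u (i - int d) (j - int d))" for d
  proof (induction d)
    case 0
    then show ?case using assms by auto
  next
    case (Suc d)
    then obtain v where v: "is_dyck v" "\<And>i j. word_rel v i j \<longleftrightarrow> word_rel u (i - int d) (j - int d)" by blast
    obtain w where "is_dyck w" "\<And>i j. word_rel w i j \<longleftrightarrow> word_rel v (i - 1) (j - 1)"
      using dyck_rotate[OF v(1)] by blast
    then show ?case using v(2) by (intro exI[of _ w]) (simp add: algebra_simps)
  qed
  define d where "d = nat ((-s) mod n)"
  have "int d = (-s) mod n" using n_pos by (simp add: d_def)
  then have d: "- int d = s + ((-s) div n) * n" by (simp add: minus_div_mult_eq_mod[symmetric])
  obtain v where v: "is_dyck v" "\<And>i j. word_rel v i j \<longleftrightarrow> word_rel u (i - int d) (j - int d)"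
    using nat by blast
  have "word_rel v i j \<longleftrightarrow> word_rel u (i + s) (j + s)" for i j
  proof -
    have e: "i - int d = i + s + ((-s) div n) * n" for i using d by linarith
    show ?thesis unfolding v(2) e
      by (rule per_equiv_cong[OF per_equiv_word_rel[OF is_dyckD(1)[OF assms]]])
  qed
  then show ?thesis using that v(1) by blast
qed

text \<open>Rotating \<open>i\<close> to 1 puts all four indices into one Dyck window, where 0 is
  the \<open>prev_low\<close> of the images of \<open>i\<close> and \<open>k\<close>. If the one of
  \<open>j\<close> and \<open>l\<close>, called \<open>d\<close>, were positive, the heights would
  satisfy \<open>k' \<le> d < l' \<le> k'\<close>.\<close>

lemma dyck_noncrossing:
  assumes u: "is_dyck u" and ord: "i < j" "j < k" "k < l" "l < i + n"
    and ik: "word_rel u i k" and jl: "word_rel u j l"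
  shows "word_rel u i j"
proof -
  obtain v where v: "is_dyck v" "\<And>x y. word_rel v x y \<longleftrightarrow> word_rel u (x + (i - 1)) (y + (i - 1))"
    using dyck_rotate_any[OF u, of "i - 1"] by blast
  let ?h = "height v"
  define j' k' l' where "j' = j - i + 1" and "k' = k - i + 1" and "l' = l - i + 1"
  have o: "1 < j'" "j' < k'" "k' < l'" "l' \<le> n" using ord by (auto simp: j'_def k'_def l'_def)
  have "word_rel v 1 k'" "word_rel v j' l'" using ik jl by (auto simp: v(2) j'_def k'_def l'_def)
  then have same: "same_low ?h 1 k'" "same_low ?h j' l'" using dyck_rel_iff[OF v(1)] o by auto
  obtain c where c: "0 \<le> c" "c < 1" "prev_low ?h c 1" using dyck_prev_low[OF v(1), of 1] o by auto
  obtain d where d: "0 \<le> d" "d < j'" "prev_low ?h d j'" using dyck_prev_low[OF v(1), of j'] o by auto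
  have ck: "prev_low ?h c k'" and dl: "prev_low ?h d l'" using same c d same_low_iff by blast+
  have kl: "?h l' \<le> ?h k'" using dl o d by (simp add: prev_low_def)
  have "d = c"
  proof (rule ccontr)
    assume "d \<noteq> c"
    then have "?h k' \<le> ?h d" using ck c d o by (simp add: prev_low_def)
    then show False using dl kl by (simp add: prev_low_def)
  qed
  then have "same_low ?h 1 j'" using c d same_low_iff by blast
  then have "word_rel v 1 j'" using dyck_rel_iff[OF v(1)] o by auto
  then show ?thesis by (simp add: v(2) j'_def)
qed

section \<open>Record lows and words with arbitrary cut\<close>

definition no_low :: "(int \<Rightarrow> bool) \<Rightarrow> int \<Rightarrow> bool" where
  "no_low u i \<longleftrightarrow> (\<forall>k < i. height u i \<le> height u k)"

lemma no_low_iff: "no_low u i \<longleftrightarrow> (\<forall>k. \<not> low u k i)"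
proof
  assume "no_low u i"
  then show "\<forall>k. \<not> low u k i" by (auto simp: no_low_def prev_low_def)
next
  assume *: "\<forall>k. \<not> low u k i"
  show "no_low u i"
    unfolding no_low_def
  proof (intro allI impI)
    fix k assume "k < i"
    show "height u i \<le> height u k"
    proof (rule ccontr)
      assume "\<not> height u i \<le> height u k"
      then obtain m where "low u m i" using prev_low_exists[OF \<open>k < i\<close>, of "height u"] by auto
      then show False using * by blast
    qed
  qed
qed

lemma no_low_periodic: "periodic m u \<Longrightarrow> no_low u (i + t * m) \<longleftrightarrow> no_low u i"
proof -
  assume per: "periodic m u"
  have e: "low u k (i + t * m) \<longleftrightarrow> low u (k - t * m) i" for k
    using prev_low_periodic[OF per, of "k - t * m" t i] by simp
  show ?thesis unfolding no_low_iff e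
  proof
    assume *: "\<forall>k. \<not> low u (k - t * m) i"
    show "\<forall>k. \<not> low u k i"
    proof
      fix k show "\<not> low u k i" using spec[OF *, of "k + t * m"] by simp
    qed
  qed blast
qed

lemma no_low_same: "no_low u i \<Longrightarrow> same u i j \<longleftrightarrow> no_low u j"
  unfolding no_low_iff same_low_def by blast

lemma height_min:
  assumes "periodic m u" "m > 0"
  obtains r where "0 \<le> r" "r < m" "\<And>k. height u r \<le> height u (k mod m)"
proof -
  have "finite {0..<m}" "{0..<m} \<noteq> {}" using assms by auto
  then obtain r where "is_arg_min (height u) (\<lambda>x. x \<in> {0..<m}) r"
    using ex_is_arg_min_if_finite by blast
  then have "r \<in> {0..<m}" "\<And>k. k \<in> {0..<m} \<Longrightarrow> height u r \<le> height u k"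
    by (auto simp: is_arg_min_linorder)
  then show ?thesis using that[of r] assms by simp
qed

lemma height_mod: "periodic m u \<Longrightarrow> height u k = height u (k mod m) + (k div m) * height u m"
  using height_periodic_mult[of m u "k mod m" "k div m"] by simp

text \<open>If the drift is not positive, earlier periods are at least as high as later ones, so a
  minimum over one period is a record low. Translating it by periods puts one into every window of
  length \<open>m\<close>.\<close>

lemma no_low_exists:
  assumes "periodic m u" "m > 0" "height u m \<le> 0"
  obtains x where "i - m \<le> x" "x < i" "no_low u x"
proof -
  obtain r where r: "0 \<le> r" "r < m" "\<And>k. height u r \<le> height u (k mod m)"
    using height_min[OF assms(1,2)] by blast
  have "no_low u r"
    unfolding no_low_def
  proof (intro allI impI)
    fix k assume "k < r"
    then have "k div m \<le> 0"
      using r(2) assms(2) zdiv_mono1[of k "m - 1" m] div_pos_pos_trivial[of "m - 1" m] by simp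
    then have "0 \<le> (k div m) * height u m" using assms(3) by (rule mult_nonpos_nonpos)
    then show "height u r \<le> height u k" using height_mod[OF assms(1), of k] r(3)[of k] by linarith
  qed
  define x where "x = r + ((i - 1 - r) div m) * m"
  have "x = i - 1 - (i - 1 - r) mod m" by (simp add: x_def minus_mod_eq_div_mult[symmetric])
  moreover have "0 \<le> (i - 1 - r) mod m" "(i - 1 - r) mod m < m" using assms by auto
  ultimately have "i - m \<le> x" "x < i" by linarith+
  moreover have "no_low u x" using \<open>no_low u r\<close> no_low_periodic[OF assms(1)] unfolding x_def by blast
  ultimately show ?thesis using that by blast
qed

text \<open>With \<open>a\<close> North steps per period the heights drift upwards, so a cut at an overall minimum of the
  heights to its right gives a Dyck word.\<close>

lemma up_word:
  assumes per: "periodic n u" and on: "ones u n = int a"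
  obtains v where "is_dyck v" "word_rel v = word_rel u"
proof -
  have hn: "height u n = int a" using on height_ones[of n u] n_pos by (simp add: algebra_simps)
  obtain r where r: "0 \<le> r" "r < n" "\<And>k. height u r \<le> height u (k mod n)"
    using height_min[OF per n_pos] by blast
  have min: "height u r \<le> height u k" if "r \<le> k" for k
  proof -
    have "0 \<le> k div n" using that r n_pos by (simp add: pos_imp_zdiv_nonneg_iff)
    then have "0 \<le> (k div n) * height u n" using hn by simp
    then show ?thesis using height_mod[OF per, of k] r(3)[of k] by linarith
  qed
  define w where "w = (\<lambda>i. u (i + r))"
  have hw: "height w i = height u (i + r) - height u r" for i unfolding w_def by (rule height_shift)
  have "is_dyck w"
  proof (rule is_dyckI)
    show "periodic n w"
      unfolding periodic_def w_def
    proof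
      fix i show "u (i + n + r) = u (i + r)"
        using spec[OF per[unfolded periodic_def], of "i + r"] by (simp add: algebra_simps)
    qed
    have "height w n = int a" using hw[of n] height_periodic[OF per, of r] hn by (simp add: add.commute)
    then show "ones w n = int a" by (rule ones_eq_if_height)
    show "0 \<le> height w i" if "1 \<le> i" for i using hw[of i] min[of "i + r"] that by simp
  qed
  \<comment> \<open>Cutting at \<open>r\<close> has shifted the partition by \<open>r\<close>;
    rotating back gives a further Dyck word for the partition of \<open>u\<close> itself.\<close>
  then obtain v where "is_dyck v" "\<And>i j. word_rel v i j \<longleftrightarrow> word_rel w (i + - r) (j + - r)"
    using dyck_rotate_any[of w "-r"] by blast
  moreover have "word_rel w (i + - r) (j + - r) \<longleftrightarrow> word_rel u i j" for i j
    using word_rel_shift[of u r "i - r" "j - r"] unfolding w_def by simp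
  ultimately show ?thesis using that[of v] by (simp add: fun_eq_iff)
qed

text \<open>With \<open>a - 1\<close> North steps per period the heights drift downwards; at a record low \<open>x\<close> the step ending at
  \<open>x\<close> is replaced by North. The record lows then become the first block.\<close>

lemma down_word:
  assumes per: "periodic n u" and on: "ones u n = int a - 1"
  obtains v where "is_dyck v" "word_rel v = word_rel u"
proof -
  let ?g = "height u"
  have gn: "?g n = - int b" using height_ones[of n u] n_pos unfolding on by (simp add: algebra_simps)
  obtain x where x: "no_low u x" using no_low_exists[OF per n_pos, of 0] gn by auto
  have xn: "no_low u (x + n)" using x no_low_periodic[OF per, of x 1] by simp
  have uxn: "\<not> u (x + n)" using xn word_iff_prev_low no_low_iff by blast
  have gxn: "?g (x + n) = ?g x - int b" using height_periodic[OF per, of x] gn by simp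
  define w where "w = periodic_ext n (\<lambda>i. if i = 1 then True else u (x + i - 1))"
  let ?h = "height w"
  have perw: "periodic n w" unfolding w_def by (rule periodic_periodic_ext)
  have w1: "w 1" unfolding w_def using n_pos by (subst periodic_ext_eq) auto
  have wi: "w i = u (i + (x - 1))" if "1 < i" "i \<le> n" for i
    unfolding w_def using that by (subst periodic_ext_eq) (auto simp: algebra_simps)
  have h1: "?h 1 = int b" using height_step[of w 1] w1 by (simp add: step_height_def)
  have hg: "?g (i + (x - 1)) = ?h i + (?g x - int b)" if "1 \<le> i" "i \<le> n" for i
    using height_agree[of 1 i u "x - 1" w] wi that h1 by simp
  \<comment> \<open>Index \<open>n\<close> of \<open>w\<close> is index \<open>x + n - 1\<close> of
    \<open>u\<close>, just before the East step into the next record low \<open>x + n\<close>, whose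
    height corresponds to 0 in \<open>w\<close>.\<close>
  have hn: "?h n = int a"
  proof -
    have "?g (x + n) = ?g (n + (x - 1)) - int a"
      using height_step[of u "x + n"] uxn by (simp add: step_height_def algebra_simps)
    then show ?thesis using hg[of n] gxn n_pos by simp
  qed
  have dw: "is_dyck w"
  proof (rule is_dyckI[OF perw ones_eq_if_height[OF hn]])
    fix i assume i: "1 \<le> i" "i \<le> n"
    have "?g (x + n) \<le> ?g (i + (x - 1))" using xn i by (simp add: no_low_def)
    then show "0 \<le> ?h i" using hg[OF i] gxn by simp
  qed
  have low_ge: "x \<le> k" if "prev_low ?g k y" "x \<le> y" for k y
  proof (rule ccontr)
    assume "\<not> x \<le> k"
    then have "?g x \<le> ?g k" using x by (simp add: no_low_def)
    moreover have "?g y \<le> ?g x" using that \<open>\<not> x \<le> k\<close> by (cases "x = y") (auto simp: prev_low_def)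
    ultimately show False using that by (simp add: prev_low_def)
  qed
  have low1: "prev_low ?h (k - (x - 1)) i"
    if i: "1 \<le> i" "i \<le> n" and k: "prev_low ?g k (i + (x - 1))" for i k
  proof -
    have "x \<le> k" using low_ge[OF k] i by simp
    then show ?thesis
      using prev_low_transfer[of "k - (x - 1)" i ?g "x - 1" ?h "?g x - int b"] hg i k by simp
  qed
  \<comment> \<open>Index 0 of \<open>w\<close> has height 0, below the rest of the window because
    \<open>w\<close> is Dyck. A record low is minimal so far in the window, so nothing after 0 is
    smaller.\<close>
  have low2: "prev_low ?h 0 i" if i: "1 \<le> i" "i \<le> n" and k: "no_low u (i + (x - 1))" for i
  proof -
    have "?h i \<le> ?h l" if l: "0 < l" "l < i" for l
    proof -
      have "?g (i + (x - 1)) \<le> ?g (l + (x - 1))" using k l by (simp add: no_low_def)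
      then show ?thesis using hg[of i] hg[of l] l i by simp
    qed
    then show ?thesis using is_dyckD(3)[OF dw] i by (simp add: prev_low_def)
  qed
  have same: "same_low ?h i j \<longleftrightarrow> word_rel u (i + (x - 1)) (j + (x - 1))"
    if i: "1 \<le> i" "i \<le> n" and j: "1 \<le> j" "j \<le> n" for i j
  proof
    assume s: "same_low ?h i j"
    have "same_low ?g (i + (x - 1)) (j + (x - 1))"
    proof (cases "no_low u (i + (x - 1))")
      case True
      then have "prev_low ?h 0 j" using low2[OF i] s same_low_iff by blast
      then have pj: "prev_low ?h 0 j" .
      have "no_low u (j + (x - 1))"
        unfolding no_low_iff
      proof (intro allI notI)
        fix k assume k: "prev_low ?g k (j + (x - 1))"
        have "x \<le> k" using low_ge[OF k] j by simp
        then show False using prev_low_unique[OF low1[OF j k] pj] by simp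
      qed
      then show ?thesis using True no_low_same by blast
    next
      case False
      then obtain k where k: "prev_low ?g k (i + (x - 1))" unfolding no_low_iff by blast
      have xk: "x \<le> k" using low_ge[OF k] i by simp
      have pj: "prev_low ?h (k - (x - 1)) j" using low1[OF i k] s same_low_iff by blast
      have "\<not> no_low u (j + (x - 1))"
      proof
        assume "no_low u (j + (x - 1))"
        then show False using prev_low_unique[OF low2[OF j] pj] xk by simp
      qed
      then obtain l where l: "prev_low ?g l (j + (x - 1))" unfolding no_low_iff by blast
      then have "l = k" using prev_low_unique[OF low1[OF j l] pj] by simp
      then show ?thesis using k l same_low_iff by blast
    qed
    then show "word_rel u (i + (x - 1)) (j + (x - 1))"
      by (rule same_word_rel)
  next
    assume "word_rel u (i + (x - 1)) (j + (x - 1))"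
    then obtain t where t: "same_low ?g (i + (x - 1)) (j + (x - 1) + t * n)"
      unfolding word_rel_def low_rel_def by blast
    show "same_low ?h i j"
    proof (cases "no_low u (i + (x - 1))")
      case True
      then have "no_low u (j + (x - 1) + t * n)" using t no_low_same by blast
      then have "no_low u (j + (x - 1))" using no_low_periodic[OF per] by blast
      then show ?thesis using low2 True i j same_low_iff by blast
    next
      case False
      then obtain k where k: "prev_low ?g k (i + (x - 1))" unfolding no_low_iff by blast
      then have kt: "prev_low ?g k (j + (x - 1) + t * n)" using t same_low_iff by blast
      then have l: "prev_low ?g (k - t * n) (j + (x - 1))"
        using prev_low_periodic[OF per, of "k - t * n" t "j + (x - 1)"] by simp
      have "x \<le> k" "x \<le> k - t * n" using low_ge k l i j by auto
      moreover have "k < i + (x - 1)" "k - t * n < j + (x - 1)" using k l by (auto simp: prev_low_def)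
      ultimately have "t = 0" using i j by (intro residue_eq_zero[of "k - x" "k - t * n - x" t n]) auto
      then have "prev_low ?h (k - (x - 1)) j" using low1[OF j] l by simp
      then show ?thesis using low1[OF i k] same_low_iff by blast
    qed
  qed
  have rel: "word_rel w i j \<longleftrightarrow> word_rel u (i + (x - 1)) (j + (x - 1))" for i j
  proof -
    define r where "r = (\<lambda>i. (i - 1) mod n + 1)"
    have r_in: "1 \<le> r i" "r i \<le> n" for i
      using pos_mod_bound[OF n_pos, of "i - 1"] pos_mod_sign[OF n_pos, of "i - 1"] unfolding r_def by linarith+
    have r_eq: "r i = i + (- ((i - 1) div n)) * n" for i
      by (simp add: r_def minus_div_mult_eq_mod[symmetric])
    have r_eq': "r i + (x - 1) = i + (x - 1) + (- ((i - 1) div n)) * n" for i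
      using r_eq[of i] by linarith
    have "word_rel w i j \<longleftrightarrow> word_rel w (r i) (r j)"
      unfolding r_eq by (rule per_equiv_cong[OF per_equiv_word_rel[OF perw], symmetric])
    also have "\<dots> \<longleftrightarrow> word_rel u (r i + (x - 1)) (r j + (x - 1))"
      using dyck_rel_iff[OF dw] r_in same by simp
    also have "\<dots> \<longleftrightarrow> word_rel u (i + (x - 1)) (j + (x - 1))"
      unfolding r_eq' by (rule per_equiv_cong[OF per_equiv_word_rel[OF per]])
    finally show ?thesis .
  qed
  obtain v where "is_dyck v" "\<And>i j. word_rel v i j \<longleftrightarrow> word_rel w (i + (1 - x)) (j + (1 - x))"
    using dyck_rotate_any[OF dw, of "1 - x"] by blast
  moreover have "word_rel w (i + (1 - x)) (j + (1 - x)) \<longleftrightarrow> word_rel u i j" for i j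
    using rel[of "i + (1 - x)" "j + (1 - x)"] by simp
  ultimately show ?thesis using that[of v] by (simp add: fun_eq_iff)
qed

section \<open>Recovering a word of short period from its partition\<close>

lemma prev_low_window:
  assumes per: "periodic p u" "p > 0" "height u p \<noteq> 0" and k: "low u k i"
  shows "i - p \<le> k"
\<comment> \<open>With upward drift \<open>i - p\<close> itself is lower than \<open>i\<close>. With
  downward drift a record low among the last \<open>p\<close> indices blocks everything to its
  left.\<close>
proof (cases "height u p > 0")
  case True
  have "height u (i - p) < height u i" using height_periodic[OF per(1), of "i - p"] True by simp
  then show ?thesis using prev_low_ge[OF k] per by simp
next
  case False
  then obtain x where x: "i - p \<le> x" "x < i" "no_low u x" using no_low_exists[OF per(1,2), of i] by auto
  have "x \<le> k"
  proof (rule ccontr)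
    assume "\<not> x \<le> k"
    then have "height u i \<le> height u x" "height u x \<le> height u k"
      using k x by (auto simp: prev_low_def no_low_def)
    then show False using k by (simp add: prev_low_def)
  qed
  then show ?thesis using x by simp
qed

text \<open>A North step at \<open>i\<close> opens its block. An equivalent \<open>k\<close> among
  the \<open>p\<close> predecessors would have some \<open>i + t * n - 1\<close> with
  \<open>t < 0\<close> as its \<open>prev_low\<close>, more than \<open>p\<close> steps back since
  \<open>n \<ge> 2 * p\<close>, against \<open>prev_low_window\<close>. Conversely, an index reached
  by an East step is either a record low, like \<open>i - p\<close>, or lies in a block that starts
  at most \<open>p\<close> steps earlier.\<close>

lemma word_recover:
  assumes per: "periodic p u" "p > 0" "height u p \<noteq> 0" and pern: "periodic n u" and p2: "2 * p \<le> n"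
  shows "u i \<longleftrightarrow> (\<forall>k. i - p \<le> k \<and> k < i \<longrightarrow> \<not> word_rel u k i)"
proof
  assume ui: "u i"
  show "\<forall>k. i - p \<le> k \<and> k < i \<longrightarrow> \<not> word_rel u k i"
  proof (intro allI impI notI)
    fix k assume k: "i - p \<le> k \<and> k < i" and R: "word_rel u k i"
    define N where "N = n"
    have N: "2 * p \<le> N" "0 < N" using p2 n_pos by (auto simp: N_def)
    obtain t where t: "same u k (i + t * N)" using R unfolding word_rel_def low_rel_def N_def by blast
    have "u (i + t * N)" using ui periodic_mult[OF pern] by (simp add: N_def)
    then have "low u (i + t * N - 1) (i + t * N)" using word_iff_prev_low by simp
    then have q: "low u (i + t * N - 1) k" using t by (simp add: same_low_def)
    have lo: "k - p \<le> i + t * N - 1" using prev_low_window[OF per q] .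
    have "i + t * N - 1 < k" using q by (simp add: prev_low_def)
    then have "t * N < 1 * N" using k N(1) per(2) N(2) by linarith
    then have "t < 1" using N(2) mult_less_cancel_right_pos by blast
    have "t \<noteq> 0" using \<open>i + t * N - 1 < k\<close> k by auto
    then have "t * N \<le> (-1) * N" using \<open>t < 1\<close> N(2) by (intro mult_right_mono) auto
    then show False using lo k N(1) per(2) by linarith
  qed
next
  assume *: "\<forall>k. i - p \<le> k \<and> k < i \<longrightarrow> \<not> word_rel u k i"
  show "u i"
  proof (cases "no_low u i")
    case True
    then have "no_low u (i - p)" using no_low_periodic[OF per(1), of "i - p" 1] by simp
    then have "same u (i - p) i" using True no_low_same by blast
    then have "word_rel u (i - p) i" by (rule same_word_rel)
    then show ?thesis using * per(2) by simp
  next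
    case False
    then obtain k where k: "low u k i" unfolding no_low_iff by blast
    have "same u (k + 1) i" using prev_low_Suc[OF k] k same_low_iff by blast
    then have "word_rel u (k + 1) i" by (rule same_word_rel)
    moreover have "i - p \<le> k" using prev_low_window[OF per k] .
    ultimately have "\<not> k + 1 < i" using * by auto
    then have "k = i - 1" using k by (simp add: prev_low_def)
    then show ?thesis using k word_iff_prev_low by simp
  qed
qed

text \<open>The Dyck word obtained by cutting at \<open>c\<close> tests \<open>y\<close> against
  \<open>{c..<y}\<close>, while \<open>first_word\<close> looks back \<open>p\<close> steps,
  possibly beyond \<open>c\<close>. An index \<open>k < c\<close> equivalent to \<open>y\<close>
  would, as \<open>k + n\<close>, cross the pair \<open>c\<close>, \<open>i\<close> and force
  \<open>c\<close> to be equivalent to \<open>y\<close>. So the two tests agree for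
  \<open>c < y \<le> i\<close>, and on this stretch \<open>u\<close> has the heights of a Dyck word
  up to a constant.\<close>

lemma first_word_hull:
  assumes v: "is_dyck v" and p: "p > 0" "2 * p \<le> n"
    and R: "word_rel v c i" "c \<le> i" "i \<le> c + p"
  defines "u \<equiv> first_word p (word_rel v)"
  shows "\<And>k. c \<le> k \<Longrightarrow> k < i \<Longrightarrow> height u i \<le> height u k"
    and "u c \<Longrightarrow> low u (c - 1) i"
proof -
  obtain w where w: "is_dyck w" "\<And>x y. word_rel w x y \<longleftrightarrow> word_rel v (x + (c - 1)) (y + (c - 1))"
    using dyck_rotate_any[OF v, of "c - 1"] by blast
  note eq = per_equiv_word_rel[OF is_dyckD(1)[OF v]]
  have agree: "u (z + (c - 1)) = w z" if z: "1 < z" "z \<le> i - c + 1" for z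
  proof -
    define y where "y = z + (c - 1)"
    have y: "c < y" "y \<le> i" "z = y - c + 1" using z by (auto simp: y_def)
    have "w z \<longleftrightarrow> (\<forall>k. 1 \<le> k \<and> k < z \<longrightarrow> \<not> word_rel v (k + (c - 1)) y)"
      using dyck_first_iff[OF w(1), of z] y z R p unfolding w(2) y_def by simp
    also have "\<dots> \<longleftrightarrow> (\<forall>k. c \<le> k \<and> k < y \<longrightarrow> \<not> word_rel v k y)"
    proof
      assume *: "\<forall>k. 1 \<le> k \<and> k < z \<longrightarrow> \<not> word_rel v (k + (c - 1)) y"
      show "\<forall>k. c \<le> k \<and> k < y \<longrightarrow> \<not> word_rel v k y"
      proof (intro allI impI)
        fix k assume "c \<le> k \<and> k < y"
        then show "\<not> word_rel v k y" using spec[OF *, of "k - (c - 1)"] y by simp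
      qed
    next
      assume *: "\<forall>k. c \<le> k \<and> k < y \<longrightarrow> \<not> word_rel v k y"
      show "\<forall>k. 1 \<le> k \<and> k < z \<longrightarrow> \<not> word_rel v (k + (c - 1)) y"
      proof (intro allI impI)
        fix k assume "1 \<le> k \<and> k < z"
        then show "\<not> word_rel v (k + (c - 1)) y" using spec[OF *, of "k + (c - 1)"] y by simp
      qed
    qed
    also have "\<dots> \<longleftrightarrow> u y"
    proof
      assume "u y"
      then show "\<forall>k. c \<le> k \<and> k < y \<longrightarrow> \<not> word_rel v k y"
        using y R unfolding u_def first_word_def by auto
    next
      assume *: "\<forall>k. c \<le> k \<and> k < y \<longrightarrow> \<not> word_rel v k y"
      then have nc: "\<not> word_rel v c y" using y by simp
      then have yi: "y < i" using R y by (cases "y = i") auto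
      show "u y"
        unfolding u_def first_word_def
      proof (intro allI impI notI)
        fix k assume k: "y - p \<le> k \<and> k < y" and ky: "word_rel v k y"
        then have kc: "k < c" using * by (meson not_le)
        have "word_rel v y (k + n)" using ky eq unfolding per_equiv_def by blast
        then have "word_rel v c y"
          using dyck_noncrossing[OF v, of c y i "k + n"] R y yi k kc p by simp
        then show False using nc by simp
      qed
    qed
    finally show ?thesis by (simp add: y_def)
  qed
  define i' where "i' = i - c + 1"
  have i': "1 \<le> i'" "i' \<le> n" using R p by (auto simp: i'_def)
  have hh: "height u (z + (c - 1)) = height w z + (height u c - height w 1)" if "1 \<le> z" "z \<le> i'" for z
    using height_agree[of 1 z u "c - 1" w] agree that by (simp add: i'_def)
  have w1: "w 1" using dyck_first_iff[OF w(1), of 1] n_pos by auto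
  then have pw: "low w 0 1" using word_iff_prev_low[of w 1] by simp
  have "word_rel w 1 i'" using R by (simp add: w(2) i'_def)
  then have low: "low w 0 i'"
    using dyck_rel_iff[OF w(1), of 1 i'] i' same_low_iff[OF pw] by simp
  have hi: "height u i = height w i' + (height u c - height w 1)" using hh[of i'] i' by (simp add: i'_def)
  show 1: "height u i \<le> height u k" if "c \<le> k" "k < i" for k
    using hh[of "k - (c - 1)"] hi low that by (simp add: i'_def prev_low_def)
  show "low u (c - 1) i" if "u c"
  proof -
    have "height u c = height u (c - 1) + int b" using height_step[of u c] that by (simp add: step_height_def)
    moreover have "height w 1 = int b" using height_step[of w 1] w1 by (simp add: step_height_def)
    ultimately have "height u (c - 1) < height u i" using hi low by (simp add: prev_low_def)
    then show ?thesis using 1 R by (simp add: prev_low_def)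
  qed
qed

text \<open>A block contains \<open>i\<close> and \<open>i + p\<close> for one of its elements \<open>i\<close> iff it is invariant under rotation by
  \<open>p\<close>. By noncrossingness there is at most one such block, and every other block fits in a window of
  length \<open>p\<close>, on which the word agrees with the Dyck word of a suitable rotation.\<close>

lemma first_word_rel:
  assumes v: "is_dyck v" and p: "p > 0" "2 * p \<le> n"
    and inv: "\<And>i j. word_rel v (i + p) (j + p) \<longleftrightarrow> word_rel v i j"
  shows "word_rel (first_word p (word_rel v)) = word_rel v"
proof -
  define R where "R = word_rel v"
  define u where "u = first_word p R"
  define N where "N = n"
  let ?g = "height u"
  have pN: "2 * p \<le> N" using p by (simp add: N_def)
  have inv: "R (i + p) (j + p) \<longleftrightarrow> R i j" for i j using inv by (simp add: R_def)
  have eq: "per_equiv N R" unfolding R_def N_def by (rule per_equiv_word_rel[OF is_dyckD(1)[OF v]])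
  have perN: "periodic n u"
    unfolding u_def by (rule periodic_first_word) (use per_equiv_cong[OF eq, of _ 1 _ 1] in \<open>simp add: N_def\<close>)
  have R_refl: "R i i" and R_sym: "R i j \<Longrightarrow> R j i" and R_trans: "R i j \<Longrightarrow> R j k \<Longrightarrow> R i k" for i j k
    using eq unfolding per_equiv_def by blast+
  have nonx: "R i j" if "i < j" "j < k" "k < l" "l < i + N" "R i k" "R j l" for i j k l
    using dyck_noncrossing[OF v, of i j k l] that by (simp add: R_def N_def)
  note hull = first_word_hull[OF v p, folded R_def, folded u_def]
  define cen where "cen = (\<lambda>i. R i (i + p))"
  have cen_cong: "cen j" if "cen i" "R i j" for i j
    using that inv[of i j] R_sym R_trans unfolding cen_def by blast
  have cen_shift: "cen (i + t * p) \<and> R i (i + t * p)" if "cen i" for i t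
  proof (induction t rule: int_induct[where k = 0])
    case base
    then show ?case using that R_refl by simp
  next
    case (step1 t)
    have e: "i + (t + 1) * p = i + t * p + p" by (simp add: algebra_simps)
    have "R (i + t * p) (i + t * p + p)" using step1 by (simp add: cen_def)
    then show ?case unfolding e using step1 cen_cong R_trans by blast
  next
    case (step2 t)
    have e: "i + (t - 1) * p = i + t * p - p" by (simp add: algebra_simps)
    have "R (i + t * p - p) (i + t * p)" using step2 inv[of "i + t * p - p" "i + t * p"] by (simp add: cen_def)
    then show ?case unfolding e using step2 cen_cong R_trans R_sym by blast
  qed
  \<comment> \<open>A step back by \<open>p\<close> stays in the block and does not lower the
    height, and \<open>hull\<close> bounds the heights in between; so every \<open>k < i\<close> is
    reached by induction on its distance.\<close>
  have cen_no_low: "no_low u i" if "cen i" for i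
  proof -
    have "?g i \<le> ?g k" if "cen i" "k < i" "i - k \<le> int m" for i k m
      using that
    proof (induction m arbitrary: i)
      case (Suc m)
      have c: "cen (i - p)" "R (i - p) i" using cen_shift[OF Suc.prems(1), of "-1"] R_sym by auto
      show ?case
      proof (cases "i - p \<le> k")
        case True
        then show ?thesis using hull(1)[of "i - p" i k] c Suc.prems p by simp
      next
        case False
        then have "?g (i - p) \<le> ?g k" using Suc.IH[of "i - p"] c Suc.prems p by simp
        moreover have "?g i \<le> ?g (i - p)" using hull(1)[of "i - p" i "i - p"] c p by simp
        ultimately show ?thesis by simp
      qed
    qed simp
    then have "?g i \<le> ?g k" if "k < i" for k
      using that \<open>cen i\<close> by (metis (no_types) int_nat_eq less_imp_le diff_ge_0_iff_ge order_refl)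
    then show ?thesis unfolding no_low_def by blast
  qed
  have noncen: "\<exists>c. R c i \<and> u c \<and> prev_low ?g (c - 1) i" if nc: "\<not> cen i" for i
  proof -
    define S where "S = {k \<in> {i - p..i}. R k i}"
    have "finite S" by (rule finite_subset[of _ "{i - p..i}"]) (auto simp: S_def)
    moreover have "i \<in> S" using R_refl p by (simp add: S_def)
    ultimately obtain c where c: "c \<in> S" "\<And>k. k \<in> S \<Longrightarrow> c \<le> k"
      using Min_in[of S] Min_le[of S] by (metis empty_iff)
    have Rc: "R c i" "i - p \<le> c" "c \<le> i" using c(1) by (auto simp: S_def)
    have icp: "i < c + p"
    proof (rule ccontr)
      assume "\<not> i < c + p"
      then have "i = c + p" using Rc by simp
      then have "cen c" using Rc by (simp add: cen_def)
      then show False using cen_cong Rc nc by blast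
    qed
    \<comment> \<open>Otherwise \<open>c\<close> is equivalent to some \<open>k\<close> in
      \<open>{c - p..<c}\<close>, and \<open>k < i - p\<close> by the choice of \<open>c\<close>.
      Then \<open>k + p\<close> equals \<open>c\<close>, or \<open>k + p\<close> and
      \<open>c + p\<close> cross \<open>c\<close> and \<open>i\<close>. Either way \<open>k\<close>
      and \<open>k + p\<close> are equivalent, so the block would be central.\<close>
    have "u c"
      unfolding u_def first_word_def
    proof (intro allI impI notI)
      fix k assume k: "c - p \<le> k \<and> k < c" and kc: "R k c"
      have "k \<notin> S" using c(2)[of k] k by auto
      then have ki: "k < i - p" using R_trans[OF kc Rc(1)] k Rc by (auto simp: S_def)
      have kp: "R (k + p) (c + p)" using kc inv by simp
      have "R c (k + p)"
      proof (cases "k + p = c")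
        case True
        then show ?thesis using R_refl by simp
      next
        case False
        then show ?thesis using nonx[of c "k + p" i "c + p"] k ki Rc kp pN p(1) icp by simp
      qed
      then have "R k (k + p)" using kc R_trans by blast
      then have "cen k" by (simp add: cen_def)
      then show False using cen_cong R_trans[OF kc Rc(1)] nc by blast
    qed
    moreover have "prev_low ?g (c - 1) i" using hull(2)[of c i] Rc \<open>u c\<close> by simp
    ultimately show ?thesis using Rc by blast
  qed
  \<comment> \<open>Moving \<open>j\<close> by multiples of \<open>p\<close> brings it within
    distance \<open>p\<close> of \<open>i\<close>; then the pairs formed with the translates by
    \<open>p\<close> cross.\<close>
  have cen_rel: "R i j" if ci: "cen i" and cj: "cen j" for i j
  proof -
    define j' where "j' = i + (j - i) mod p"
    have j': "j' = j + (- ((j - i) div p)) * p" by (simp add: j'_def minus_div_mult_eq_mod[symmetric])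
    have c': "cen j'" "R j j'" using cen_shift[OF cj] unfolding j' by blast+
    have b: "i \<le> j'" "j' < i + p"
      using pos_mod_bound[OF p(1), of "j - i"] pos_mod_sign[OF p(1), of "j - i"] unfolding j'_def by linarith+
    have "R i j'"
    proof (cases "i = j'")
      case False
      then show ?thesis using nonx[of i j' "i + p" "j' + p"] b ci c' pN by (simp add: cen_def)
    qed (simp add: R_refl)
    then show ?thesis using c' R_sym R_trans by blast
  qed
  have "low_rel n ?g i j \<longleftrightarrow> R i j" for i j
  proof
    assume "low_rel n ?g i j"
    then obtain t where t: "same_low ?g i (j + t * N)" unfolding low_rel_def N_def by blast
    have Rj: "R j (j + t * N)" by (rule per_equiv_mult[OF eq])
    have "R i (j + t * N)"
    proof (cases "cen i")
      case True
      then have "no_low u (j + t * N)" using cen_no_low no_low_same t by blast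
      then have "cen (j + t * N)" using noncen no_low_iff by blast
      then show ?thesis using cen_rel True by blast
    next
      case False
      then obtain c where c: "R c i" "prev_low ?g (c - 1) i" using noncen by blast
      then have cj: "prev_low ?g (c - 1) (j + t * N)" using t same_low_iff by blast
      then have "\<not> cen (j + t * N)" using cen_no_low no_low_iff by blast
      then obtain d where d: "R d (j + t * N)" "prev_low ?g (d - 1) (j + t * N)" using noncen by blast
      then have "d = c" using prev_low_unique[OF cj d(2)] by simp
      then show ?thesis using c d R_sym R_trans by blast
    qed
    then show "R i j" using Rj R_sym R_trans by blast
  next
    assume Rij: "R i j"
    show "low_rel n ?g i j"
    proof (cases "cen i")
      case True
      then have "same_low ?g i j" using cen_cong Rij cen_no_low no_low_same by blast
      then show ?thesis unfolding low_rel_def by (intro exI[of _ 0]) simp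
    next
      case False
      then have "\<not> cen j" using cen_cong Rij R_sym by blast
      obtain c where c: "R c i" "u c" "prev_low ?g (c - 1) i" using noncen False by blast
      obtain d where d: "R d j" "u d" "prev_low ?g (d - 1) j" using noncen \<open>\<not> cen j\<close> by blast
      define t where "t = - ((d - c) div N)"
      define e where "e = d + t * N"
      have e: "e = c + (d - c) mod N" by (simp add: e_def t_def minus_div_mult_eq_mod[symmetric])
      have N0: "0 < N" using n_pos by (simp add: N_def)
      have eb: "c \<le> e" "e < c + N"
        using pos_mod_bound[OF N0, of "d - c"] pos_mod_sign[OF N0, of "d - c"] unfolding e by linarith+
      have "R d e" unfolding e_def by (rule per_equiv_mult[OF eq])
      then have ce: "R c e" using c d Rij R_sym R_trans by blast
      have ue: "u e" unfolding e_def using d(2) periodic_mult[OF perN, of d t] by (simp add: N_def)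
      \<comment> \<open>Distinct North steps of one block are more than \<open>p\<close> apart on
        both sides of the cycle. Then the pairs \<open>c\<close>, \<open>e\<close> and
        \<open>c + p\<close>, \<open>e + p\<close> cross, and the block would be central.\<close>
      have "e = c"
      proof (rule ccontr)
        assume ne: "e \<noteq> c"
        have "\<not> e - p \<le> c"
          using ue ce eb ne unfolding u_def first_word_def by auto
        then have "c < e - p" by simp
        have "R c (c + N)" using per_equiv_mult[OF eq, of c 1] by simp
        then have "R e (c + N)" using R_trans[OF R_sym[OF ce]] by blast
        moreover have "u (c + N)" using c(2) periodic_mult[OF perN, of c 1] by (simp add: N_def)
        ultimately have "\<not> c + N - p \<le> e"
          using eb unfolding u_def first_word_def by auto
        then have "R c (c + p)"
          using nonx[of c "c + p" e "e + p"] \<open>c < e - p\<close> p(1) ce inv[of c e] by simp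
        then have "cen c" by (simp add: cen_def)
        then show False using cen_cong c(1) False by blast
      qed
      then have "prev_low ?g (d - 1 + t * n) (j + t * n) = prev_low ?g (c - 1) (j + t * n)"
        unfolding e_def N_def by (simp add: algebra_simps)
      then have "prev_low ?g (c - 1) (j + t * n)" using d(3) prev_low_periodic[OF perN, of "d - 1" t j] by simp
      then have "same_low ?g i (j + t * n)" using c(3) same_low_iff by blast
      then show ?thesis unfolding low_rel_def by blast
    qed
  qed
  then have "word_rel u = R" unfolding word_rel_def by (simp add: fun_eq_iff)
  then show ?thesis by (simp add: u_def R_def)
qed

section \<open>Counting blocks and invariant partitions\<close>

lemma card_blocks:
  assumes per: "periodic n u"
  shows "int (card (cyc_part (nat n) (word_rel u))) = ones u n + of_bool (\<exists>i. no_low u i)"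
proof -
  let ?g = "height u" and ?B = "block (nat n) (word_rel u)"
  have N: "int (nat n) = n" "nat n > 0" using n_pos by auto
  have eq: "per_equiv (int (nat n)) (word_rel u)" using per_equiv_word_rel[OF per] N by simp
  have beq: "?B i = ?B j \<longleftrightarrow> word_rel u i j" for i j by (rule block_eq_iff[OF eq N(2)])
  have same_rel: "word_rel u i j" if "same_low ?g i j" for i j
    using that by (rule same_word_rel)
  \<comment> \<open>A block that does not consist of record lows has exactly one North index modulo
    \<open>n\<close>, its first element. So \<open>F\<close> represents these blocks, and
    \<open>C\<close> yields at most one more.\<close>
  define F where "F = {i \<in> {1..n}. u i}"
  define C where "C = {i. no_low u i}"
  have "cyc_part (nat n) (word_rel u) = ?B ` F \<union> ?B ` C"
  proof -
    have "?B i \<in> ?B ` F \<union> ?B ` C" for i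
    proof (cases "no_low u i")
      case False
      then obtain k where k: "prev_low ?g k i" unfolding no_low_iff by blast
      have k1: "prev_low ?g k (k + 1)" using prev_low_Suc[OF k] .
      define r where "r = k mod n + 1"
      have r: "r = k + 1 + (- (k div n)) * n" by (simp add: r_def minus_div_mult_eq_mod[symmetric])
      have "u (k + 1)" using k1 word_iff_prev_low[of u "k + 1"] by simp
      then have "u r" unfolding r using periodic_mult[OF per] by blast
      moreover have "r \<in> {1..n}"
        using pos_mod_bound[OF n_pos, of k] pos_mod_sign[OF n_pos, of k] unfolding r_def by simp
      ultimately have "r \<in> F" by (simp add: F_def)
      moreover have "word_rel u i r"
      proof -
        have "word_rel u i (k + 1)" using k k1 same_low_iff same_rel by blast
        then show ?thesis
          unfolding r using per_equiv_cong[OF per_equiv_word_rel[OF per], of i 0 "k + 1" "- (k div n)"] by simp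
      qed
      ultimately show ?thesis using beq by blast
    qed (simp add: C_def)
    then show ?thesis unfolding cyc_part_eq_blocks[OF eq N(2)] by blast
  qed
  moreover have "card (?B ` F) = card F"
  proof (rule card_image, rule inj_onI)
    fix i j assume ij: "i \<in> F" "j \<in> F" "?B i = ?B j"
    then obtain t where t: "same_low ?g i (j + t * n)" using beq unfolding word_rel_def low_rel_def by blast
    have "prev_low ?g (i - 1) i" using ij word_iff_prev_low by (simp add: F_def)
    moreover have "prev_low ?g (j + t * n - 1) (j + t * n)"
      using ij periodic_mult[OF per, of j t] word_iff_prev_low[of u "j + t * n"] by (simp add: F_def)
    ultimately have e: "i - 1 = j + t * n - 1" using t same_low_iff prev_low_unique by blast
    then have "t = 0" using ij by (intro residue_eq_zero[of "i - 1" "j - 1" t n]) (auto simp: F_def)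
    then show "i = j" using e by simp
  qed
  moreover have "card (?B ` C) = of_bool (\<exists>i. no_low u i)"
  proof (cases "\<exists>i. no_low u i")
    case True
    then obtain x where x: "no_low u x" by blast
    have "?B ` C = {?B x}"
    proof
      show "?B ` C \<subseteq> {?B x}"
        using beq same_rel no_low_same x unfolding C_def by blast
    qed (use x in \<open>simp add: C_def\<close>)
    then show ?thesis using True by simp
  next
    case False
    then show ?thesis by (simp add: C_def)
  qed
  moreover have "?B ` F \<inter> ?B ` C = {}"
  proof (rule ccontr)
    assume "?B ` F \<inter> ?B ` C \<noteq> {}"
    then obtain i j where ij: "i \<in> F" "j \<in> C" "?B i = ?B j" by blast
    then obtain t where t: "same_low ?g i (j + t * n)" using beq unfolding word_rel_def low_rel_def by blast
    have "no_low u (j + t * n)" using ij no_low_periodic[OF per] by (simp add: C_def)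
    then have "no_low u i" using t no_low_same same_low_sym by blast
    then show False using ij word_iff_prev_low[of u i] by (auto simp: F_def no_low_iff)
  qed
  moreover have "finite (?B ` F)" "finite (?B ` C)"
  proof -
    have "finite F" by (rule finite_subset[of _ "{1..n}"]) (auto simp: F_def)
    then show "finite (?B ` F)" by simp
    have "?B ` C \<subseteq> Pow {1..nat n}" by (auto simp: block_def)
    then show "finite (?B ` C)" by (rule finite_subset) simp
  qed
  ultimately show ?thesis by (simp add: card_Un_disjoint ones_card F_def)
qed

definition N :: nat where "N = a + b - 1"

lemma int_N: "int N = n" and N_pos: "N > 0" and nat_n: "nat n = N"
  using a_pos b_pos by (auto simp: N_def of_nat_diff)

abbreviation "word_part u \<equiv> cyc_part N (word_rel u)"

definition dyck_parts :: "nat set set set" where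
  "dyck_parts = word_part ` {u. is_dyck u}"

abbreviation "fixed_parts d \<equiv> {x \<in> dyck_parts. (rotate_partition N ^^ d) x = x}"

lemma cyc_part_word_rel_inject:
  assumes "periodic n u" "periodic n v"
  shows "word_part u = word_part v \<longleftrightarrow> word_rel u = word_rel v"
  using cyc_part_inject[of N "word_rel u" "word_rel v"] per_equiv_word_rel assms int_N N_pos by simp

lemma rotate_word_rel_fixed_iff:
  assumes per: "periodic n u"
  shows "(rotate_partition N ^^ d) (word_part u) = word_part u \<longleftrightarrow>
    (\<forall>i j. word_rel u (i + int d) (j + int d) \<longleftrightarrow> word_rel u i j)" (is "?L \<longleftrightarrow> ?R")
proof -
  have eq: "per_equiv (int N) (word_rel u)" using per_equiv_word_rel[OF per] int_N by simp
  have eq': "per_equiv (int N) (\<lambda>i j. word_rel u (i - int d) (j - int d))"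
    using per_equiv_shift[OF eq, of "- int d"] by simp
  have "?L \<longleftrightarrow> (\<forall>i j. word_rel u (i - int d) (j - int d) \<longleftrightarrow> word_rel u i j)"
    using rotate_cyc_part_funpow[OF eq N_pos] cyc_part_inject[OF eq' eq N_pos] by (simp add: fun_eq_iff)
  also have "\<dots> \<longleftrightarrow> ?R"
  proof
    assume *: "\<forall>i j. word_rel u (i - int d) (j - int d) \<longleftrightarrow> word_rel u i j"
    show ?R
    proof (intro allI)
      fix i j show "word_rel u (i + int d) (j + int d) \<longleftrightarrow> word_rel u i j"
        using spec[OF spec[OF *, of "i + int d"], of "j + int d"] by simp
    qed
  next
    assume *: ?R
    show "\<forall>i j. word_rel u (i - int d) (j - int d) \<longleftrightarrow> word_rel u i j"
    proof (intro allI)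
      fix i j show "word_rel u (i - int d) (j - int d) \<longleftrightarrow> word_rel u i j"
        using spec[OF spec[OF *, of "i - int d"], of "j - int d"] by simp
    qed
  qed
  finally show ?thesis .
qed

text \<open>The shifts that preserve the relation form a subgroup of the integers containing
  \<open>n\<close>, so \<open>d\<close> belongs to it iff \<open>gcd d N\<close> does.\<close>

lemma rotate_fixed_gcd:
  assumes per: "periodic n u"
  shows "(rotate_partition N ^^ d) (word_part u) = word_part u \<longleftrightarrow>
    (rotate_partition N ^^ gcd d N) (word_part u) = word_part u"
  unfolding rotate_word_rel_fixed_iff[OF per]
proof
  let ?R = "word_rel u"
  have eq: "per_equiv (int N) ?R" using per_equiv_word_rel[OF per] int_N by simp
  assume inv: "\<forall>i j. ?R (i + int d) (j + int d) \<longleftrightarrow> ?R i j"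
  obtain x y where xy: "x * int d + y * int N = gcd (int d) (int N)" using bezout_int by blast
  show "\<forall>i j. ?R (i + int (gcd d N)) (j + int (gcd d N)) \<longleftrightarrow> ?R i j"
  proof (intro allI)
    fix i j
    have e: "i + int (gcd d N) = i + x * int d + y * int N" for i using xy by simp
    show "?R (i + int (gcd d N)) (j + int (gcd d N)) \<longleftrightarrow> ?R i j"
      unfolding e per_equiv_cong[OF eq] using shift_invariant_mult[of ?R "int d"] inv by simp
  qed
next
  let ?R = "word_rel u"
  assume inv: "\<forall>i j. ?R (i + int (gcd d N)) (j + int (gcd d N)) \<longleftrightarrow> ?R i j"
  obtain k where k: "d = gcd d N * k" using dvdE[OF gcd_dvd1] by blast
  have "int d = int k * int (gcd d N)" by (subst k) simp
  then show "\<forall>i j. ?R (i + int d) (j + int d) \<longleftrightarrow> ?R i j"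
    using shift_invariant_mult[of ?R "int (gcd d N)"] inv by simp
qed

lemma dyck_card_blocks:
  assumes "is_dyck v"
  shows "card (word_part v) = a"
proof -
  have per: "periodic n v" using is_dyckD[OF assms] by simp
  have "\<not> no_low v i" for i
  proof -
    have "height v (i - n) < height v i"
      using height_periodic[OF per, of "i - n"] is_dyckD(2)[OF assms] a_pos by simp
    then show ?thesis using n_pos by (auto simp: no_low_def intro!: exI[of _ "i - n"])
  qed
  then show ?thesis
    using card_blocks[OF per] assms unfolding nat_n is_dyck_def by simp
qed

text \<open>Injectivity is \<open>word_recover\<close>, and \<open>up_word\<close> and
  \<open>down_word\<close> show that the images are Dyck partitions. For surjectivity take
  \<open>first_word\<close>: Dyck partitions have \<open>a\<close> blocks, so by
  \<open>card_blocks\<close> it has \<open>a\<close> or \<open>a - 1\<close> North steps.\<close>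

lemma card_fixed_words:
  fixes p e :: nat
  assumes p: "p > 0" and e: "e \<ge> 2" and pe: "p * e = N"
  shows "card (fixed_parts p) =
    card {u. periodic (int p) u \<and> (ones u n = int a \<or> ones u n = int a - 1)}"
proof -
  let ?W = "{u. periodic (int p) u \<and> (ones u n = int a \<or> ones u n = int a - 1)}"
  let ?X = "fixed_parts p"
  let ?f = "\<lambda>u. word_part u"
  have n_eq: "n = int e * int p" using pe int_N by (metis mult.commute of_nat_mult)
  have p2: "2 * int p \<le> n" unfolding n_eq using e by (intro mult_right_mono) auto
  have perW: "periodic n u" if "u \<in> ?W" for u using that periodic_multiple[of "int p" u "int e"] n_eq by simp
  \<comment> \<open>Over \<open>n\<close> steps the height changes by \<open>a\<close> or by
    \<open>- b\<close>; the nonzero drift is what \<open>prev_low_window\<close> requires.\<close>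
  have hW: "height u (int p) \<noteq> 0" if u: "u \<in> ?W" for u
  proof
    assume "height u (int p) = 0"
    then have "height u n = 0" using height_periodic_mult[of "int p" u 0 "int e"] u n_eq by simp
    moreover have "height u n = (int a + int b) * ones u n - int a * n" using height_ones[of n u] n_pos by simp
    ultimately have "(int a + int b) * ones u n = int a * n" by simp
    moreover have "(int a + int b) * int a \<noteq> int a * n" "(int a + int b) * (int a - 1) \<noteq> int a * n"
      using a_pos b_pos by (auto simp: algebra_simps)
    ultimately show False using u by auto
  qed
  have "bij_betw ?f ?W ?X"
    unfolding bij_betw_def
  proof
    show "inj_on ?f ?W"
    proof (rule inj_onI)
      fix u v assume uv: "u \<in> ?W" "v \<in> ?W" "?f u = ?f v"
      then have rel: "word_rel u = word_rel v" using cyc_part_word_rel_inject perW by blast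
      have recover: "first_word (int p) (word_rel u) = u" if "u \<in> ?W" for u
      proof
        fix i
        have "periodic (int p) u" "0 < int p" using that p by auto
        then show "first_word (int p) (word_rel u) i = u i"
          unfolding first_word_def using word_recover[OF _ _ hW[OF that] perW[OF that] p2, of i] by blast
      qed
      have "u = first_word (int p) (word_rel u)" by (rule recover[OF uv(1), symmetric])
      also have "\<dots> = first_word (int p) (word_rel v)" by (simp only: rel)
      also have "\<dots> = v" by (rule recover[OF uv(2)])
      finally show "u = v" .
    qed
    show "?f ` ?W = ?X"
    proof
      show "?f ` ?W \<subseteq> ?X"
      proof
        fix x assume "x \<in> ?f ` ?W"
        then obtain u where u: "u \<in> ?W" "x = ?f u" by blast
        obtain v where v: "is_dyck v" "word_rel v = word_rel u"
          using up_word[OF perW[OF u(1)]] down_word[OF perW[OF u(1)]] u(1) by blast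
        have "x \<in> dyck_parts"
          unfolding dyck_parts_def u(2) v(2)[symmetric] using v(1) by (intro imageI) simp
        moreover have "(\<lambda>i. u (i + int p)) = u" using u by (simp add: periodic_def)
        then have "word_rel u (i + int p) (j + int p) \<longleftrightarrow> word_rel u i j" for i j
          using word_rel_shift[of u "int p" i j] by simp
        then have "(rotate_partition N ^^ p) x = x"
          using rotate_word_rel_fixed_iff[OF perW[OF u(1)], of p] u by simp
        ultimately show "x \<in> ?X" by simp
      qed
      show "?X \<subseteq> ?f ` ?W"
      proof
        fix x assume x: "x \<in> ?X"
        then obtain v where v: "is_dyck v" "x = ?f v" unfolding dyck_parts_def by blast
        have inv: "word_rel v (i + int p) (j + int p) \<longleftrightarrow> word_rel v i j" for i j
          using rotate_word_rel_fixed_iff[OF is_dyckD(1)[OF v(1)], of p] x v by simp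
        define u where "u = first_word (int p) (word_rel v)"
        have rel: "word_rel u = word_rel v" unfolding u_def using first_word_rel[OF v(1) _ p2 inv] p by simp
        have perp: "periodic (int p) u" unfolding u_def by (rule periodic_first_word) (rule inv)
        then have per: "periodic n u" using periodic_multiple[of "int p" u "int e"] n_eq by simp
        have "int a = ones u n + of_bool (\<exists>i. no_low u i)"
          using card_blocks[OF per] dyck_card_blocks[OF v(1)] rel nat_n by simp
        then have "u \<in> ?W" using perp by (cases "\<exists>i. no_low u i") auto
        then show "x \<in> ?f ` ?W" using v rel by (intro image_eqI[of _ _ u]) auto
      qed
    qed
  qed
  then show ?thesis by (rule bij_betw_same_card[symmetric])
qed

text \<open>Since \<open>ones u n\<close> is \<open>e\<close> times the count in one period,
  \<open>e\<close> must divide \<open>a\<close> or \<open>a - 1\<close>. As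
  \<open>e \<ge> 2\<close>, at most one of these happens, and the count in a period is
  \<open>a div e\<close> in both cases.\<close>

lemma card_fixed:
  fixes p e :: nat
  assumes p: "p > 0" and e: "e \<ge> 2" and pe: "p * e = N"
  shows "card (fixed_parts p) =
    (if a mod e \<le> 1 then p choose (a div e) else 0)"
proof -
  have n_eq: "n = int e * int p" using pe int_N by (metis mult.commute of_nat_mult)
  have on: "ones u n = int e * ones u (int p)" if "periodic (int p) u" for u
  proof -
    have "height u n = int e * height u (int p)"
      using height_periodic_mult[OF that, of 0 "int e"] n_eq by simp
    then have "(int a + int b) * ones u n - int a * n = int e * ((int a + int b) * ones u (int p) - int a * int p)"
      using height_ones[of n u] height_ones[of "int p" u] n_pos by simp
    then have "(int a + int b) * ones u n = (int a + int b) * (int e * ones u (int p))"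
      unfolding n_eq by (simp add: algebra_simps)
    then show ?thesis using a_pos by (simp only: mult_cancel_left) auto
  qed
  have key: "(int e * s = int a \<or> int e * s = int a - 1) \<longleftrightarrow> a mod e \<le> 1 \<and> s = int (a div e)" for s
  proof
    assume *: "int e * s = int a \<or> int e * s = int a - 1"
    have "\<exists>r. int a = int e * s + int r \<and> r \<le> 1"
      using * by (elim disjE) (auto intro: exI[of _ 0] exI[of _ 1])
    then obtain r where r: "int a = int e * s + int r" "r \<le> 1" by blast
    have "int a div int e = s" "int a mod int e = int r"
      using r(2) e unfolding r(1) by (auto simp: div_add1_eq)
    then have "int (a div e) = s" "int (a mod e) = int r" by (simp_all add: zdiv_int zmod_int)
    then show "a mod e \<le> 1 \<and> s = int (a div e)" using r by simp
  next
    assume *: "a mod e \<le> 1 \<and> s = int (a div e)"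
    have "int a = int e * int (a div e) + int (a mod e)"
      by (metis mult_div_mod_eq of_nat_add of_nat_mult)
    then show "int e * s = int a \<or> int e * s = int a - 1" using * by (cases "a mod e = 0") auto
  qed
  have "{u. periodic (int p) u \<and> (ones u n = int a \<or> ones u n = int a - 1)} =
    (if a mod e \<le> 1 then {u. periodic (int p) u \<and> ones u (int p) = int (a div e)} else {})"
  proof -
    have "(periodic (int p) u \<and> (ones u n = int a \<or> ones u n = int a - 1)) \<longleftrightarrow>
      a mod e \<le> 1 \<and> periodic (int p) u \<and> ones u (int p) = int (a div e)" for u
    proof (cases "periodic (int p) u")
      case True
      show ?thesis unfolding on[OF True] key using True by blast
    qed simp
    then show ?thesis by auto
  qed
  then show ?thesis
    unfolding card_fixed_words[OF assms] using card_words(1)[of "int p" "a div e"] p by simp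
qed

section \<open>Counting all Dyck partitions\<close>

lemma inj_on_dyck: "inj_on word_part {u. is_dyck u}"
proof (rule inj_onI)
  fix u v assume uv: "u \<in> {u. is_dyck u}" "v \<in> {u. is_dyck u}"
    and "word_part u = word_part v"
  then have rel: "word_rel u = word_rel v" using cyc_part_word_rel_inject is_dyckD(1) by blast
  have "u i = v i" if "1 \<le> i" "i \<le> n" for i
    using dyck_first_iff[of u i] dyck_first_iff[of v i] rel uv that by simp
  moreover have "1 \<le> (i - 1) mod n + 1" "(i - 1) mod n + 1 \<le> n" for i
    using pos_mod_bound[OF n_pos, of "i - 1"] pos_mod_sign[OF n_pos, of "i - 1"] by linarith+
  ultimately have "u ((i - 1) mod n + 1) = v ((i - 1) mod n + 1)" for i by blast
  then show "u = v"
    using periodic_mod[of n u] periodic_mod[of n v] is_dyckD(1) uv by (auto simp: fun_eq_iff)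
qed

text \<open>Cycle lemma: each rotation class of words with \<open>a\<close> North and \<open>b\<close> East steps has \<open>a + b\<close>
  elements, exactly one of which is a Dyck path.\<close>

lemma card_dyck: "card {u. is_dyck u} * (a + b) = (a + b) choose a"
proof -
  define L where "L = int a + int b"
  have L: "L = n + 1" "L > 0" using n_pos by (auto simp: L_def)
  let ?shift = "\<lambda>(w, r). (\<lambda>i :: int. w (i + r) :: bool)"
  \<comment> \<open>This puts the omitted East step back at index \<open>L\<close>, which gives the
    whole path, repeated with period \<open>L\<close> and drift 0.\<close>
  let ?ext = "\<lambda>u. periodic_ext L (\<lambda>i. i \<le> n \<and> u i)"
  let ?W = "{w. periodic L w \<and> ones w L = int a}"
  define G where "G = {w \<in> ?W. \<forall>i. 0 \<le> height w i}"
  have hL: "height w L = 0 \<longleftrightarrow> ones w L = int a" for w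
    using height_ones[of L w] L(2) unfolding L_def by auto
  \<comment> \<open>This yields uniqueness in the cycle lemma: if two rotations of one word are both
    nonnegative, they differ by an index of height 0.\<close>
  have hz: "L dvd i" if w: "w \<in> G" "height w i = 0" for w i
  proof -
    have per: "periodic L w" and h0: "height w L = 0" using w hL by (auto simp: G_def)
    have "height w (i mod L) = 0" using height_mod[OF per, of i] h0 w by simp
    then have "L * ones w (i mod L) = int a * (i mod L)"
      using height_ones[of "i mod L" w] L(2) by (simp add: L_def)
    moreover have "coprime L (int a)"
      unfolding L_def by (rule coprime_int_add[OF coprime_ab])
    ultimately have "L dvd i mod L" by (metis coprime_dvd_mult_right_iff dvd_triv_left)
    then show ?thesis using dvd_mod_iff[of L L i] by simp
  qed
  have "bij_betw ?shift (G \<times> {0..<L}) ?W"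
    unfolding bij_betw_def
  proof
    show "inj_on ?shift (G \<times> {0..<L})"
    proof (rule inj_onI, clarify)
      fix w r w' r' assume G: "w \<in> G" "w' \<in> G" and r: "r \<in> {0..<L}" "r' \<in> {0..<L}"
        and eq: "(\<lambda>i. w (i + r)) = (\<lambda>i. w' (i + r'))"
      define s where "s = r - r'"
      have w': "w' = (\<lambda>i. w (i + s))"
      proof
        fix i show "w' i = w (i + s)" using fun_cong[OF eq, of "i - r'"] by (simp add: s_def algebra_simps)
      qed
      have "height w' (-s) = - height w s" unfolding w' height_shift by simp
      moreover have "0 \<le> height w' (-s)" "0 \<le> height w s" using G by (auto simp: G_def)
      ultimately have "height w s = 0" by linarith
      then have "L dvd s" using hz G by blast
      then have "s = 0" using r zdvd_imp_le[of L "\<bar>s\<bar>"] L(2) by (cases "s = 0") (auto simp: s_def)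
      then show "w = w' \<and> r = r'" using w' by (simp add: s_def)
    qed
    show "?shift ` (G \<times> {0..<L}) = ?W"
    proof
      have sh: "(\<lambda>i. w (i + r)) \<in> ?W" if w: "w \<in> ?W" for w r
      proof -
        have per: "periodic L w" using w by simp
        have "periodic L (\<lambda>i. w (i + r))"
          unfolding periodic_def
        proof
          fix i show "w (i + L + r) = w (i + r)"
            using spec[OF per[unfolded periodic_def], of "i + r"] by (simp add: algebra_simps)
        qed
        moreover have "height (\<lambda>i. w (i + r)) L = 0"
          using height_shift[of w r L] height_periodic[OF per, of r] w hL by (simp add: add.commute)
        ultimately show ?thesis using hL by simp
      qed
      show "?shift ` (G \<times> {0..<L}) \<subseteq> ?W" using sh by (auto simp: G_def)
      show "?W \<subseteq> ?shift ` (G \<times> {0..<L})"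
      proof
        fix s assume s: "s \<in> ?W"
        then have per: "periodic L s" and h0: "height s L = 0" using hL by auto
        obtain r where r: "0 \<le> r" "r < L" "\<And>k. height s r \<le> height s (k mod L)"
          using height_min[OF per L(2)] by blast
        define w where "w = (\<lambda>i. s (i + r))"
        have "height s r \<le> height s i" for i using r(3)[of i] height_mod[OF per, of i] h0 by simp
        then have "w \<in> G" using sh[OF s] unfolding G_def w_def by (simp add: height_shift)
        moreover have "s = (\<lambda>i. w (i + (-r) mod L))"
        proof
          fix i
          have "(-r) mod L + r = (- ((-r) div L)) * L" by (simp add: minus_div_mult_eq_mod[symmetric])
          then have "i + (-r) mod L + r = i + (- ((-r) div L)) * L" by linarith
          then show "s i = w (i + (-r) mod L)" using periodic_mult[OF per] unfolding w_def by metis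
        qed
        moreover have "(-r) mod L \<in> {0..<L}" using L(2) by simp
        ultimately show "s \<in> ?shift ` (G \<times> {0..<L})"
          by (intro image_eqI[of _ _ "(w, (-r) mod L)"]) auto
      qed
    qed
  qed
  then have "card ?W = card (G \<times> {0..<L})" by (rule bij_betw_same_card[symmetric])
  moreover have "card ?W = (a + b) choose a" using card_words(1)[OF L(2), of a] by (simp add: L_def nat_int_add)
  ultimately have cG: "card G * (a + b) = (a + b) choose a" by (simp add: card_cartesian_product L_def nat_int_add)
  have "bij_betw (\<lambda>u. ?ext u) {u. is_dyck u} G"
  proof (rule bij_betwI[where g = "periodic_ext n"])
    show "(\<lambda>u. ?ext u) \<in> {u. is_dyck u} \<rightarrow> G"
    proof
      fix u assume "u \<in> {u. is_dyck u}"
      then have u: "is_dyck u" by simp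
      define w where "w = ?ext u"
      have wi: "w i \<longleftrightarrow> i \<le> n \<and> u i" if "1 \<le> i" "i \<le> L" for i
        unfolding w_def using periodic_ext_eq[OF that] by simp
      have per: "periodic L w" unfolding w_def by (rule periodic_periodic_ext)
      have h: "height w i = height u i" if "0 \<le> i" "i \<le> n" for i
        using height_agree[of 0 i w 0 u] wi that L by simp
      have hwL: "height w L = 0"
        using height_step[of w L] wi[of L] L h[of n] is_dyckD(2)[OF u] n_pos by (simp add: step_height_def)
      have "0 \<le> height w i" for i
      proof -
        have "0 \<le> height w (i mod L)"
        proof (cases "i mod L = 0")
          case False
          moreover have "0 \<le> i mod L" "i mod L < L" using L(2) by auto
          ultimately have "1 \<le> i mod L" "i mod L \<le> n" using L(1) by linarith+
          then show ?thesis using h[of "i mod L"] is_dyckD(3)[OF u, of "i mod L"] by simp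
        qed simp
        then show ?thesis using height_mod[OF per, of i] hwL by simp
      qed
      then show "?ext u \<in> G"
        unfolding w_def[symmetric] G_def using per hwL hL by simp
    qed
    show "periodic_ext n \<in> G \<rightarrow> {u. is_dyck u}"
    proof
      fix w assume w: "w \<in> G"
      have h: "height (periodic_ext n w) i = height w i" if "0 \<le> i" "i \<le> n" for i
        using height_agree[of 0 i w 0 "periodic_ext n w"] that by (simp add: periodic_ext_eq)
      have "height w L = 0" using w hL by (auto simp: G_def)
      moreover have "height w n \<ge> 0" using w by (simp add: G_def)
      ultimately have "height w n = int a"
        using height_step[of w L] L b_pos by (cases "w L") (auto simp: step_height_def)
      then have "height (periodic_ext n w) n = int a" using h[of n] n_pos by simp
      then show "periodic_ext n w \<in> {u. is_dyck u}"
        using is_dyckI[OF periodic_periodic_ext[of n w] ones_eq_if_height] h w by (simp add: G_def)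
    qed
    show "periodic_ext n (?ext u) = u" if "u \<in> {u. is_dyck u}" for u
    proof
      fix i
      define m where "m = (i - 1) mod n + 1"
      have "1 \<le> m" "m \<le> n"
        using pos_mod_bound[OF n_pos, of "i - 1"] pos_mod_sign[OF n_pos, of "i - 1"] unfolding m_def by linarith+
      then have "?ext u m = u m" using L by (subst periodic_ext_eq) auto
      then show "periodic_ext n (?ext u) i = u i"
        unfolding periodic_ext_def[of n] m_def[symmetric]
        using periodic_mod[of n u i] that is_dyckD(1) m_def by simp
    qed
    show "periodic_ext L (\<lambda>i. i \<le> n \<and> periodic_ext n w i) = w" if w: "w \<in> G" for w
    proof
      fix i
      define m where "m = (i - 1) mod L + 1"
      have m: "1 \<le> m" "m \<le> L"
        using pos_mod_bound[OF L(2), of "i - 1"] pos_mod_sign[OF L(2), of "i - 1"] unfolding m_def by linarith+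
      have "\<not> w L"
      proof
        assume "w L"
        moreover have "height w L = 0" using w hL by (auto simp: G_def)
        moreover have "height w (L - 1) \<ge> 0" using w by (simp add: G_def)
        ultimately show False using height_step[of w L] b_pos by (simp add: step_height_def)
      qed
      then have "(m \<le> n \<and> periodic_ext n w m) = w m"
        using m L periodic_ext_eq[of m n w] by (cases "m = L") auto
      then show "periodic_ext L (\<lambda>i. i \<le> n \<and> periodic_ext n w i) i = w i"
        unfolding periodic_ext_def[of L] m_def[symmetric]
        using periodic_mod[of L w i] w m_def by (simp add: G_def)
    qed
  qed
  then have "card {u. is_dyck u} = card G" by (rule bij_betw_same_card)
  then show ?thesis using cG by simp
qed

lemma card_dyck_parts: "card dyck_parts * (fact a * fact b) = fact (a + b - 1)"
proof -
  have "card dyck_parts = card {u. is_dyck u}"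
    unfolding dyck_parts_def using card_image[OF inj_on_dyck] .
  then have "card dyck_parts * (fact a * fact b) * (a + b) = fact (a + b)"
    using card_dyck binomial_fact_lemma[of a "a + b"] by (simp add: algebra_simps)
  also have "\<dots> = fact (a + b - 1) * (a + b)" using a_pos fact_reduce[of "a + b", where 'a = nat] by simp
  finally show ?thesis using a_pos by simp
qed

lemma finite_dyck_parts: "finite dyck_parts"
  unfolding dyck_parts_def
proof (rule finite_imageI, rule finite_subset)
  show "{u. is_dyck u} \<subseteq> {u. periodic n u \<and> ones u n = int a}" by (auto simp: is_dyck_def)
  show "finite {u. periodic n u \<and> ones u n = int a}" by (rule card_words(2)[OF n_pos])
qed

lemma rotate_dyck_parts: "bij_betw (rotate_partition N) dyck_parts dyck_parts"
  and rotate_dyck_parts_funpow: "x \<in> dyck_parts \<Longrightarrow> (rotate_partition N ^^ N) x = x"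
proof -
  have *: "rotate_partition N x \<in> dyck_parts \<and> (rotate_partition N ^^ N) x = x" if x: "x \<in> dyck_parts" for x
  proof -
    obtain u where u: "is_dyck u" "x = word_part u" using x unfolding dyck_parts_def by blast
    have per: "per_equiv (int N) (word_rel u)" using per_equiv_word_rel is_dyckD(1)[OF u(1)] int_N by simp
    obtain v where v: "is_dyck v" "\<And>i j. word_rel v i j \<longleftrightarrow> word_rel u (i - 1) (j - 1)"
      using dyck_rotate[OF u(1)] by blast
    have "rotate_partition N x = word_part v"
      unfolding u(2) rotate_cyc_part[OF per N_pos] v(2)[symmetric] by (simp add: eta_contract_eq)
    moreover have "(rotate_partition N ^^ N) x = x"
      unfolding u(2) using rotate_word_rel_fixed_iff[OF is_dyckD(1)[OF u(1)], of N]
        per_equiv_cong[OF per, of _ 1 _ 1] by simp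
    ultimately show ?thesis using v(1) unfolding dyck_parts_def by blast
  qed
  then show "x \<in> dyck_parts \<Longrightarrow> (rotate_partition N ^^ N) x = x" by blast
  obtain M where M: "N = Suc M" using N_pos by (cases N) auto
  have "inj_on (rotate_partition N) dyck_parts"
  proof (rule inj_onI)
    fix x y assume xy: "x \<in> dyck_parts" "y \<in> dyck_parts" "rotate_partition N x = rotate_partition N y"
    have "(rotate_partition N ^^ N) x = (rotate_partition N ^^ N) y"
      using xy(3) funpow_Suc_right[of M "rotate_partition N"] by (simp add: M[symmetric])
    then show "x = y" using * xy by simp
  qed
  moreover have "rotate_partition N ` dyck_parts \<subseteq> dyck_parts" using * by blast
  ultimately show "bij_betw (rotate_partition N) dyck_parts dyck_parts"
    using finite_dyck_parts by (simp add: bij_betw_def endo_inj_surj)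
qed

end

section \<open>Unimodality of Gaussian binomials\<close>

text \<open>Gaussian elimination: one equation is solved for a variable \<open>a0\<close> and
  substituted into the others. Solutions vanish off \<open>A\<close> so that they can serve as
  vectors indexed by all subsets later.\<close>

lemma homogeneous_system_nontrivial:
  fixes M :: "'b \<Rightarrow> 'a \<Rightarrow> real"
  assumes "finite B" "finite A" "card B < card A"
  shows "\<exists>x. (\<exists>a\<in>A. x a \<noteq> 0) \<and> (\<forall>a. a \<notin> A \<longrightarrow> x a = 0) \<and> (\<forall>b\<in>B. (\<Sum>a\<in>A. M b a * x a) = 0)"
  using assms
proof (induction B arbitrary: A M rule: finite_induct)
  case empty
  then obtain a where "a \<in> A" by (metis card.empty ex_in_conv less_irrefl)
  then show ?case by (intro exI[of _ "\<lambda>x. if x = a then 1 else 0"]) auto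
next
  case (insert b B)
  show ?case
  proof (cases "\<forall>a\<in>A. M b a = 0")
    case True
    obtain x where "\<exists>a\<in>A. x a \<noteq> 0" "\<forall>a. a \<notin> A \<longrightarrow> x a = 0" "\<forall>b\<in>B. (\<Sum>a\<in>A. M b a * x a) = 0"
      using insert.IH[of A M] insert.prems insert.hyps by auto
    then show ?thesis using True by (intro exI[of _ x]) auto
  next
    case False
    then obtain a0 where a0: "a0 \<in> A" "M b a0 \<noteq> 0" by blast
    define A' where "A' = A - {a0}"
    have A': "finite A'" "A = insert a0 A'" "a0 \<notin> A'" using insert.prems a0 by (auto simp: A'_def)
    have cA: "card B < card A'" using insert.prems insert.hyps A' by simp
    define M' where "M' = (\<lambda>c a. M c a - M c a0 * M b a / M b a0)"
    obtain x where x: "\<exists>a\<in>A'. x a \<noteq> 0" "\<forall>a. a \<notin> A' \<longrightarrow> x a = 0" "\<forall>c\<in>B. (\<Sum>a\<in>A'. M' c a * x a) = 0"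
      using insert.IH[OF A'(1) cA, of M'] by blast
    define s where "s = (\<Sum>a\<in>A'. M b a * x a)"
    define y where "y = x(a0 := - s / M b a0)"
    have ysum: "(\<Sum>a\<in>A. M c a * y a) = (\<Sum>a\<in>A'. M c a * x a) - M c a0 * s / M b a0" for c
    proof -
      have "(\<Sum>a\<in>A'. M c a * y a) = (\<Sum>a\<in>A'. M c a * x a)"
        using A'(3) by (intro sum.cong) (auto simp: y_def)
      then show ?thesis using A' by (simp add: y_def)
    qed
    have "(\<Sum>a\<in>A. M c a * y a) = 0" if "c \<in> B" for c
    proof -
      have "(\<Sum>a\<in>A'. M' c a * x a) = (\<Sum>a\<in>A'. M c a * x a) - M c a0 / M b a0 * s"
        unfolding s_def sum_distrib_left sum_subtractf[symmetric] by (intro sum.cong) (auto simp: M'_def field_simps)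
      then show ?thesis using x(3) that ysum[of c] by simp
    qed
    moreover have "(\<Sum>a\<in>A. M b a * y a) = 0" using ysum[of b] a0 by (simp add: s_def)
    moreover have "\<exists>a\<in>A. y a \<noteq> 0" using x(1) A' by (auto simp: y_def)
    moreover have "\<forall>a. a \<notin> A \<longrightarrow> y a = 0" using x(2) A' by (auto simp: y_def)
    ultimately show ?thesis by (intro exI[of _ y]) auto
  qed
qed

text \<open>This acts on coefficient vectors: the basis vector of a set containing \<open>i\<close>
  but not \<open>Suc i\<close> goes to that of the set with \<open>i\<close> replaced by
  \<open>Suc i\<close>. It is the matrix unit from \<open>i\<close> to \<open>Suc i\<close> acting
  on an exterior power; no signs arise, as the two positions are adjacent.\<close>

definition raise :: "nat \<Rightarrow> (nat set \<Rightarrow> real) \<Rightarrow> nat set \<Rightarrow> real" where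
  "raise i x T = (if Suc i \<in> T \<and> i \<notin> T then x (insert i (T - {Suc i})) else 0)"

definition lower :: "nat \<Rightarrow> (nat set \<Rightarrow> real) \<Rightarrow> nat set \<Rightarrow> real" where
  "lower i x T = (if i \<in> T \<and> Suc i \<notin> T then x (insert (Suc i) (T - {i})) else 0)"

text \<open>Moves at non-adjacent places concern different elements. For adjacent places both sides
  vanish, since one move destroys the condition for the other.\<close>

lemma lower_raise_commute:
  assumes "i \<noteq> j"
  shows "lower i (raise j x) T = raise j (lower i x) T"
proof -
  have "insert j (insert (Suc i) (T - {i}) - {Suc j}) = insert (Suc i) (insert j (T - {Suc j}) - {i})"
    if "i \<in> T" "Suc i \<notin> T" "Suc j \<in> T" "j \<notin> T" "j \<noteq> Suc i" "i \<noteq> Suc j" using that assms by auto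
  then show ?thesis using assms unfolding raise_def lower_def by auto
qed

lemma lower_raise_self: "lower i (raise i x) T = (if i \<in> T \<and> Suc i \<notin> T then x T else 0)"
proof -
  have "insert i (insert (Suc i) (T - {i}) - {Suc i}) = T" if "i \<in> T" "Suc i \<notin> T" using that by auto
  then show ?thesis unfolding raise_def lower_def by auto
qed

lemma raise_lower_self: "raise i (lower i x) T = (if Suc i \<in> T \<and> i \<notin> T then x T else 0)"
proof -
  have "insert (Suc i) (insert i (T - {Suc i}) - {i}) = T" if "i \<notin> T" "Suc i \<in> T" using that by auto
  then show ?thesis unfolding raise_def lower_def by auto
qed

lemma raise_lower_adjoint:
  assumes "Suc i < N"
  shows "(\<Sum>T\<in>Pow {..<N}. raise i x T * y T) = (\<Sum>T\<in>Pow {..<N}. x T * lower i y T)"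
proof -
  let ?P = "{T \<in> Pow {..<N}. Suc i \<in> T \<and> i \<notin> T}" and ?Q = "{T \<in> Pow {..<N}. i \<in> T \<and> Suc i \<notin> T}"
  have "(\<Sum>T\<in>Pow {..<N}. raise i x T * y T) = (\<Sum>T\<in>?P. x (insert i (T - {Suc i})) * y T)"
    by (rule sum.mono_neutral_cong_right) (auto simp: raise_def)
  also have "\<dots> = (\<Sum>T\<in>?Q. x T * y (insert (Suc i) (T - {i})))"
    by (rule sum.reindex_bij_witness[of _ "\<lambda>T. insert (Suc i) (T - {i})" "\<lambda>T. insert i (T - {Suc i})"])
      (use assms in \<open>auto simp: insert_absorb\<close>)
  also have "\<dots> = (\<Sum>T\<in>Pow {..<N}. x T * lower i y T)"
    by (rule sum.mono_neutral_cong_left) (auto simp: lower_def)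
  finally show ?thesis .
qed

text \<open>The commutator of the raising and lowering operators, weighted as in the exterior power of the
  irreducible representation of \<open>sl\<^sub>2\<close> of dimension \<open>N\<close>, is diagonal.\<close>

lemma raise_lower_norms:
  fixes x :: "nat set \<Rightarrow> real" and N :: nat
  defines "w \<equiv> \<lambda>i. sqrt (real (Suc i) * (real N - 1 - real i))"
  shows "(\<Sum>T\<in>Pow {..<N}. (\<Sum>i<N-1. w i * raise i x T)\<^sup>2) =
    (\<Sum>T\<in>Pow {..<N}. (\<Sum>i<N-1. w i * lower i x T)\<^sup>2) +
    (\<Sum>T\<in>Pow {..<N}. (\<Sum>i\<in>T. real N - 1 - 2 * real i) * (x T)\<^sup>2)"
proof -
  let ?P = "Pow {..<N}"
  let ?c = "\<lambda>i j T. x T * (lower i (raise j x) T - raise j (lower i x) T)"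
  \<comment> \<open>With the square root of \<open>?\<gamma> i\<close> as weight of both moves, the
    total raising and lowering operators are transposes of each other. The difference
    \<open>?\<gamma> i - ?\<gamma> (i - 1)\<close> is \<open>N - 1 - 2 * i\<close>, the weight of
    position \<open>i\<close>.\<close>
  let ?\<gamma> = "\<lambda>i. real (Suc i) * (real N - 1 - real i)"
  have N: "Suc i < N" if "i \<in> {..<N-1}" for i using that by auto
  have ww: "w i * w i = ?\<gamma> i" if "i \<in> {..<N-1}" for i
    using that N[OF that] unfolding w_def by (subst real_sqrt_mult_self) auto
  have sq: "(\<Sum>i<N-1. w i * f i)\<^sup>2 = (\<Sum>i<N-1. \<Sum>j<N-1. w i * w j * (f i * f j))" for f :: "nat \<Rightarrow> real"
    unfolding power2_eq_square sum_product by (intro sum.cong refl) simp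
  have swap: "(\<Sum>T\<in>?P. \<Sum>i<N-1. \<Sum>j<N-1. w i * w j * g i j T) = (\<Sum>i<N-1. \<Sum>j<N-1. w i * w j * (\<Sum>T\<in>?P. g i j T))"
    for g :: "nat \<Rightarrow> nat \<Rightarrow> nat set \<Rightarrow> real"
    by (subst sum.swap, intro sum.cong refl, subst sum.swap) (simp add: sum_distrib_left)
  have E: "(\<Sum>T\<in>?P. raise i x T * raise j x T) = (\<Sum>T\<in>?P. x T * lower i (raise j x) T)"
    if "i \<in> {..<N-1}" for i j using raise_lower_adjoint[OF N[OF that], of x "raise j x"] .
  have F: "(\<Sum>T\<in>?P. lower i x T * lower j x T) = (\<Sum>T\<in>?P. x T * raise j (lower i x) T)"
    if "j \<in> {..<N-1}" for i j using raise_lower_adjoint[OF N[OF that], of "lower i x" x] by (simp add: mult.commute)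
  \<comment> \<open>By adjointness the difference of the squared norms is the quadratic form of the
    commutator, in which only the terms with \<open>i = j\<close> survive.\<close>
  have "(\<Sum>T\<in>?P. (\<Sum>i<N-1. w i * raise i x T)\<^sup>2) - (\<Sum>T\<in>?P. (\<Sum>i<N-1. w i * lower i x T)\<^sup>2)
    = (\<Sum>i<N-1. \<Sum>j<N-1. w i * w j * (\<Sum>T\<in>?P. ?c i j T))"
    unfolding sq swap by (simp add: E F sum_subtractf right_diff_distrib)
  also have "\<dots> = (\<Sum>i<N-1. ?\<gamma> i * (\<Sum>T\<in>?P. ?c i i T))"
  proof (intro sum.cong refl)
    fix i assume i: "i \<in> {..<N-1}"
    have "(\<Sum>j<N-1. w i * w j * (\<Sum>T\<in>?P. ?c i j T))
      = (\<Sum>j<N-1. if j = i then w i * w i * (\<Sum>T\<in>?P. ?c i i T) else 0)"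
      by (intro sum.cong refl) (auto simp: lower_raise_commute)
    also have "\<dots> = ?\<gamma> i * (\<Sum>T\<in>?P. ?c i i T)"
      using i ww[OF i] by (simp add: sum.delta)
    finally show "(\<Sum>j<N-1. w i * w j * (\<Sum>T\<in>?P. ?c i j T))
      = ?\<gamma> i * (\<Sum>T\<in>?P. ?c i i T)" .
  qed
  also have "\<dots> = (\<Sum>T\<in>?P. \<Sum>i<N-1. ?\<gamma> i * (?c i i T))"
    by (subst sum.swap) (simp add: sum_distrib_left)
  also have "\<dots> = (\<Sum>T\<in>?P. (\<Sum>i\<in>T. real N - 1 - 2 * real i) * (x T)\<^sup>2)"
  proof (intro sum.cong refl)
    fix T assume T: "T \<in> ?P"
    have "(\<Sum>i<N-1. ?\<gamma> i * (?c i i T))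
      = (\<Sum>i<N-1. ?\<gamma> i * (of_bool (i \<in> T) - of_bool (Suc i \<in> T))) * (x T)\<^sup>2"
      unfolding sum_distrib_right
      by (intro sum.cong refl) (auto simp: lower_raise_self raise_lower_self power2_eq_square)
    also have "(\<Sum>i<N-1. ?\<gamma> i * (of_bool (i \<in> T) - of_bool (Suc i \<in> T))) = (\<Sum>i\<in>T. real N - 1 - 2 * real i)"
    proof (cases N)
      case 0
      then show ?thesis using T by simp
    next
      case (Suc K)
      \<comment> \<open>Summation by parts with \<open>?\<delta> (Suc i) = ?\<gamma> i\<close>. Both
        sums extend to \<open>i < N\<close> because \<open>?\<gamma> (N - 1)\<close> and
        \<open>?\<delta> 0\<close> are 0.\<close>
      let ?\<delta> = "\<lambda>i. real i * (real N - real i)"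
      have "(\<Sum>i<N-1. ?\<gamma> i * (of_bool (i \<in> T) - of_bool (Suc i \<in> T))) =
        (\<Sum>i<K. ?\<gamma> i * of_bool (i \<in> T)) - (\<Sum>i<K. ?\<delta> (Suc i) * of_bool (Suc i \<in> T))"
        unfolding sum_subtractf[symmetric] using Suc by (intro sum.cong) (auto simp: algebra_simps)
      also have "(\<Sum>i<K. ?\<gamma> i * of_bool (i \<in> T)) = (\<Sum>i<N. ?\<gamma> i * of_bool (i \<in> T))" using Suc by simp
      also have "(\<Sum>i<K. ?\<delta> (Suc i) * of_bool (Suc i \<in> T)) = (\<Sum>i<N. ?\<delta> i * of_bool (i \<in> T))"
        unfolding Suc sum.lessThan_Suc_shift by simp
      also have "(\<Sum>i<N. ?\<gamma> i * of_bool (i \<in> T)) - (\<Sum>i<N. ?\<delta> i * of_bool (i \<in> T))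
        = (\<Sum>i<N. (real N - 1 - 2 * real i) * of_bool (i \<in> T))"
        unfolding sum_subtractf[symmetric] by (intro sum.cong) (auto simp: algebra_simps)
      also have "\<dots> = (\<Sum>i\<in>T. real N - 1 - 2 * real i)"
        using T by (intro sum.mono_neutral_cong_right) auto
      finally show ?thesis .
    qed
    finally show "(\<Sum>i<N-1. ?\<gamma> i * (?c i i T))
      = (\<Sum>i\<in>T. real N - 1 - 2 * real i) * (x T)\<^sup>2" .
  qed
  finally show ?thesis by simp
qed

text \<open>If there were more subsets of sum \<open>s\<close> than of sum \<open>s + 1\<close>,
  raising would kill a nonzero vector \<open>x\<close> supported on sum \<open>s\<close>. Then
  \<open>raise_lower_norms\<close> writes 0 as the squared norm of the lowered vector plus
  \<open>m * (N - 1) - 2 * s > 0\<close> times that of \<open>x\<close>.\<close>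

lemma card_subsets_sum_mono:
  assumes "2 * s < m * (N - 1)"
  shows "card {S. S \<subseteq> {..<N} \<and> card S = m \<and> \<Sum>S = s} \<le> card {S. S \<subseteq> {..<N} \<and> card S = m \<and> \<Sum>S = Suc s}"
    (is "card ?A \<le> card ?B")
proof (rule ccontr)
  assume "\<not> card ?A \<le> card ?B"
  then have lt: "card ?B < card ?A" by simp
  have fin: "finite ?A" "finite ?B" by (rule finite_subset[of _ "Pow {..<N}"]; auto)+
  define w where "w = (\<lambda>i. sqrt (real (Suc i) * (real N - 1 - real i)))"
  define M where "M = (\<lambda>T S. \<Sum>i<N-1. w i * of_bool (Suc i \<in> T \<and> i \<notin> T \<and> S = insert i (T - {Suc i})))"
  obtain x where x: "\<exists>S\<in>?A. x S \<noteq> 0" "\<forall>S. S \<notin> ?A \<longrightarrow> x S = 0" "\<forall>T\<in>?B. (\<Sum>S\<in>?A. M T S * x S) = 0"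
    using homogeneous_system_nontrivial[OF fin(2,1) lt, of M] by blast
  have Mx: "(\<Sum>S\<in>?A. M T S * x S) = (\<Sum>i<N-1. w i * raise i x T)" for T
  proof -
    have "(\<Sum>S\<in>?A. M T S * x S) = (\<Sum>i<N-1. w i * (\<Sum>S\<in>?A. of_bool (Suc i \<in> T \<and> i \<notin> T \<and> S = insert i (T - {Suc i})) * x S))"
      unfolding M_def sum_distrib_right sum_distrib_left by (subst sum.swap) (simp add: mult.assoc)
    also have "\<dots> = (\<Sum>i<N-1. w i * raise i x T)"
    proof (intro sum.cong refl arg_cong2[of _ _ _ _ "(*)"])
      fix i
      show "(\<Sum>S\<in>?A. of_bool (Suc i \<in> T \<and> i \<notin> T \<and> S = insert i (T - {Suc i})) * x S) = raise i x T"
      proof (cases "Suc i \<in> T \<and> i \<notin> T")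
        case True
        have "(\<Sum>S\<in>?A. of_bool (Suc i \<in> T \<and> i \<notin> T \<and> S = insert i (T - {Suc i})) * x S)
          = (\<Sum>S\<in>?A. if insert i (T - {Suc i}) = S then x S else 0)"
          using True by (intro sum.cong) auto
        also have "\<dots> = x (insert i (T - {Suc i}))"
          unfolding sum.delta'[OF fin(1)] using x(2) by auto
        finally show ?thesis using True by (simp add: raise_def)
      qed (auto simp: raise_def)
    qed
    finally show ?thesis .
  qed
  have E0: "(\<Sum>i<N-1. w i * raise i x T) = 0" if T: "T \<in> Pow {..<N}" for T
  proof (cases "T \<in> ?B")
    case True
    then show ?thesis using x(3) Mx by simp
  next
    case False
    \<comment> \<open>A move preserves the size and raises the sum by one, so outside
      \<open>?B\<close> it can only read values of \<open>x\<close> outside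
      \<open>?A\<close>.\<close>
    have "raise i x T = 0" for i
    proof (cases "Suc i \<in> T \<and> i \<notin> T")
      case True
      have fT: "finite T" using T finite_subset by auto
      define S where "S = insert i (T - {Suc i})"
      have "card T > 0" using True fT by (auto simp: card_gt_0_iff)
      then have "card S = card T" using True fT unfolding S_def by simp
      moreover have "Suc (\<Sum>S) = \<Sum>T"
        using True fT sum.remove[of T "Suc i" "\<lambda>x. x"] unfolding S_def by simp
      ultimately have "S \<notin> ?A" using False T by auto
      then show ?thesis using x(2) True by (simp add: raise_def S_def)
    qed (auto simp: raise_def)
    then show ?thesis by simp
  qed
  have "0 = (\<Sum>T\<in>Pow {..<N}. (\<Sum>i<N-1. w i * raise i x T)\<^sup>2)" using E0 by simp
  also have "\<dots> = (\<Sum>T\<in>Pow {..<N}. (\<Sum>i<N-1. w i * lower i x T)\<^sup>2) +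
    (\<Sum>T\<in>Pow {..<N}. (\<Sum>i\<in>T. real N - 1 - 2 * real i) * (x T)\<^sup>2)"
    unfolding w_def by (rule raise_lower_norms)
  also have "(\<Sum>T\<in>Pow {..<N}. (\<Sum>i\<in>T. real N - 1 - 2 * real i) * (x T)\<^sup>2)
    = (\<Sum>T\<in>?A. (real m * (real N - 1) - 2 * real s) * (x T)\<^sup>2)"
  proof (rule sum.mono_neutral_cong_right)
    fix T assume T: "T \<in> ?A"
    then have "real s = (\<Sum>i\<in>T. real i)" by auto
    then have "(\<Sum>i\<in>T. real N - 1 - 2 * real i) = real m * (real N - 1) - 2 * real s"
      using T by (simp add: sum_subtractf sum_distrib_left)
    then show "(\<Sum>i\<in>T. real N - 1 - 2 * real i) * (x T)\<^sup>2 = (real m * (real N - 1) - 2 * real s) * (x T)\<^sup>2" by simp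
  qed (use x(2) in auto)
  finally have eq: "0 = (\<Sum>T\<in>Pow {..<N}. (\<Sum>i<N-1. w i * lower i x T)\<^sup>2) +
    (\<Sum>T\<in>?A. (real m * (real N - 1) - 2 * real s) * (x T)\<^sup>2)" .
  have "N > 0" using assms by (cases N) auto
  moreover have "real (2 * s) < real (m * (N - 1))" using assms by (simp only: of_nat_less_iff)
  ultimately have c: "real m * (real N - 1) - 2 * real s > 0" by (simp add: of_nat_diff)
  obtain S where S: "S \<in> ?A" "x S \<noteq> 0" using x(1) by blast
  have "0 < (\<Sum>T\<in>?A. (real m * (real N - 1) - 2 * real s) * (x T)\<^sup>2)"
    using S c by (intro sum_pos2[OF fin(1) S(1)]) auto
  moreover have "0 \<le> (\<Sum>T\<in>Pow {..<N}. (\<Sum>i<N-1. w i * lower i x T)\<^sup>2)" by (intro sum_nonneg) auto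
  ultimately show False using eq by linarith
qed

section \<open>The rational q-Catalan polynomial\<close>

text \<open>Pascal's rule in the form that splits subsets of \<open>{..<Suc N}\<close> by whether
  they contain \<open>N\<close>, see \<open>coeff_q_binom_shift\<close>. For \<open>m > N\<close>
  the truncated exponent \<open>N - m\<close> does no harm, its factor \<open>q_binom N m\<close>
  being 0.\<close>

fun q_binom :: "nat \<Rightarrow> nat \<Rightarrow> int poly" where
  "q_binom N 0 = 1"
| "q_binom 0 (Suc m) = 0"
| "q_binom (Suc N) (Suc m) = q_binom N (Suc m) + monom 1 (N - m) * q_binom N m"

lemma q_binom_eq_0: "N < m \<Longrightarrow> q_binom N m = 0"
  by (induction N m rule: q_binom.induct) auto

lemma q_int_0 [simp]: "q_int 0 = 0" and q_int_1 [simp]: "q_int (Suc 0) = 1"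
  by (simp_all add: q_int_def)

lemma q_int_Suc: "q_int (Suc n) = q_int n + monom 1 n"
  by (simp add: q_int_def)

lemma q_int_add: "q_int (m + k) = q_int m + monom 1 m * q_int k"
  by (induction k) (simp_all add: q_int_Suc algebra_simps mult_monom)

lemma coeff_q_int: "coeff (q_int n) i = (if i < n then 1 else 0)"
  by (induction n) (auto simp: q_int_Suc less_Suc_eq)

lemma q_int_neq_0: "n > 0 \<Longrightarrow> q_int n \<noteq> 0"
  using coeff_q_int[of n 0] by auto

lemma q_fact_0 [simp]: "q_fact 0 = 1"
  by (simp add: q_fact_def)

lemma q_fact_Suc: "q_fact (Suc n) = q_fact n * q_int (Suc n)"
  by (simp add: q_fact_def)

lemma q_fact_neq_0: "q_fact n \<noteq> 0"
  by (induction n) (auto simp: q_fact_Suc q_int_neq_0)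

lemma q_binom_self: "q_binom m m = 1"
  by (induction m) (auto simp: q_binom_eq_0)

lemma q_binom_q_fact: "q_binom (m + k) m * (q_fact m * q_fact k) = q_fact (m + k)"
proof (induction "m + k" arbitrary: m k)
  case 0
  then show ?case by simp
next
  case (Suc l)
  show ?case
  proof (cases m)
    case 0
    then show ?thesis by simp
  next
    case m: (Suc m')
    show ?thesis
    proof (cases k)
      case 0
      then show ?thesis by (simp add: q_binom_self)
    next
      case k: (Suc k')
      have l: "l = Suc m' + k'" "l = m' + Suc k'" using Suc m k by auto
      have 1: "q_binom l (Suc m') * (q_fact (Suc m') * q_fact k') = q_fact l"
        using Suc.hyps(1)[OF l(1)] l(1) by simp
      have 2: "q_binom l m' * (q_fact m' * q_fact (Suc k')) = q_fact l"
        using Suc.hyps(1)[OF l(2)] l(2) by simp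
      have mk: "m + k = Suc l" using Suc by simp
      have "q_binom (m + k) m * (q_fact m * q_fact k)
        = (q_binom l (Suc m') * (q_fact (Suc m') * q_fact k')) * q_int (Suc k')
          + monom 1 (Suc k') * (q_binom l m' * (q_fact m' * q_fact (Suc k'))) * q_int (Suc m')"
        unfolding mk m k using l by (simp add: q_fact_Suc algebra_simps)
      also have "\<dots> = q_fact l * (q_int (Suc k') + monom 1 (Suc k') * q_int (Suc m'))"
        unfolding 1 2 by (simp add: algebra_simps)
      also have "\<dots> = q_fact l * q_int (Suc l)"
        using q_int_add[of "Suc k'" "Suc m'"] l by (simp add: add.commute)
      finally show ?thesis unfolding mk by (simp add: q_fact_Suc)
    qed
  qed
qed

text \<open>Euclid's algorithm carries over from \<open>m\<close> and \<open>k\<close> through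
  \<open>q_int_add\<close>. It gives a Bezout identity with integer coefficients, so that
  divisibility can be concluded in \<open>int poly\<close> itself.\<close>

lemma q_int_bezout:
  assumes "coprime m k"
  shows "\<exists>u v. u * q_int m + v * q_int k = 1"
  using assms
proof (induction "m + k" arbitrary: m k rule: less_induct)
  case less
  consider "m = 0" | "k = 0" | "0 < m" "m < k" | "0 < k" "k < m" | "m = k" by linarith
  then show ?case
  proof cases
    case 1
    then show ?thesis using less.prems by (intro exI[of _ 0] exI[of _ 1]) simp
  next
    case 2
    then show ?thesis using less.prems by (intro exI[of _ 1] exI[of _ 0]) simp
  next
    case 3
    have "gcd m (k - m) = gcd m k" using gcd_add2[of m "k - m"] le_add_diff_inverse[of m k] 3 by (simp only: less_imp_le)
    then have "coprime m (k - m)" using less.prems by (simp add: coprime_iff_gcd_eq_1)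
    then obtain u v where uv: "u * q_int m + v * q_int (k - m) = 1" using less.hyps[of m "k - m"] 3 by auto
    have "q_int k = q_int (k - m) + monom 1 (k - m) * q_int m" using q_int_add[of "k - m" m] 3 by simp
    then have "(u - v * monom 1 (k - m)) * q_int m + v * q_int k = 1" using uv by (simp add: algebra_simps)
    then show ?thesis by blast
  next
    case 4
    have "gcd (m - k) k = gcd m k" using gcd_add1[of "m - k" k] le_add_diff_inverse2[of k m] 4 by (simp only: less_imp_le)
    then have "coprime (m - k) k" using less.prems by (simp add: coprime_iff_gcd_eq_1)
    then obtain u v where uv: "u * q_int (m - k) + v * q_int k = 1" using less.hyps[of "m - k" k] 4 by auto
    have "q_int m = q_int (m - k) + monom 1 (m - k) * q_int k" using q_int_add[of "m - k" k] 4 by simp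
    then have "u * q_int m + (v - u * monom 1 (m - k)) * q_int k = 1" using uv by (simp add: algebra_simps)
    then show ?thesis by blast
  next
    case 5
    then have "m = 1" "k = 1" using less.prems by auto
    then show ?thesis by (intro exI[of _ 0] exI[of _ 1]) simp
  qed
qed

text \<open>Cancelling factorials shows that \<open>q_int a * q_binom (a + b) a\<close> equals
  \<open>q_int (a + b) * q_binom (a + b - 1) (a - 1)\<close>. A Bezout identity for
  \<open>q_int a\<close> and \<open>q_int (a + b)\<close> then exhibits the quotient
  \<open>F\<close>.\<close>

lemma q_catalan_exists:
  assumes "a > 0" "coprime a b"
  obtains F where "q_binom (a + b) a = q_int (a + b) * F" "F * (q_fact a * q_fact b) = q_fact (a + b - 1)"
proof -
  obtain m where m: "a = Suc m" using assms by (cases a) auto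
  have ab: "a + b = Suc (m + b)" using m by simp
  have "q_int a * q_binom (a + b) a * (q_fact m * q_fact b) = q_binom (a + b) a * (q_fact a * q_fact b)"
    using q_fact_Suc[of m] by (simp only: m[symmetric] ac_simps)
  also have "\<dots> = q_fact (m + b) * q_int (a + b)"
    unfolding q_binom_q_fact using q_fact_Suc[of "m + b"] by (simp only: ab)
  also have "\<dots> = q_int (a + b) * q_binom (m + b) m * (q_fact m * q_fact b)"
    using q_binom_q_fact[of m b] by (simp only: ac_simps)
  finally have eq: "q_int a * q_binom (a + b) a = q_int (a + b) * q_binom (m + b) m"
    using q_fact_neq_0 by simp
  have "coprime a (a + b)" using assms by (simp add: coprime_iff_gcd_eq_1)
  then obtain u v where uv: "u * q_int a + v * q_int (a + b) = 1" using q_int_bezout by blast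
  define F where "F = u * q_binom (m + b) m + v * q_binom (a + b) a"
  have "q_binom (a + b) a = (u * q_int a + v * q_int (a + b)) * q_binom (a + b) a" using uv by simp
  also have "\<dots> = u * (q_int a * q_binom (a + b) a) + v * q_int (a + b) * q_binom (a + b) a"
    by (simp add: algebra_simps)
  also have "\<dots> = q_int (a + b) * F" unfolding eq F_def by (simp add: algebra_simps)
  finally have 1: "q_binom (a + b) a = q_int (a + b) * F" .
  have "q_int (a + b) * (F * (q_fact a * q_fact b)) = q_fact (a + b)"
    using q_binom_q_fact[of a b] unfolding 1 by (simp only: ac_simps)
  also have "\<dots> = q_int (a + b) * q_fact (a + b - 1)"
    using q_fact_Suc[of "m + b"] unfolding ab by (simp add: mult.commute)
  finally have "q_int (a + b) * (F * (q_fact a * q_fact b)) = q_int (a + b) * q_fact (a + b - 1)" .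
  then have "F * (q_fact a * q_fact b) = q_fact (a + b - 1)"
    using q_int_neq_0[of "a + b"] assms by simp
  then show ?thesis using that 1 by blast
qed

section \<open>Nonnegativity of the coefficients\<close>

lemma degree_q_binom: "degree (q_binom N m) \<le> m * (N - m)"
proof (induction N m rule: q_binom.induct)
  case (3 N m)
  have "degree (monom 1 (N - m) * q_binom N m) \<le> (N - m) + m * (N - m)"
    using degree_mult_le[of "monom 1 (N - m)" "q_binom N m"] degree_monom_le[of "1::int" "N - m"] 3(2) by linarith
  moreover have "degree (q_binom N (Suc m)) \<le> Suc m * (N - m)"
    using 3(1) by (rule order_trans) (intro mult_left_mono, auto)
  ultimately show ?case by (auto intro: degree_add_le)
qed auto

definition subset_sums :: "nat \<Rightarrow> nat \<Rightarrow> nat \<Rightarrow> nat set set" where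
  "subset_sums N m s = {S. S \<subseteq> {..<N} \<and> card S = m \<and> \<Sum>S = s}"

lemma subset_sums_rec:
  "card (subset_sums (Suc N) (Suc m) s) =
    card (subset_sums N (Suc m) s) + (if N \<le> s then card (subset_sums N m (s - N)) else 0)"
proof -
  have fin: "finite (subset_sums N m s)" for N m s
    by (rule finite_subset[of _ "Pow {..<N}"]) (auto simp: subset_sums_def)
  let ?I = "if N \<le> s then insert N ` subset_sums N m (s - N) else {}"
  have fS: "finite S" if "S \<subseteq> {..<N}" for S :: "nat set" and N using that finite_subset by blast
  have "subset_sums (Suc N) (Suc m) s = subset_sums N (Suc m) s \<union> ?I"
  proof (intro equalityI subsetI)
    fix S assume S: "S \<in> subset_sums (Suc N) (Suc m) s"
    then have f: "finite S" using fS unfolding subset_sums_def by blast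
    show "S \<in> subset_sums N (Suc m) s \<union> ?I"
    proof (cases "N \<in> S")
      case True
      have s: "\<Sum>S = N + \<Sum>(S - {N})" using sum.remove[OF f True, of "\<lambda>x. x"] by simp
      have "S - {N} \<in> subset_sums N m (s - N)" using S True f s by (auto simp: subset_sums_def)
      moreover have "N \<le> s" using S s by (simp add: subset_sums_def)
      moreover have "S = insert N (S - {N})" using True by auto
      ultimately have "S \<in> ?I" by (simp only: if_True) (rule image_eqI)
      then show ?thesis by blast
    next
      case False
      then have "S \<subseteq> {..<N}" using S by (auto simp: subset_sums_def less_Suc_eq)
      then show ?thesis using S by (simp add: subset_sums_def)
    qed
  next
    fix S assume "S \<in> subset_sums N (Suc m) s \<union> ?I"
    then consider "S \<in> subset_sums N (Suc m) s" | T where "N \<le> s" "T \<in> subset_sums N m (s - N)" "S = insert N T"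
      by (auto split: if_splits)
    then show "S \<in> subset_sums (Suc N) (Suc m) s"
    proof cases
      case 1
      then show ?thesis by (auto simp: subset_sums_def)
    next
      case 2
      then have T: "T \<subseteq> {..<N}" "card T = m" "\<Sum>T = s - N" by (auto simp: subset_sums_def)
      then have "finite T" "N \<notin> T" using fS by auto
      then show ?thesis using T 2 by (auto simp: subset_sums_def)
    qed
  qed
  moreover have "subset_sums N (Suc m) s \<inter> ?I = {}" by (auto simp: subset_sums_def)
  moreover have "card ?I = (if N \<le> s then card (subset_sums N m (s - N)) else 0)"
  proof -
    have "inj_on (insert N) (subset_sums N m (s - N))"
    proof (rule inj_onI)
      fix S T assume "S \<in> subset_sums N m (s - N)" "T \<in> subset_sums N m (s - N)" "insert N S = insert N T"
      moreover from this have "N \<notin> S" "N \<notin> T" by (auto simp: subset_sums_def)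
      ultimately show "S = T" by (metis Diff_insert_absorb)
    qed
    then show ?thesis by (simp add: card_image)
  qed
  moreover have "finite ?I" using fin by simp
  ultimately show ?thesis using fin by (simp add: card_Un_disjoint)
qed

text \<open>The exponent \<open>m choose 2\<close> is the least sum of \<open>m\<close> elements,
  \<open>0 + ... + (m - 1)\<close>. With it included, both sides obey the recursion of
  \<open>subset_sums_rec\<close>.\<close>

lemma coeff_q_binom_shift:
  "coeff (monom 1 (m choose 2) * q_binom N m) s = int (card (subset_sums N m s))"
proof (induction N m arbitrary: s rule: q_binom.induct)
  case (1 N)
  have "{S. S \<subseteq> {..<N} \<and> card S = 0 \<and> \<Sum>S = s} = (if s = 0 then {{}} else {})"
    using finite_subset[of _ "{..<N}"] by auto
  then show ?case by (simp add: subset_sums_def numeral_2_eq_2)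
next
  case (2 m)
  then show ?case by (simp add: subset_sums_def card_eq_0_iff)
next
  case (3 N m)
  have c2: "Suc m choose 2 = (m choose 2) + m" by (simp add: numeral_2_eq_2)
  have "monom 1 (Suc m choose 2) * q_binom (Suc N) (Suc m) =
    monom 1 (Suc m choose 2) * q_binom N (Suc m) + monom 1 N * (monom 1 (m choose 2) * q_binom N m)"
  proof (cases "m \<le> N")
    case True
    then have "monom 1 (Suc m choose 2) * monom 1 (N - m) = monom 1 N * (monom 1 (m choose 2) :: int poly)"
      by (simp add: mult_monom c2 add.commute)
    then show ?thesis by (simp add: distrib_left mult.assoc[symmetric])
  next
    case False
    then show ?thesis by (simp add: q_binom_eq_0)
  qed
  then have "coeff (monom 1 (Suc m choose 2) * q_binom (Suc N) (Suc m)) s =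
    int (card (subset_sums N (Suc m) s)) + (if s < N then 0 else int (card (subset_sums N m (s - N))))"
    using 3 by (simp add: coeff_monom_mult)
  then show ?case by (simp add: subset_sums_rec)
qed

text \<open>Sums of \<open>a\<close> elements of \<open>{..<a + b}\<close> are centred at
  \<open>a * (a + b - 1) / 2\<close>, which is \<open>(a choose 2) + a * b / 2\<close>; removing the
  shift moves the centre to \<open>a * b / 2\<close>.\<close>

lemma q_binom_unimodal:
  assumes "2 * Suc j \<le> a * b"
  shows "coeff (q_binom (a + b) a) j \<le> coeff (q_binom (a + b) a) (Suc j)"
proof -
  let ?c = "a choose 2"
  have co: "coeff (q_binom (a + b) a) i = int (card (subset_sums (a + b) a (i + ?c)))" for i
    using coeff_q_binom_shift[of a "a + b" "i + ?c"] by (simp add: coeff_monom_mult)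
  have "even (a * (a - 1))" by (cases a) auto
  then have "2 * ?c = a * (a - 1)" by (simp add: choose_two)
  moreover have "a * (a + b - 1) = a * (a - 1) + a * b" by (cases a) (auto simp: algebra_simps)
  ultimately have "2 * (j + ?c) < a * (a + b - 1)" using assms by simp
  then show ?thesis unfolding co subset_sums_def using card_subsets_sum_mono[of "j + ?c" a "a + b"] by simp
qed

lemma degree_q_int: "degree (q_int n) = n - 1"
proof (cases n)
  case (Suc m)
  then show ?thesis by (intro antisym degree_le le_degree) (auto simp: coeff_q_int)
qed simp

lemma reflect_q_int: "reflect_poly (q_int n) = q_int n"
  by (rule poly_eqI) (auto simp: coeff_reflect_poly coeff_q_int degree_q_int)

lemma reflect_q_fact: "reflect_poly (q_fact n) = q_fact n"
  by (induction n) (auto simp: q_fact_Suc reflect_poly_mult reflect_q_int)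

lemma q_catalan_nonneg:
  assumes "a > 0" "b > 0" and F1: "q_binom (a + b) a = q_int (a + b) * F"
    and F2: "F * (q_fact a * q_fact b) = q_fact (a + b - 1)"
  shows "coeff F j \<ge> 0"
proof -
  define L where "L = a + b"
  have r: "reflect_poly (F * (q_fact a * q_fact b)) = q_fact (a + b - 1)"
    by (simp only: F2 reflect_q_fact)
  have "reflect_poly F * (q_fact a * q_fact b) = F * (q_fact a * q_fact b)"
    using r[unfolded reflect_poly_mult reflect_q_fact] F2 by (rule trans[OF _ sym])
  then have refl: "reflect_poly F = F" using q_fact_neq_0 by simp
  have "F \<noteq> 0" using F2 q_fact_neq_0 by auto
  \<comment> \<open>A crude bound, but enough for reflection at \<open>degree F\<close> to send an
    index above \<open>a * b / 2\<close> into the half covered by \<open>low\<close>.\<close>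
  have degF: "degree F \<le> a * b"
  proof -
    have "degree F \<le> degree (q_int (a + b) * F)"
      using degree_mult_eq[of "q_int (a + b)" F] q_int_neq_0[of "a + b"] assms \<open>F \<noteq> 0\<close> by simp
    also have "\<dots> \<le> a * b" using degree_q_binom[of "a + b" a] F1 by simp
    finally show ?thesis .
  qed
  have geom: "(1 - monom 1 1) * q_int n = 1 - monom 1 n" for n
  proof (induction n)
    case (Suc n)
    have "(1 - monom 1 1) * q_int (Suc n) = (1 - monom 1 1) * q_int n + (1 - monom 1 1) * monom 1 n"
      by (simp add: q_int_Suc distrib_left)
    then show ?case unfolding Suc by (simp add: left_diff_distrib mult_monom)
  qed simp
  have "(1 - monom 1 1) * q_binom L a = F - monom 1 L * F"
  proof -
    have "(1 - monom 1 1) * q_binom L a = ((1 - monom 1 1) * q_int L) * F"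
      using F1 by (simp add: L_def mult.assoc)
    then show ?thesis unfolding geom by (simp add: algebra_simps)
  qed
  \<comment> \<open>Coefficient \<open>j\<close> of \<open>F\<close> is a difference of consecutive
    Gaussian coefficients plus coefficient \<open>j - L\<close> of \<open>F\<close>: unimodality
    handles the former, induction the latter.\<close>
  then have F: "F = q_binom L a - monom 1 1 * q_binom L a + monom 1 L * F" by (simp add: algebra_simps)
  have low: "coeff F j \<ge> 0" if "2 * j \<le> a * b" for j
    using that
  proof (induction j rule: less_induct)
    case (less j)
    have "coeff F j = coeff (q_binom L a) j - (if j < 1 then 0 else coeff (q_binom L a) (j - 1))
      + (if j < L then 0 else coeff F (j - L))"
      by (subst F) (simp add: coeff_monom_mult)
    moreover have "(if j < L then 0 else coeff F (j - L)) \<ge> 0"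
      using less.IH[of "j - L"] less.prems assms by (auto simp: L_def)
    moreover have "(if j < 1 then 0 else coeff (q_binom L a) (j - 1)) \<le> coeff (q_binom L a) j"
    proof (cases j)
      case 0
      have "coeff (q_binom L a) 0 = int (card (subset_sums (a + b) a (a choose 2)))"
        using coeff_q_binom_shift[of a "a + b" "a choose 2"] by (simp add: coeff_monom_mult L_def)
      then show ?thesis using 0 by simp
    next
      case (Suc i)
      then show ?thesis using q_binom_unimodal[of i a b] less.prems by (simp add: L_def)
    qed
    ultimately show ?case by linarith
  qed
  show ?thesis
  proof (cases "2 * j \<le> a * b \<or> degree F < j")
    case True
    then show ?thesis using low coeff_eq_0[of F j] by auto
  next
    case False
    then have "coeff F j = coeff F (degree F - j)"
      using arg_cong[OF refl, of "\<lambda>p. coeff p j"] by (simp add: coeff_reflect_poly)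
    moreover have "2 * (degree F - j) \<le> a * b" using False degF by linarith
    ultimately show ?thesis using low[of "degree F - j"] by simp
  qed
qed

lemma q_Cat_eq:
  assumes "a > 0" and F1: "q_binom (a + b) a = q_int (a + b) * F"
  shows "q_Cat a b = to_fract F"
proof -
  have "q_fact (a + b) = q_int (a + b) * F * (q_fact a * q_fact b)"
    using q_binom_q_fact[of a b] F1 by simp
  moreover have "to_fract (q_int (a + b)) \<noteq> 0" "to_fract (q_fact a) \<noteq> 0" "to_fract (q_fact b) \<noteq> 0"
    using q_int_neq_0[of "a + b"] q_fact_neq_0 assms by auto
  ultimately show ?thesis unfolding q_Cat_def q_binomial_def by (simp add: field_simps)
qed

section \<open>Values at roots of unity\<close>

definition eval_int_poly :: "complex \<Rightarrow> int poly \<Rightarrow> complex" where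
  "eval_int_poly z p = poly (map_poly of_int p) z"

lemma eval_int_poly_pCons: "eval_int_poly z (pCons c p) = of_int c + z * eval_int_poly z p"
  by (simp add: eval_int_poly_def map_poly_pCons)

lemma eval_int_poly_0 [simp]: "eval_int_poly z 0 = 0"
  by (simp add: eval_int_poly_def)

lemma eval_int_poly_1 [simp]: "eval_int_poly z 1 = 1"
  using eval_int_poly_pCons[of z 1 0] by (simp add: one_pCons)

lemma eval_int_poly_add [simp]: "eval_int_poly z (p + q) = eval_int_poly z p + eval_int_poly z q"
  by (induction p q rule: poly_induct2) (auto simp: eval_int_poly_pCons algebra_simps)

lemma eval_int_poly_smult: "eval_int_poly z (smult c p) = of_int c * eval_int_poly z p"
  by (induction p) (auto simp: eval_int_poly_pCons algebra_simps)

lemma eval_int_poly_mult [simp]: "eval_int_poly z (p * q) = eval_int_poly z p * eval_int_poly z q"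
  by (induction p) (auto simp: eval_int_poly_pCons eval_int_poly_smult algebra_simps)

lemma eval_int_poly_monom: "eval_int_poly z (monom 1 k) = z ^ k"
  by (induction k) (auto simp: monom_0 monom_Suc eval_int_poly_pCons)

lemma eval_int_poly_sum: "eval_int_poly z (\<Sum>i\<in>A. f i) = (\<Sum>i\<in>A. eval_int_poly z (f i))"
  by (induction A rule: infinite_finite_induct) auto

lemma eval_q_int: "eval_int_poly z (q_int k) = (\<Sum>i<k. z ^ i)"
  by (simp add: q_int_def eval_int_poly_sum eval_int_poly_monom)

lemma eval_q_fact_1: "eval_int_poly 1 (q_fact k) = fact k"
  by (induction k) (auto simp: q_fact_Suc eval_q_int algebra_simps)

lemma q_int_mult: "q_int (e * k) = q_int e * (\<Sum>j<k. monom 1 (e * j))"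
proof (induction k)
  case (Suc k)
  have "q_int (e * Suc k) = q_int (e * k) + monom 1 (e * k) * q_int e"
    using q_int_add[of "e * k" e] by (simp add: add.commute)
  then show ?case using Suc by (simp add: algebra_simps)
qed simp

locale root_of_unity =
  fixes \<omega> :: complex and e :: nat
  assumes e2: "e \<ge> 2" and root: "primitive_root_of_unity e \<omega>"
begin

abbreviation "ev \<equiv> eval_int_poly \<omega>"

lemma omega_pow: "\<omega> ^ e = 1" and omega_pow_neq: "0 < k \<Longrightarrow> k < e \<Longrightarrow> \<omega> ^ k \<noteq> 1"
  using root by (auto simp: primitive_root_of_unity_def)

lemma eval_q_int_geometric: "(1 - \<omega>) * ev (q_int k) = 1 - \<omega> ^ k"
  unfolding eval_q_int by (rule one_diff_power_eq[symmetric])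

lemma omega_neq_1: "1 - \<omega> \<noteq> 0"
  using omega_pow_neq[of 1] e2 by auto

lemma eval_q_int_mod: "ev (q_int k) = ev (q_int (k mod e))"
proof -
  have "\<omega> ^ k = \<omega> ^ (e * (k div e) + k mod e)" by simp
  also have "\<dots> = \<omega> ^ (k mod e)" unfolding power_add power_mult omega_pow by simp
  finally have "(1 - \<omega>) * ev (q_int k) = (1 - \<omega>) * ev (q_int (k mod e))"
    by (simp add: eval_q_int_geometric)
  then show ?thesis using omega_neq_1 by simp
qed

lemma eval_q_int_eq_0: "ev (q_int e) = 0"
  using eval_q_int_mod[of e] by (simp add: eval_q_int)

lemma eval_q_int_neq_0: "0 < k \<Longrightarrow> k < e \<Longrightarrow> ev (q_int k) \<noteq> 0"
  using eval_q_int_geometric[of k] omega_pow_neq[of k] by auto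

lemma eval_q_fact_neq_0: "k < e \<Longrightarrow> ev (q_fact k) \<noteq> 0"
  by (induction k) (auto simp: q_fact_Suc eval_q_int_neq_0)

text \<open>For \<open>m \<ge> e\<close> the factorial vanishes at \<open>\<omega>\<close>, so
  quotients are evaluated after splitting off one \<open>q_int e\<close> for each multiple of
  \<open>e\<close> up to \<open>m\<close>. The cofactor of the \<open>j\<close>-th multiple has the
  value \<open>j\<close>, and each full run between multiples contributes
  \<open>q_fact (e - 1)\<close>.\<close>

lemma q_fact_factor:
  "\<exists>R. q_fact m = q_int e ^ (m div e) * R \<and>
     ev R = fact (m div e) * ev (q_fact (e - 1)) ^ (m div e) * ev (q_fact (m mod e))"
proof (induction m)
  case 0
  then show ?case by (intro exI[of _ 1]) simp
next
  case (Suc m)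
  then obtain R where R: "q_fact m = q_int e ^ (m div e) * R"
    "ev R = fact (m div e) * ev (q_fact (e - 1)) ^ (m div e) * ev (q_fact (m mod e))"
    by blast
  show ?case
  proof (cases "Suc (m mod e) = e")
    case True
    then have dm: "Suc m div e = Suc (m div e)" "Suc m mod e = 0" "m mod e = e - 1"
      by (auto simp: div_Suc mod_Suc)
    have Sm: "Suc m = e * Suc (m div e)" using dm mult_div_mod_eq[of e "Suc m"] by simp
    define S :: "int poly" where "S = (\<Sum>j<Suc (m div e). monom 1 (e * j))"
    have "q_fact (Suc m) = q_fact m * (q_int e * S)"
      unfolding q_fact_Suc S_def q_int_mult[symmetric] by (simp only: Sm[symmetric])
    moreover have "ev S = of_nat (Suc (m div e))"
      unfolding S_def eval_int_poly_sum eval_int_poly_monom power_mult omega_pow by simp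
    ultimately show ?thesis using R dm by (intro exI[of _ "R * S"]) (simp add: algebra_simps)
  next
    case False
    then have dm: "Suc m div e = m div e" "Suc m mod e = Suc (m mod e)"
      by (auto simp: div_Suc mod_Suc)
    have "ev (q_int (Suc m)) = ev (q_int (Suc (m mod e)))"
      using eval_q_int_mod[of "Suc m"] dm by simp
    then show ?thesis using R dm by (intro exI[of _ "R * q_int (Suc m)"]) (simp add: q_fact_Suc algebra_simps)
  qed
qed

text \<open>Compare exponents of \<open>q_int e\<close>, using
  \<open>e * p + 1 = e * (da + db) + (r + s)\<close>. For \<open>r \<le> 1\<close> this forces
  \<open>r + s = 1\<close>, the powers cancel and a binomial coefficient remains. Otherwise
  \<open>da + db < p\<close>, a factor \<open>q_int e\<close> is left over, and the value is
  0.\<close>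

lemma eval_q_catalan:
  assumes "a > 0" "b > 0" and F: "F * (q_fact a * q_fact b) = q_fact (a + b - 1)" and p: "p * e = a + b - 1"
  shows "ev F = (if a mod e \<le> 1 then of_nat (p choose (a div e)) else 0)"
proof -
  define u where "u = ev (q_fact (e - 1))"
  have u0: "u \<noteq> 0" unfolding u_def using eval_q_fact_neq_0[of "e - 1"] e2 by simp
  have qe: "q_int e \<noteq> 0" using q_int_neq_0 e2 by simp
  define da db r s where "da = a div e" and "db = b div e" and "r = a mod e" and "s = b mod e"
  have ab: "a = e * da + r" "b = e * db + s" "r < e" "s < e" using e2 by (auto simp: da_def db_def r_def s_def)
  obtain A where A: "q_fact a = q_int e ^ da * A" "ev A = fact da * u ^ da * ev (q_fact r)"
    using q_fact_factor[of a] unfolding u_def da_def r_def by blast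
  obtain B where B: "q_fact b = q_int e ^ db * B" "ev B = fact db * u ^ db * ev (q_fact s)"
    using q_fact_factor[of b] unfolding u_def db_def s_def by blast
  have "(a + b - 1) div e = p" "(a + b - 1) mod e = 0" using p[symmetric] e2 by auto
  then obtain C where C: "q_fact (a + b - 1) = q_int e ^ p * C" "ev C = fact p * u ^ p"
    using q_fact_factor[of "a + b - 1"] unfolding u_def by auto
  have FC: "q_int e ^ (da + db) * (F * A * B) = q_int e ^ p * C"
    using F unfolding A B C by (simp add: power_add algebra_simps)
  have sum: "e * p + 1 = e * (da + db) + (r + s)" 
  proof -
    have "p * e + 1 = a + b" using p assms(1) by linarith
    also have "\<dots> = (e * da + r) + (e * db + s)" using ab(1,2) by (rule arg_cong2)
    finally show ?thesis by (simp add: algebra_simps)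
  qed
  have A0: "ev A \<noteq> 0" and B0: "ev B \<noteq> 0"
    using A B u0 eval_q_fact_neq_0 ab by auto
  show ?thesis
  proof (cases "r \<le> 1")
    case True
    have "(r + s) mod e = (e * (da + db) + (r + s)) mod e" by simp
    also have "\<dots> = (1 + e * p) mod e" unfolding sum[symmetric] by (simp add: add.commute)
    also have "\<dots> = 1" unfolding mod_mult_self2 using e2 by simp
    finally have "(r + s) mod e = 1" .
    have rs: "r + s = 1"
    proof (cases "r + s < e")
      case True
      then show ?thesis using \<open>(r + s) mod e = 1\<close> by simp
    next
      case False
      then have "r + s = e" using \<open>r \<le> 1\<close> ab by simp
      then show ?thesis using \<open>(r + s) mod e = 1\<close> by simp
    qed
    then have pd: "p = da + db" using sum e2 by auto
    then have "F * A * B = C" using FC qe by simp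
    then have "ev F * ev A * ev B = ev C"
      by (metis eval_int_poly_mult)
    moreover have "ev (q_fact r) = 1" "ev (q_fact s) = 1"
    proof -
      have "q_fact k = 1" if "k \<le> 1" for k using that by (cases k) (auto simp: q_fact_Suc)
      then show "ev (q_fact r) = 1" "ev (q_fact s) = 1" using rs by simp_all
    qed
    ultimately have "(ev F * (fact da * fact db)) * u ^ p = fact p * u ^ p"
      unfolding A B C by (simp add: pd power_add algebra_simps)
    then have "ev F * (fact da * fact db) = fact p" using u0 by simp
    moreover have "of_nat (p choose da) * (fact da * fact db) = (fact p :: complex)"
    proof -
      have "fact da * fact db * (p choose da) = fact p" using binomial_fact_lemma[of da p] pd by simp
      then have "of_nat (fact da * fact db * (p choose da)) = (of_nat (fact p) :: complex)" by (simp only:)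
      then show ?thesis by (simp add: algebra_simps)
    qed
    ultimately have "ev F * (fact da * fact db) = of_nat (p choose da) * (fact da * fact db)" by simp
    then have "ev F = of_nat (p choose da)" by simp
    then show ?thesis using True by (simp add: da_def r_def)
  next
    case False
    have "da + db < p"
    proof (rule ccontr)
      assume "\<not> da + db < p"
      then have "e * p \<le> e * (da + db)" by simp
      then show False using sum False by linarith
    qed
    then obtain k where k: "p = da + db + Suc k" using less_imp_Suc_add by auto
    have "q_int e ^ (da + db) * (F * A * B) = q_int e ^ (da + db) * (q_int e * (q_int e ^ k * C))"
      using FC unfolding k by (simp add: power_add algebra_simps)
    then have "F * A * B = q_int e * (q_int e ^ k * C)" using qe by simp
    then have "ev F * ev A * ev B = ev (q_int e) * ev (q_int e ^ k * C)"
      by (metis eval_int_poly_mult)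
    then have "ev F = 0" using A0 B0 eval_q_int_eq_0 by simp
    then show ?thesis using False by (simp add: r_def)
  qed
qed

end

lemma eval_q_catalan_1:
  assumes F: "F * (q_fact a * q_fact b) = q_fact (a + b - 1)"
    and c: "c * (fact a * fact b) = fact (a + b - 1)"
  shows "eval_int_poly 1 F = of_nat c"
proof -
  have "eval_int_poly 1 F * (fact a * fact b) = fact (a + b - 1)"
    using arg_cong[OF F, of "eval_int_poly 1"] by (simp only: eval_int_poly_mult eval_q_fact_1)
  moreover have "of_nat (c * (fact a * fact b)) = (of_nat (fact (a + b - 1)) :: complex)" by (simp only: c)
  ultimately have "eval_int_poly 1 F * (fact a * fact b) = of_nat c * (fact a * fact b)" by simp
  then show ?thesis by simp
qed

lemma nat_poly_of_nonneg:
  assumes "\<And>j. coeff F j \<ge> 0"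
  shows "map_poly int (map_poly nat F) = F"
    and "poly (map_poly of_nat (map_poly nat F)) z = eval_int_poly z F"
proof -
  show *: "map_poly int (map_poly nat F) = F"
    by (rule poly_eqI) (simp add: coeff_map_poly assms)
  have "map_poly of_nat (map_poly nat F) = (map_poly of_int F :: complex poly)"
    by (rule poly_eqI) (simp add: coeff_map_poly assms)
  then show "poly (map_poly of_nat (map_poly nat F)) z = eval_int_poly z F"
    by (simp add: eval_int_poly_def)
qed

section \<open>Lasers\<close>

lemma count_list_steps: "count_list xs North + count_list xs East = length xs"
proof (induction xs)
  case (Cons x xs)
  then show ?case by (cases x) auto
qed simp

locale dyck_geometry =
  fixes a b :: nat and D :: "step list"
  assumes a_pos: "a > 0" and b_pos: "b > 0" and coprime_ab: "coprime a b" and dyck: "dyck_path a b D"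
begin

definition px :: "nat \<Rightarrow> nat" where "px i = count_list (take i D) East"
definition py :: "nat \<Rightarrow> nat" where "py i = count_list (take i D) North"
definition ph :: "nat \<Rightarrow> int" where "ph i = int b * int (py i) - int a * int (px i)"

abbreviation "rx i \<equiv> real (px i)"
abbreviation "ry i \<equiv> real (py i)"
abbreviation "rh i \<equiv> real_of_int (ph i)"
abbreviation "on_step i x y \<equiv> if D ! i = North then x = rx i \<and> ry i \<le> y \<and> y \<le> ry i + 1
  else rx i \<le> x \<and> x \<le> rx i + 1 \<and> y = ry i"

lemma length_D: "length D = a + b"
  using dyck count_list_steps[of D] by (auto simp: dyck_path_def)

lemma lattice_pt_eq: "lattice_pt D i = (rx i, ry i)"
  by (simp add: lattice_pt_def px_def py_def)

lemma px_py: "i \<le> a + b \<Longrightarrow> py i + px i = i"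
  using count_list_steps[of "take i D"] by (simp add: px_def py_def length_D)

lemma step_North: "i < a + b \<Longrightarrow> D ! i = North \<Longrightarrow> px (Suc i) = px i \<and> py (Suc i) = Suc (py i) \<and> ph (Suc i) = ph i + int b"
  by (simp add: px_def py_def ph_def take_Suc_conv_app_nth length_D algebra_simps)

lemma step_East: "i < a + b \<Longrightarrow> D ! i \<noteq> North \<Longrightarrow> px (Suc i) = Suc (px i) \<and> py (Suc i) = py i \<and> ph (Suc i) = ph i - int a"
  by (cases "D ! i") (auto simp: px_def py_def ph_def take_Suc_conv_app_nth length_D algebra_simps)

lemma px_mono: "i \<le> j \<Longrightarrow> px i \<le> px j" and py_mono: "i \<le> j \<Longrightarrow> py i \<le> py j"
proof -
  have "take j D = take i D @ take (j - i) (drop i D)" if "i \<le> j"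
    using that take_add[of i "j - i" D] by simp
  then show "i \<le> j \<Longrightarrow> px i \<le> px j" "i \<le> j \<Longrightarrow> py i \<le> py j" by (auto simp: px_def py_def)
qed

lemma ph_real: "rh i = real b * ry i - real a * rx i"
  by (simp add: ph_def)

lemma ph_nonneg: "i \<le> a + b \<Longrightarrow> ph i \<ge> 0"
proof -
  assume "i \<le> a + b"
  then have "real a / real b * rx i \<le> ry i"
    using dyck by (auto simp: dyck_path_def lattice_pt_eq length_D)
  then have "real a * rx i \<le> real b * ry i" using b_pos by (simp add: field_simps)
  then have "0 \<le> rh i" by (simp add: ph_real)
  then show ?thesis by simp
qed

lemma ph_0 [simp]: "ph 0 = 0" by (simp add: ph_def px_def py_def)

lemma ph_last [simp]: "ph (a + b) = 0"
  using dyck by (simp add: ph_def px_def py_def dyck_path_def flip: length_D)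

text \<open>By \<open>px_py\<close> the height at index \<open>k\<close> is \<open>- a * k\<close>
  modulo \<open>a + b\<close>, so equal heights give \<open>a + b dvd j - i\<close>. Hence different
  lasers have different levels.\<close>

lemma ph_distinct: "i < j \<Longrightarrow> j < a + b \<Longrightarrow> ph i \<noteq> ph j"
proof
  assume ij: "i < j" "j < a + b" and eq: "ph i = ph j"
  have h: "ph k = (int a + int b) * int (py k) - int a * int k" if "k \<le> a + b" for k
  proof -
    have e: "int (px k) = int k - int (py k)" using px_py[OF that] by linarith
    show ?thesis unfolding ph_def e by (simp add: algebra_simps)
  qed
  have "(int a + int b) * (int (py j) - int (py i)) = int a * (int j - int i)"
    using eq h[of i] h[of j] ij by (simp add: algebra_simps)
  moreover have "coprime (int a + int b) (int a)"
    by (rule coprime_int_add[OF coprime_ab])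
  ultimately have "int a + int b dvd int j - int i"
    by (metis coprime_dvd_mult_right_iff dvd_triv_left)
  then show False using ij zdvd_imp_le[of "int a + int b" "int j - int i"] by linarith
qed

lemma ph_pos: "0 < i \<Longrightarrow> i < a + b \<Longrightarrow> ph i > 0"
  using ph_distinct[of 0 i] ph_nonneg[of i] by simp

text \<open>The counterpart of \<open>prev_low\<close> on the finite path; the two are matched in
  \<open>hom_partition_path_word\<close>.\<close>

definition plow :: "nat \<Rightarrow> nat \<Rightarrow> bool" where
  "plow k i \<longleftrightarrow> k < i \<and> ph k < ph i \<and> (\<forall>l. k < l \<and> l < i \<longrightarrow> ph i \<le> ph l)"

lemma plow_unique: "plow k i \<Longrightarrow> plow l i \<Longrightarrow> k = l"
  unfolding plow_def by (meson linorder_neqE_nat not_le)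

lemma plow_exists:
  assumes "0 < i" "i < a + b"
  obtains k where "plow k i"
proof -
  let ?P = "\<lambda>k. k < i \<and> ph k < ph i"
  have 0: "?P 0" using assms ph_pos by simp
  have g: "?P (GREATEST k. ?P k)" by (rule GreatestI_nat[of ?P 0 i]) (use 0 in auto)
  have "ph i \<le> ph l" if "(GREATEST k. ?P k) < l" "l < i" for l
  proof (rule ccontr)
    assume "\<not> ph i \<le> ph l"
    then have "l \<le> (GREATEST k. ?P k)" using that by (intro Greatest_le_nat[of ?P l i]) auto
    then show False using that by simp
  qed
  then show ?thesis using g that unfolding plow_def by blast
qed

lemma plow_North: "plow k i \<Longrightarrow> i < a + b \<Longrightarrow> D ! k = North"
proof (rule ccontr)
  assume p: "plow k i" "i < a + b" "D ! k \<noteq> North"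
  then have "ph (Suc k) < ph k" using step_East[of k] a_pos by (simp add: plow_def)
  moreover have "ph i \<le> ph (Suc k)" using p(1) by (cases "Suc k = i") (auto simp: plow_def)
  ultimately show False using p by (simp add: plow_def)
qed

lemma segment_iff:
  assumes "i < a + b"
  shows "(x, y) \<in> closed_segment (lattice_pt D i) (lattice_pt D (Suc i)) \<longleftrightarrow>
    on_step i x y" (is "_ \<longleftrightarrow> ?R")
proof (cases "D ! i = North")
  case True
  then have s: "lattice_pt D (Suc i) = (rx i, ry i + 1)" using step_North[OF assms] by (simp add: lattice_pt_eq)
  show ?thesis
  proof
    assume "(x, y) \<in> closed_segment (lattice_pt D i) (lattice_pt D (Suc i))"
    then obtain t where t: "0 \<le> t" "t \<le> 1" "(x, y) = (1 - t) *\<^sub>R lattice_pt D i + t *\<^sub>R lattice_pt D (Suc i)"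
      unfolding in_segment by blast
    then have "x = rx i" "y = ry i + t" unfolding s lattice_pt_eq[of i] by (auto simp: algebra_simps)
    then show ?R using True t by simp
  next
    assume ?R
    then have "x = rx i" "ry i \<le> y" "y \<le> ry i + 1" using True by auto
    then show "(x, y) \<in> closed_segment (lattice_pt D i) (lattice_pt D (Suc i))"
      unfolding in_segment s lattice_pt_eq[of i]
      by (intro exI[of _ "y - ry i"]) (auto simp: algebra_simps)
  qed
next
  case False
  then have s: "lattice_pt D (Suc i) = (rx i + 1, ry i)" using step_East[OF assms] by (simp add: lattice_pt_eq)
  show ?thesis
  proof
    assume "(x, y) \<in> closed_segment (lattice_pt D i) (lattice_pt D (Suc i))"
    then obtain t where t: "0 \<le> t" "t \<le> 1" "(x, y) = (1 - t) *\<^sub>R lattice_pt D i + t *\<^sub>R lattice_pt D (Suc i)"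
      unfolding in_segment by blast
    then have "x = rx i + t" "y = ry i" unfolding s lattice_pt_eq[of i] by (auto simp: algebra_simps)
    then show ?R using False t by simp
  next
    assume ?R
    then have "y = ry i" "rx i \<le> x" "x \<le> rx i + 1" using False by auto
    then show "(x, y) \<in> closed_segment (lattice_pt D i) (lattice_pt D (Suc i))"
      unfolding in_segment s lattice_pt_eq[of i]
      by (intro exI[of _ "x - rx i"]) (auto simp: algebra_simps)
  qed
qed

lemma path_trace_iff:
  "(x, y) \<in> path_trace D \<longleftrightarrow> (\<exists>i < a + b. on_step i x y)"
  unfolding path_trace_def length_D using segment_iff by auto

lemma region_iff:
  "(x, y) \<in> region_below a b D \<longleftrightarrow> 0 \<le> real b * y - real a * x \<and> (\<exists>y' \<ge> y. (x, y') \<in> path_trace D)"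
  using b_pos unfolding region_below_def by (auto simp: field_simps)

lemma laser_iff:
  "(x, y) \<in> laser a b D m \<longleftrightarrow> (\<exists>t \<ge> 0. x = rx m + t * real b \<and> y = ry m + t * real a \<and>
     (\<forall>s. 0 < s \<and> s < t \<longrightarrow> (rx m + s * real b, ry m + s * real a) \<notin> path_trace D))"
  unfolding laser_def lattice_pt_eq by auto

text \<open>Lasers lie on integer levels of \<open>b * y - a * x\<close>. A label has level
  \<open>ph i - b * \<epsilon>\<close>, which is not an integer for small \<open>\<epsilon>\<close>,
  so its level line meets no laser.\<close>

lemma laser_level: "(x, y) \<in> laser a b D m \<Longrightarrow> real b * y - real a * x = rh m"
  unfolding laser_iff ph_real by (auto simp: algebra_simps)

text \<open>Along an East step the level is lowest at the right end. So lattice points at level at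
  least \<open>h\<close> keep the path at or above \<open>h\<close> in every column between them,
  and the level line runs inside the region.\<close>

lemma trace_above:
  assumes "j \<le> i" "i < a + b" "rx j \<le> x" "x \<le> rx i" "\<And>l. j \<le> l \<Longrightarrow> l \<le> i \<Longrightarrow> h \<le> rh l"
  shows "\<exists>y'. (x, y') \<in> path_trace D \<and> h \<le> real b * y' - real a * x"
  using assms
proof (induction i rule: dec_induct)
  case base
  then have x: "x = rx j" by simp
  have "(x, ry j) \<in> path_trace D"
    unfolding path_trace_iff using base x by (intro exI[of _ j]) auto
  then show ?case using base(4)[of j] x by (auto simp: ph_real)
next
  case (step i)
  show ?case
  proof (cases "x \<le> rx i")
    case True
    then show ?thesis using step by simp
  next
    case False
    then have E: "D ! i \<noteq> North" using step step_North[of i] by auto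
    then have s: "px (Suc i) = Suc (px i)" "py (Suc i) = py i" using step_East[of i] step by auto
    have "(x, ry i) \<in> path_trace D"
      unfolding path_trace_iff using step False E s by (intro exI[of _ i]) auto
    moreover have "h \<le> real b * ry i - real a * x"
    proof -
      have "h \<le> real b * ry (Suc i) - real a * rx (Suc i)" using step.prems(4)[of "Suc i"] step.hyps by (simp add: ph_real)
      moreover have "real a * x \<le> real a * rx (Suc i)" using step.prems by (intro mult_left_mono) auto
      ultimately show ?thesis using s by simp
    qed
    ultimately show ?thesis by blast
  qed
qed

text \<open>This locates the end of the laser from \<open>m\<close>: the path first drops below the
  level of the laser on an East step \<open>l\<close>, and the laser hits that step.\<close>

lemma first_below:
  assumes "D ! m = North" "m < k" "k \<le> a + b" "ph k < ph m"
  obtains l where "m < l" "l < k" "D ! l \<noteq> North" "ph m \<le> ph l" "ph (Suc l) < ph m"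
    "\<And>l'. m < l' \<Longrightarrow> l' \<le> l \<Longrightarrow> ph m \<le> ph l'"
proof -
  define z where "z = (LEAST z. m < z \<and> ph z < ph m)"
  have z: "m < z" "ph z < ph m" "z \<le> k"
    using LeastI[of "\<lambda>z. m < z \<and> ph z < ph m" k] Least_le[of "\<lambda>z. m < z \<and> ph z < ph m" k] assms by (auto simp: z_def)
  have ge: "ph m \<le> ph l'" if "m < l'" "l' < z" for l'
    using not_less_Least[of l' "\<lambda>z. m < z \<and> ph z < ph m"] that by (auto simp: z_def)
  have "ph (Suc m) = ph m + int b" using step_North[of m] assms by simp
  then have "z \<noteq> Suc m" using z by auto
  then obtain l where l: "z = Suc l" "m < l" using z by (cases z) auto
  have "ph m \<le> ph l" using ge l by simp
  moreover have "D ! l \<noteq> North" using step_North[of l] l z assms \<open>ph m \<le> ph l\<close> by auto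
  ultimately show ?thesis using that[of l] l z ge by auto
qed

text \<open>At an interior point of North step \<open>k\<close> the laser would be above the level
  of the south end. So the path has dropped below the laser on an East step \<open>l\<close> before
  \<open>k\<close>, and the laser has already stopped there.\<close>

lemma laser_avoids_North:
  assumes m: "m < a + b" "D ! m = North" and k: "k < a + b" and s: "0 < s" "s < 1"
  shows "(rx k, ry k + s) \<notin> laser a b D m"
proof
  assume L: "(rx k, ry k + s) \<in> laser a b D m"
  then obtain t where t: "t \<ge> 0" "rx k = rx m + t * real b" "ry k + s = ry m + t * real a"
    "\<And>s. 0 < s \<Longrightarrow> s < t \<Longrightarrow> (rx m + s * real b, ry m + s * real a) \<notin> path_trace D"
    unfolding laser_iff by blast
  have "t \<noteq> 0"
  proof
    assume "t = 0"
    then have "ry k < ry m" "ry m < real (Suc (py k))" using t s by auto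
    then show False unfolding of_nat_less_iff by linarith
  qed
  then have t0: "t > 0" using t by simp
  then have "px m < px k" using t(2) b_pos by (metis less_add_same_cancel1 mult_pos_pos of_nat_0_less_iff of_nat_less_iff)
  then have mk: "m < k" using px_mono[of k m] by (meson not_le)
  have "rh k + real b * s = rh m"
    using laser_level[OF L] by (simp add: ph_real algebra_simps)
  moreover have "real b * s > 0" using b_pos s by simp
  ultimately have "ph k < ph m" by linarith
  then obtain l where l: "m < l" "l < k" "D ! l \<noteq> North" "ph m \<le> ph l" "ph (Suc l) < ph m"
    using first_below[OF m(2) mk] k by auto
  have E: "px (Suc l) = Suc (px l)" "ph (Suc l) = ph l - int a" using step_East[of l] l k by auto
  \<comment> \<open>The hitting point on step \<open>l\<close>: going east by \<open>r\<close>
    lowers the level from \<open>ph l\<close> to \<open>ph m\<close>. Below, \<open>s'\<close> is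
    the parameter of this point on the laser.\<close>
  define r where "r = (rh l - rh m) / real a"
  have r: "0 \<le> r" "r < 1" using l E a_pos by (auto simp: r_def field_simps)
  define s' where "s' = (ry l - ry m) / real a"
  have "real a * r = rh l - rh m" using a_pos by (simp add: r_def)
  then have "real b * (ry l - ry m) = real a * (rx l + r - rx m)"
    by (simp add: ph_real algebra_simps)
  then have pt: "rx m + s' * real b = rx l + r" "ry m + s' * real a = ry l"
    using a_pos by (auto simp: s'_def field_simps)
  have "py m < py l" using py_mono[of "Suc m" l] step_North[of m] m l by simp
  then have "0 < s'" using a_pos by (simp add: s'_def)
  moreover have "s' < t"
  proof -
    have "rx l + r < rx k" using px_mono[of "Suc l" k] l E r by auto
    then have "s' * real b < t * real b" using pt t by linarith
    then show ?thesis using b_pos by simp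
  qed
  ultimately have "(rx l + r, ry l) \<notin> path_trace D" using t(4)[of s'] pt by simp
  moreover have "(rx l + r, ry l) \<in> path_trace D"
    unfolding path_trace_iff using l k r by (intro exI[of _ l]) auto
  ultimately show False by simp
qed

section \<open>Connecting and separating labels\<close>

abbreviation "free_region \<equiv> region_below a b D - laser_fire a b D"

lemma connected_component_segment:
  fixes x y :: "real \<times> real"
  shows "closed_segment x y \<subseteq> S \<Longrightarrow> connected_component S x y"
  unfolding connected_component_def by (intro exI[of _ "closed_segment x y"]) auto

text \<open>The end point depends on \<open>k\<close> alone, so labels with the same
  \<open>plow\<close> are joined through it. The descent runs on the North step \<open>k\<close>
  itself, which belongs to the closed region and whose interior no laser touches. The bound on
  \<open>\<epsilon>\<close> gives \<open>b * \<epsilon> < 1 / 2\<close>, which keeps the walk to the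
  left off integer levels.\<close>

lemma label_connected:
  assumes i: "0 < i" "i < a + b" and k: "plow k i" and \<epsilon>: "0 < \<epsilon>" "\<epsilon> < 1 / (2 * real b)"
  shows "connected_component free_region (label_pt D \<epsilon> i) (rx k, ry k + \<epsilon>)"
proof -
  have kN: "D ! k = North" using plow_North[OF k i(2)] .
  have ki: "k < i" "ph k < ph i" using k by (auto simp: plow_def)
  have ge: "ph i \<le> ph l" if "Suc k \<le> l" "l \<le> i" for l using k that by (cases "l = i") (auto simp: plow_def)
  have sk: "px (Suc k) = px k" "py (Suc k) = Suc (py k)" "ph (Suc k) = ph k + int b" using step_North[of k] ki i kN by auto
  have be: "0 < real b * \<epsilon>" "2 * (real b * \<epsilon>) < 1" using \<epsilon> b_pos by (auto simp: field_simps)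
  define h where "h = rh i - real b * \<epsilon>"
  have hk: "rh k + 1 \<le> rh i" using ki by linarith
  have h0: "0 < h" using hk be ph_nonneg[of k] ki i unfolding h_def by linarith
  \<comment> \<open>The distance from the south end at which the North step \<open>k\<close> meets
    the level \<open>h\<close>.\<close>
  define s1 where "s1 = (h - rh k) / real b"
  have bs1: "real b * s1 = h - rh k" using b_pos by (simp add: s1_def)
  have s1: "\<epsilon> \<le> s1" "s1 < 1"
  proof -
    have "real b * \<epsilon> \<le> real b * s1" using bs1 be hk unfolding h_def by linarith
    then show "\<epsilon> \<le> s1" using b_pos by simp
    have "rh i \<le> rh k + real b" using ge[of "Suc k"] ki sk by simp
    then have "real b * s1 < real b * 1" using bs1 be unfolding h_def by linarith
    then show "s1 < 1" using b_pos by simp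
  qed
  define q where "q = (rx k, ry k + s1)"
  have "closed_segment (label_pt D \<epsilon> i) q \<subseteq> free_region"
  proof
    fix p assume "p \<in> closed_segment (label_pt D \<epsilon> i) q"
    then obtain t where t: "0 \<le> t" "t \<le> 1" "p = (1 - t) *\<^sub>R label_pt D \<epsilon> i + t *\<^sub>R q" unfolding in_segment by blast
    obtain x y where p: "p = (x, y)" by (cases p)
    have xy: "x = (1 - t) * rx i + t * rx k" "y = (1 - t) * (ry i - \<epsilon>) + t * (ry k + s1)"
      using t(3) by (auto simp: p q_def label_pt_def lattice_pt_eq)
    have "real b * y - real a * x = (1 - t) * (real b * ry i - real a * rx i - real b * \<epsilon>)
        + t * (real b * ry k - real a * rx k + real b * s1)"
      unfolding xy by (simp add: algebra_simps)
    also have "\<dots> = (1 - t) * h + t * h" unfolding bs1 h_def by (simp add: ph_real)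
    finally have lev: "real b * y - real a * x = h" by (simp add: algebra_simps)
    have pk: "rx k \<le> rx i" using px_mono[of k i] ki by simp
    have x1: "rx (Suc k) \<le> x" "x \<le> rx i"
    proof -
      have "t * (rx i - rx k) \<le> 1 * (rx i - rx k)" using t pk by (intro mult_right_mono) auto
      moreover have "0 \<le> t * (rx i - rx k)" using t pk by simp
      ultimately show "rx (Suc k) \<le> x" "x \<le> rx i" unfolding xy sk by (auto simp: algebra_simps)
    qed
    obtain y' where y': "(x, y') \<in> path_trace D" "rh i \<le> real b * y' - real a * x"
      using trace_above[of "Suc k" i x "rh i"] ki i x1 ge by auto
    have "real b * y \<le> real b * y'" using y' lev be unfolding h_def by linarith
    then have "y \<le> y'" using b_pos by simp
    then have "p \<in> region_below a b D" unfolding p region_iff using lev h0 y' by auto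
    moreover have "p \<notin> laser_fire a b D"
    proof
      assume "p \<in> laser_fire a b D"
      then obtain m where "p \<in> laser a b D m" unfolding laser_fire_def by blast
      then have "h = rh m" using laser_level[of x y m] lev p by simp
      then have "real_of_int (ph i - ph m) = real b * \<epsilon>" unfolding h_def by simp
      then have "0 < ph i - ph m" "ph i - ph m < 1" using be by linarith+
      then show False by simp
    qed
    ultimately show "p \<in> free_region" by simp
  qed
  then have 1: "connected_component free_region (label_pt D \<epsilon> i) q" by (rule connected_component_segment)
  have "closed_segment q (rx k, ry k + \<epsilon>) \<subseteq> free_region"
  proof
    fix p assume "p \<in> closed_segment q (rx k, ry k + \<epsilon>)"
    then obtain t where t: "0 \<le> t" "t \<le> 1" "p = (1 - t) *\<^sub>R q + t *\<^sub>R (rx k, ry k + \<epsilon>)" unfolding in_segment by blast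
    define s where "s = (1 - t) * s1 + t * \<epsilon>"
    have p: "p = (rx k, ry k + s)" using t(3) by (simp add: q_def s_def algebra_simps)
    have "0 \<le> (1 - t) * (s1 - \<epsilon>)" "0 \<le> t * (s1 - \<epsilon>)" using t s1 by auto
    then have s: "\<epsilon> \<le> s" "s \<le> s1" unfolding s_def by (auto simp: algebra_simps)
    have "p \<in> path_trace D" unfolding p path_trace_iff using kN ki i s s1 \<epsilon> by (intro exI[of _ k]) auto
    moreover have "0 \<le> real b * (ry k + s) - real a * rx k"
    proof -
      have "0 \<le> rh k" using ph_nonneg[of k] ki i by simp
      moreover have "0 \<le> real b * s" using s \<epsilon> by simp
      ultimately show ?thesis by (simp add: ph_real algebra_simps)
    qed
    ultimately have "p \<in> region_below a b D" unfolding p region_iff by auto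
    moreover have "p \<notin> laser_fire a b D"
      unfolding laser_fire_def p length_D using laser_avoids_North[of _ k s] ki i s s1 \<epsilon> by auto
    ultimately show "p \<in> free_region" by simp
  qed
  then have "connected_component free_region q (rx k, ry k + \<epsilon>)" by (rule connected_component_segment)
  with 1 show ?thesis by (rule connected_component_trans)
qed

text \<open>The laser from \<open>k\<close> and the path enclose a pocket that contains label
  \<open>i\<close>; by \<open>sep\<close>, label \<open>j\<close> comes before the start of the
  laser or after its end. The condition \<open>0 < k\<close> ensures that the path later drops below
  the level of the laser, whereas the laser from index 0 only follows the boundary line.\<close>

lemma labels_separated:
  assumes i: "0 < i" "i < a + b" and k: "plow k i" "0 < k" and j: "0 < j" "j < a + b"
    and sep: "j \<le> k \<or> ph j < ph k" and \<epsilon>: "0 < \<epsilon>" "\<epsilon> < 1 / (2 * real b)"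
  shows "\<not> connected_component free_region (label_pt D \<epsilon> i) (label_pt D \<epsilon> j)"
proof
  assume "connected_component free_region (label_pt D \<epsilon> i) (label_pt D \<epsilon> j)"
  then obtain C where C: "connected C" "C \<subseteq> free_region" "label_pt D \<epsilon> i \<in> C" "label_pt D \<epsilon> j \<in> C"
    unfolding connected_component_def by blast
  have kN: "D ! k = North" using plow_North[OF k(1) i(2)] .
  have ki: "k < i" "ph k < ph i" using k by (auto simp: plow_def)
  have be: "0 < real b * \<epsilon>" "2 * (real b * \<epsilon>) < 1" using \<epsilon> b_pos by (auto simp: field_simps)
  have "ph (a + b) < ph k" using ph_pos[of k] k ki i by simp
  then obtain l where l: "k < l" "l < a + b" "D ! l \<noteq> North" "ph k \<le> ph l" "ph (Suc l) < ph k"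
    "\<And>l'. k < l' \<Longrightarrow> l' \<le> l \<Longrightarrow> ph k \<le> ph l'"
    using first_below[OF kN, of "a + b"] ki i by auto
  have above: "ph k < ph l'" if "k < l'" "l' \<le> l" for l' using l(6)[OF that] ph_distinct[of k l'] that l by force
  have E: "px (Suc l) = Suc (px l)" "py (Suc l) = py l" "ph (Suc l) = ph l - int a" using step_East[of l] l by auto
  have il: "i \<le> l"
  proof (rule ccontr)
    assume "\<not> i \<le> l"
    then have "ph i \<le> ph (Suc l)" using k(1) l by (cases "Suc l = i") (auto simp: plow_def)
    then show False using l ki by simp
  qed
  define r where "r = (rh l - rh k) / real a"
  have r: "0 < r" "r < 1" using above[of l] l E a_pos by (auto simp: r_def field_simps)
  have ar: "real a * r = rh l - rh k" using a_pos by (simp add: r_def)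
  define xs where "xs = rx l + r"
  \<comment> \<open>\<open>O1\<close> contains the pocket, \<open>O2\<close> the outside. The bound
    \<open>ry k < snd p\<close> separates \<open>O1\<close> from the part left of
    \<open>rx k\<close>, where points of the region are no higher than \<open>ry k\<close>.\<close>
  define O1 where "O1 = {p :: real \<times> real. rh k < real b * snd p - real a * fst p} \<inter> {p. fst p < xs} \<inter> {p. ry k < snd p}"
  define O2 where "O2 = {p :: real \<times> real. real b * snd p - real a * fst p < rh k} \<union> {p. xs < fst p} \<union> {p. fst p < rx k}"
  have "open O1" unfolding O1_def by (intro open_Int open_Collect_less continuous_intros)
  moreover have "open O2" unfolding O2_def by (intro open_Un open_Collect_less continuous_intros)
  moreover have "C \<inter> O1 \<inter> O2 = {}"
  proof (rule ccontr)
    assume "C \<inter> O1 \<inter> O2 \<noteq> {}"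
    then obtain x y where p: "(x, y) \<in> C" "(x, y) \<in> O1" "(x, y) \<in> O2" by auto
    then have x: "x < rx k" "ry k < y" by (auto simp: O1_def O2_def)
    obtain y' where y': "y \<le> y'" "(x, y') \<in> path_trace D" using p(1) C(2) region_iff by blast
    then obtain m where m: "m < a + b" "on_step m x y'" unfolding path_trace_iff by blast
    have "rx m \<le> x" using m by (auto split: if_splits)
    then have "m < k" using px_mono[of k m] x by (cases "k \<le> m") auto
    then have "py (Suc m) \<le> py k" using py_mono by simp
    moreover have "y' \<le> ry (Suc m)" using m step_North[of m] step_East[of m] by (cases "D ! m = North") auto
    ultimately show False using x y' by linarith
  qed
  \<comment> \<open>A point of the region in neither set would lie on the laser, or straight above
    its end at abscissa \<open>xs\<close> and hence above the path.\<close>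
  moreover have "C \<subseteq> O1 \<union> O2"
  proof
    fix p assume "p \<in> C"
    obtain x y where p: "p = (x, y)" by (cases p)
    show "p \<in> O1 \<union> O2"
    proof (rule ccontr)
      assume nO: "p \<notin> O1 \<union> O2"
      then have lev: "rh k \<le> real b * y - real a * x" and x: "rx k \<le> x" "x \<le> xs"
        by (auto simp: O2_def p)
      have reg: "(x, y) \<in> region_below a b D" "(x, y) \<notin> laser_fire a b D" using \<open>p \<in> C\<close> C(2) p by auto
      show False
      proof (cases "real b * y - real a * x = rh k")
        case True
        define t where "t = (x - rx k) / real b"
        have t: "0 \<le> t" "x = rx k + t * real b" using x b_pos by (auto simp: t_def)
        have y: "y = ry k + t * real a"
        proof -
          have "real b * y = real b * (ry k + t * real a)" using True unfolding t(2) by (simp add: ph_real algebra_simps)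
          then show ?thesis using b_pos by simp
        qed
        \<comment> \<open>Strictly between \<open>rx k\<close> and \<open>xs\<close> the path is
          above the laser: the vertices \<open>k + 1..l\<close> are, and step \<open>l\<close> comes
          down to that level only at \<open>xs\<close>.\<close>
        have "(rx k + s * real b, ry k + s * real a) \<notin> path_trace D" if s: "0 < s" "s < t" for s
        proof
          assume "(rx k + s * real b, ry k + s * real a) \<in> path_trace D"
          moreover define u v where "u = rx k + s * real b" and "v = ry k + s * real a"
          ultimately obtain m where m: "m < a + b" "on_step m u v" unfolding path_trace_iff by blast
          have u: "rx k < u" "u < xs"
          proof -
            show "rx k < u" using s b_pos by (simp add: u_def)
            have "s * real b < t * real b" using s b_pos by simp
            then show "u < xs" using t(2) x by (simp add: u_def)
          qed
          have levu: "real b * v - real a * u = rh k" by (simp add: u_def v_def ph_real algebra_simps)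
          have lowm: "rx m \<le> u" and upm: "u \<le> rx (Suc m)"
            using m step_North[of m] step_East[of m] by (cases "D ! m = North"; auto)+
          have "k \<le> m"
          proof (rule ccontr)
            assume "\<not> k \<le> m"
            then have "px (Suc m) \<le> px k" using px_mono by simp
            then show False using upm u by linarith
          qed
          have "m \<le> l"
          proof (rule ccontr)
            assume "\<not> m \<le> l"
            then have "px (Suc l) \<le> px m" using px_mono by simp
            then show False using lowm u E r xs_def by simp
          qed
          have "k \<noteq> m" using m kN u by auto
          then have km: "k < m" using \<open>k \<le> m\<close> by simp
          show False
          proof (cases "D ! m = North")
            case True
            have "real b * ry m \<le> real b * v" using m True by (intro mult_left_mono) auto
            then have "rh m \<le> real b * v - real a * u" using m True by (simp add: ph_real)
            then show False using above[OF km \<open>m \<le> l\<close>] levu by simp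
          next
            case False
            show False
            proof (cases "m = l")
              case True
              then have "real b * v - real a * u > real b * ry l - real a * xs"
                using m False u a_pos by simp
              moreover have "real b * ry l - real a * xs = rh k"
                using ar by (simp add: xs_def ph_real algebra_simps)
              ultimately show False using levu by simp
            next
              case False
              have sm: "px (Suc m) = Suc (px m)" "py (Suc m) = py m" using step_East[of m] m(1) \<open>D ! m \<noteq> North\<close> by auto
              have "real a * u \<le> real a * rx (Suc m)" using upm by (intro mult_left_mono) auto
              then have "rh (Suc m) \<le> real b * v - real a * u"
                using m(2) \<open>D ! m \<noteq> North\<close> sm by (simp add: ph_real)
              then show False using above[of "Suc m"] km \<open>m \<le> l\<close> False levu by simp
            qed
          qed
        qed
        then have "(x, y) \<in> laser a b D k" unfolding laser_iff using t y by (intro exI[of _ t]) auto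
        then have "(x, y) \<in> laser_fire a b D" unfolding laser_fire_def length_D using kN ki i
          by (intro UN_I[of k]) auto
        then show False using reg by simp
      next
        case False
        then have lev': "rh k < real b * y - real a * x" using lev by simp
        show False
        proof (cases "x < xs")
          case True
          have "real a * rx k \<le> real a * x" using x by (intro mult_left_mono) auto
          then have "real b * ry k < real b * y" using lev' by (simp add: ph_real)
          then have "ry k < y" using b_pos by simp
          then show False using nO lev' True by (simp add: O1_def p)
        next
          case False
          then have xeq: "x = xs" using x by simp
          obtain y' where y': "y \<le> y'" "(x, y') \<in> path_trace D" using reg region_iff by blast
          then obtain m where m: "m < a + b" "on_step m x y'" unfolding path_trace_iff by blast
          have lowm: "rx m \<le> x" and upm: "x \<le> rx (Suc m)"
            using m step_North[of m] step_East[of m] by (cases "D ! m = North"; auto)+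
          have "l \<le> m"
          proof (rule ccontr)
            assume "\<not> l \<le> m"
            then have "px (Suc m) \<le> px l" using px_mono by simp
            then show False using upm xeq r xs_def by simp
          qed
          moreover have "m \<le> l"
          proof (rule ccontr)
            assume "\<not> m \<le> l"
            then have "px (Suc l) \<le> px m" using px_mono by simp
            then show False using lowm xeq E r xs_def by simp
          qed
          ultimately have "m = l" by simp
          then have "y' = ry l" using m l by simp
          then have "real b * y \<le> real b * ry l" using y' by (intro mult_left_mono) auto
          moreover have "real b * ry l - real a * xs = rh k"
            using ar by (simp add: xs_def ph_real algebra_simps)
          ultimately show False using lev' xeq by simp
        qed
      qed
    qed
  qed
  moreover have "label_pt D \<epsilon> i \<in> O1"
  proof -
    have "py (Suc k) \<le> py i" using py_mono ki by simp
    then have y: "ry k + 1 \<le> ry i" using step_North[of k] kN ki i by simp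
    have "2 * \<epsilon> < 1"
    proof -
      have "1 * \<epsilon> \<le> real b * \<epsilon>" using b_pos \<epsilon> by (intro mult_right_mono) auto
      then show ?thesis using be by linarith
    qed
    moreover have "rx i < xs" using px_mono[OF il] r by (simp add: xs_def)
    moreover have "rh k + 1 \<le> rh i" using ki by linarith
    ultimately show ?thesis
      using y be \<epsilon> by (simp add: O1_def label_pt_def lattice_pt_eq ph_real algebra_simps)
  qed
  moreover have "label_pt D \<epsilon> j \<in> O2"
  proof (cases "j \<le> k")
    case True
    show ?thesis
    proof (cases "px j < px k")
      case True
      then show ?thesis by (simp add: O2_def label_pt_def lattice_pt_eq)
    next
      case False
      then have "px j = px k" "py j \<le> py k" using px_mono[OF True] py_mono[OF True] by auto
      have "real b * ry j \<le> real b * ry k"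
        using \<open>py j \<le> py k\<close> by (intro mult_left_mono) auto
      then show ?thesis using be \<open>px j = px k\<close> by (simp add: O2_def label_pt_def lattice_pt_eq ph_real algebra_simps)
    qed
  next
    case False
    then have "ph j < ph k" "k < j" using sep by auto
    then have "Suc l \<le> j" using above[of j] by (cases "j \<le> l") auto
    then have "px (Suc l) \<le> px j" by (rule px_mono)
    then show ?thesis using E r by (simp add: O2_def label_pt_def lattice_pt_eq xs_def)
  qed
  ultimately show False using connectedD[OF C(1), of O1 O2] C(3,4) by blast
qed

lemma not_separated_iff:
  assumes i: "0 < i" "i < a + b" and j: "0 < j" "j < a + b"
  shows "not_separated a b D i j \<longleftrightarrow> (\<exists>k. plow k i \<and> plow k j)"
proof
  assume "\<exists>k. plow k i \<and> plow k j"
  then obtain k where k: "plow k i" "plow k j" by blast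
  have "connected_component free_region (label_pt D \<epsilon> i) (label_pt D \<epsilon> j)"
    if "0 < \<epsilon>" "\<epsilon> < 1 / (2 * real b)" for \<epsilon>
    using label_connected[OF i k(1) that] label_connected[OF j k(2) that]
    by (meson connected_component_sym connected_component_trans)
  then show "not_separated a b D i j"
    unfolding not_separated_def using b_pos by (intro eventually_at_rightI[of 0 "1 / (2 * real b)"]) auto
next
  assume ns: "not_separated a b D i j"
  obtain k where k: "plow k i" using plow_exists[OF i] by blast
  obtain l where l: "plow l j" using plow_exists[OF j] by blast
  \<comment> \<open>The label with the larger \<open>plow\<close> supplies the separating laser; the
    relation being symmetric, \<open>l < k\<close> covers both cases.\<close>
  have no: "\<not> not_separated a b D i j"
    if i: "0 < i" "i < a + b" and j: "0 < j" "j < a + b" and k: "plow k i" and l: "plow l j" and "l < k" for i j k l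
  proof
    assume "not_separated a b D i j"
    then have "\<forall>\<^sub>F \<epsilon> in at_right 0. connected_component free_region (label_pt D \<epsilon> i) (label_pt D \<epsilon> j)"
      unfolding not_separated_def .
    \<comment> \<open>If \<open>k < j\<close>, then \<open>k\<close> lies strictly between
      \<open>l\<close> and \<open>j\<close>, so \<open>ph j \<le> ph k\<close>, and equality is
      excluded by \<open>ph_distinct\<close>.\<close>
    moreover have "j \<le> k \<or> ph j < ph k"
      using l \<open>l < k\<close> ph_distinct[of k j] j unfolding plow_def by (metis le_neq_trans not_le)
    then have "\<not> connected_component free_region (label_pt D \<epsilon> i) (label_pt D \<epsilon> j)"
      if "0 < \<epsilon>" "\<epsilon> < 1 / (2 * real b)" for \<epsilon> using labels_separated[OF i k _ j _ that] \<open>l < k\<close> by simp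
    then have "\<forall>\<^sub>F \<epsilon> in at_right 0. \<not> connected_component free_region (label_pt D \<epsilon> i) (label_pt D \<epsilon> j)"
      using b_pos by (intro eventually_at_rightI[of 0 "1 / (2 * real b)"]) auto
    ultimately have "\<forall>\<^sub>F \<epsilon> in at_right (0::real). False" by eventually_elim simp
    then show False by (simp add: trivial_limit_at_right_real)
  qed
  have "not_separated a b D j i"
    using ns unfolding not_separated_def by (rule eventually_mono) (rule connected_component_sym)
  then have "k = l" using no[OF i j k l] no[OF j i l k] ns by (meson linorder_neqE_nat)
  then show "\<exists>k. plow k i \<and> plow k j" using k l by blast
qed

end

section \<open>Cyclic sieving\<close>

context rational_slope
begin

section \<open>Translating between paths and words\<close>

definition path_word :: "step list \<Rightarrow> int \<Rightarrow> bool" where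
  "path_word D = periodic_ext n (\<lambda>i. D ! nat (i - 1) = North)"

lemma hom_partition_path_word:
  assumes D: "dyck_path a b D"
  shows "is_dyck (path_word D)" and "hom_partition a b D = word_part (path_word D)"
proof -
  interpret G: dyck_geometry a b D using a_pos b_pos coprime_ab D by unfold_locales
  let ?u = "path_word D"
  have SN: "Suc N = a + b" using a_pos by (simp add: N_def)
  have per: "periodic n ?u" unfolding path_word_def by (rule periodic_periodic_ext)
  have h: "height ?u (int l) = G.ph l" if "l \<le> N" for l
    using that
  proof (induction l)
    case (Suc l)
    have "?u (int l + 1) \<longleftrightarrow> D ! l = North"
      unfolding path_word_def using Suc.prems int_N by (subst periodic_ext_eq) auto
    then show ?case
      using Suc height_step[of ?u "int l + 1"] G.step_North[of l] G.step_East[of l] SN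
      by (auto simp: step_height_def add.commute)
  qed simp
  \<comment> \<open>The path ends at height 0 without ever being below it, so its last step is East
    and starts at height \<open>a\<close>.\<close>
  have "G.ph N = int a"
  proof -
    have "G.ph (Suc N) = 0" using G.ph_last SN by simp
    then show ?thesis
      using G.step_North[of N] G.step_East[of N] G.ph_nonneg[of N] SN b_pos by (cases "D ! N = North") auto
  qed
  then have "height ?u n = int a" using h[of N] int_N by simp
  then show dy: "is_dyck ?u"
  proof (intro is_dyckI[OF per ones_eq_if_height])
    fix i assume i: "1 \<le> i" "i \<le> n"
    then have "i = int (nat i)" "nat i \<le> N" using int_N by auto
    then show "0 \<le> height ?u i" using h[of "nat i"] G.ph_nonneg[of "nat i"] SN by simp
  qed
  have low: "low ?u (int k) (int i)" if k: "G.plow k i" "i \<le> N" for k i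
    unfolding prev_low_def
  proof (intro conjI allI impI)
    show "int k < int i" "height ?u (int k) < height ?u (int i)" using k h[of k] h[of i] by (auto simp: G.plow_def)
    fix l assume l: "int k < l \<and> l < int i"
    then have "l = int (nat l)" "k < nat l" "nat l < i" by auto
    then show "height ?u (int i) \<le> height ?u l" using k h[of "nat l"] h[of i] by (simp add: G.plow_def)
  qed
  have rel: "not_separated a b D i j \<longleftrightarrow> word_rel ?u (int i) (int j)" if "i \<in> {1..N}" "j \<in> {1..N}" for i j
  proof -
    have ij: "0 < i" "i < a + b" "0 < j" "j < a + b" using that SN by auto
    obtain k where k: "G.plow k i" using G.plow_exists[OF ij(1,2)] .
    obtain l where l: "G.plow l j" using G.plow_exists[OF ij(3,4)] .
    have kl: "low ?u (int k) (int i)" "low ?u (int l) (int j)" using low k l that by auto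
    have "not_separated a b D i j \<longleftrightarrow> k = l"
      using G.not_separated_iff[OF ij] k l G.plow_unique by blast
    also have "\<dots> \<longleftrightarrow> same ?u (int i) (int j)"
      using same_low_iff[OF kl(1)] kl prev_low_unique[of "height ?u" "int k" "int j" "int l"] by auto
    also have "\<dots> \<longleftrightarrow> word_rel ?u (int i) (int j)"
      using dyck_rel_iff[OF dy, of "int i" "int j"] that int_N by auto
    finally show ?thesis .
  qed
  then show "hom_partition a b D = word_part ?u"
    unfolding hom_partition_def cyc_part_def N_def[symmetric] by (intro arg_cong2[of _ _ _ _ quotient] refl) auto
qed

lemma dyck_word_path:
  assumes u: "is_dyck u"
  obtains D where "dyck_path a b D" "path_word D = u"
proof -
  define D where "D = map (\<lambda>i. if u (int i + 1) then North else East) [0..<N] @ [East]"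
  have SN: "Suc N = a + b" using a_pos by (simp add: N_def)
  have len: "length D = a + b" using SN by (simp add: D_def)
  have nth: "D ! i = North \<longleftrightarrow> u (int i + 1)" if "i < N" for i using that by (simp add: D_def nth_append)
  have cN: "int (count_list (take i D) North) = ones u (int i)" if "i \<le> N" for i
    using that
  proof (induction i)
    case (Suc i)
    then show ?case using nth[of i] ones_step[of "int i + 1" u] len SN
      by (cases "D ! i") (auto simp: take_Suc_conv_app_nth add.commute)
  qed simp
  have "D = take N D @ [East]" by (simp add: D_def)
  then have "count_list D North = count_list (take N D) North"
    using count_list_append[of "take N D" "[East]" North] by simp
  moreover have "int (count_list (take N D) North) = int a" using cN[of N] u int_N by (simp add: is_dyck_def)
  ultimately have DN: "count_list D North = a" by simp
  then have DE: "count_list D East = b" using count_list_steps[of D] len by simp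
  have "real a / real b * real (count_list (take i D) East) \<le> real (count_list (take i D) North)" if i: "i \<le> a + b" for i
  proof (cases "i \<le> N")
    case True
    have E: "int (count_list (take i D) East) = int i - int (count_list (take i D) North)"
      using count_list_steps[of "take i D"] len i by simp
    have e: "int b * int (count_list (take i D) North) - int a * int (count_list (take i D) East) = height u (int i)"
      unfolding E cN[OF True] using height_ones[of "int i" u] by (simp add: algebra_simps)
    have "0 \<le> height u (int i)"
      using is_dyckD(3)[OF u, of "int i"] True int_N by (cases "i = 0") auto
    then have "int a * int (count_list (take i D) East) \<le> int b * int (count_list (take i D) North)" using e by simp
    then have "real_of_int (int a * int (count_list (take i D) East)) \<le> real_of_int (int b * int (count_list (take i D) North))"
      by (simp only: of_int_le_iff)
    then have "real a * real (count_list (take i D) East) \<le> real b * real (count_list (take i D) North)" by simp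
    then show ?thesis using b_pos by (simp add: field_simps)
  next
    case False
    then have "take i D = D" using i SN len by simp
    then show ?thesis using DN DE b_pos by simp
  qed
  then have "dyck_path a b D" unfolding dyck_path_def using DN DE len by (simp add: lattice_pt_def)
  moreover have "path_word D = u"
  proof
    fix i
    define m where "m = (i - 1) mod n"
    have m: "0 \<le> m" "m < n" using n_pos by (auto simp: m_def)
    then have "nat m < N" using int_N by linarith
    then have "path_word D i \<longleftrightarrow> u (m + 1)"
      unfolding path_word_def periodic_ext_def m_def[symmetric] using nth[of "nat m"] m by simp
    then show "path_word D i = u i" using periodic_mod[OF is_dyckD(1)[OF u], of i] by (simp add: m_def)
  qed
  ultimately show ?thesis using that by blast
qed

lemma HNC_eq: "HNC a b = dyck_parts"
proof
  show "HNC a b \<subseteq> dyck_parts"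
    unfolding HNC_def dyck_parts_def using hom_partition_path_word by auto
  show "dyck_parts \<subseteq> HNC a b"
  proof
    fix x assume "x \<in> dyck_parts"
    then obtain u where u: "is_dyck u" "x = word_part u" unfolding dyck_parts_def by blast
    obtain D where D: "dyck_path a b D" "path_word D = u" using dyck_word_path[OF u(1)] .
    then have "x = hom_partition a b D" using hom_partition_path_word(2)[OF D(1)] u by simp
    then show "x \<in> HNC a b" unfolding HNC_def using D by blast
  qed
qed

end

section \<open>Matching powers of the root with rotations\<close>

lemma primitive_root_power_eq_1:
  assumes "primitive_root_of_unity n z"
  shows "z ^ m = 1 \<longleftrightarrow> n dvd m"
proof -
  have n: "n > 0" "z ^ n = 1" and prim: "\<And>k. 0 < k \<Longrightarrow> k < n \<Longrightarrow> z ^ k \<noteq> 1"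
    using assms by (auto simp: primitive_root_of_unity_def)
  have "z ^ m = z ^ (n * (m div n) + m mod n)" by simp
  also have "\<dots> = z ^ (m mod n)" unfolding power_add power_mult n(2) by simp
  finally have "z ^ m = 1 \<longleftrightarrow> z ^ (m mod n) = 1" by simp
  also have "\<dots> \<longleftrightarrow> m mod n = 0" using prim[of "m mod n"] n(1) by (cases "m mod n = 0") auto
  finally show ?thesis by (simp add: dvd_eq_mod_eq_0)
qed

text \<open>After division by \<open>g = gcd d n\<close> the cofactor \<open>c\<close> of
  \<open>d\<close> is coprime to \<open>e\<close>, so \<open>e dvd c * k\<close> reduces to
  \<open>e dvd k\<close>. Thus \<open>z ^ d\<close> has the order \<open>e\<close> that governs the
  partitions fixed by rotation by \<open>gcd d n\<close>.\<close>

lemma primitive_root_power: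
  assumes z: "primitive_root_of_unity n z" and e: "n = gcd d n * e"
  shows "primitive_root_of_unity e (z ^ d)"
proof -
  have n: "n > 0" using z by (simp add: primitive_root_of_unity_def)
  define g where "g = gcd d n"
  have g: "g > 0" using n by (simp add: g_def)
  obtain c where c: "d = g * c" using dvdE[OF gcd_dvd1] unfolding g_def by blast
  have e: "n = g * e" using e by (simp add: g_def)
  have "gcd (g * c) (g * e) = g" by (simp only: c[symmetric] e[symmetric] g_def[symmetric])
  then have "g * gcd c e = g" by (simp only: gcd_mult_distrib_nat)
  then have "gcd c e = 1" using g by simp
  then have "coprime e c" by (simp add: coprime_iff_gcd_eq_1 gcd.commute)
  have "(z ^ d) ^ k = 1 \<longleftrightarrow> e dvd k" for k
  proof -
    have "(z ^ d) ^ k = 1 \<longleftrightarrow> g * e dvd g * (c * k)"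
      unfolding power_mult[symmetric] primitive_root_power_eq_1[OF z]
      by (simp only: c[symmetric] e[symmetric] mult.assoc[symmetric])
    also have "\<dots> \<longleftrightarrow> e dvd c * k" using g by simp
    also have "\<dots> \<longleftrightarrow> e dvd k" using \<open>coprime e c\<close> by (rule coprime_dvd_mult_right_iff)
    finally show ?thesis .
  qed
  moreover have "e > 0" using n e by (cases e) auto
  ultimately show ?thesis unfolding primitive_root_of_unity_def by (auto dest: dvd_imp_le)
qed

theorem theorem5p4:
  fixes a b :: nat
  assumes "a > 0" and "b > 0" and "coprime a b"
  shows "cyclic_sieving (HNC a b) (a + b - 1) (rotate_partition (a + b - 1)) (q_Cat a b)"
proof -
  interpret rational_slope a b using assms by unfold_locales
  obtain F where F: "q_binom (a + b) a = q_int (a + b) * F" "F * (q_fact a * q_fact b) = q_fact (a + b - 1)"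
    using q_catalan_exists[OF assms(1,3)] .
  note nonneg = nat_poly_of_nonneg[OF q_catalan_nonneg[OF assms(1,2) F]]
  have eval: "eval_int_poly (\<zeta> ^ d) F = of_nat (card (fixed_parts d))"
    if \<zeta>: "primitive_root_of_unity N \<zeta>" for \<zeta> d
  proof -
    define p where "p = gcd d N"
    obtain e where e: "N = p * e" using dvdE[OF gcd_dvd2] unfolding p_def by blast
    have p0: "p > 0" and e0: "e > 0" using N_pos e by (auto intro: Nat.gr0I)
    have "fixed_parts d = fixed_parts p"
      unfolding dyck_parts_def p_def using rotate_fixed_gcd is_dyckD(1) by blast
    moreover have "eval_int_poly (\<zeta> ^ d) F = of_nat (card (fixed_parts p))"
    \<comment> \<open>For \<open>e = 1\<close> the rotation is trivial and the polynomial is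
      evaluated at 1, so the total count is used. The count by words of period \<open>p\<close>
      requires \<open>e \<ge> 2\<close>.\<close>
    proof (cases "e = 1")
      case True
      then have pN: "p = N" using e by simp
      then have "N dvd d" using gcd_dvd1[of d N] unfolding p_def by simp
      then have "\<zeta> ^ d = 1" using primitive_root_power_eq_1[OF \<zeta>] by simp
      moreover have "fixed_parts N = dyck_parts"
        using rotate_dyck_parts_funpow by blast
      ultimately show ?thesis using eval_q_catalan_1[OF F(2) card_dyck_parts] pN by simp
    next
      case False
      then have e2: "e \<ge> 2" using e0 by simp
      interpret root_of_unity "\<zeta> ^ d" e
        using e2 primitive_root_power[OF \<zeta>, of d e] e unfolding p_def by unfold_locales auto
      show ?thesis
        using eval_q_catalan[OF assms(1,2) F(2), of p] card_fixed[OF p0 e2] e by (simp add: N_def)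
    qed
    ultimately show ?thesis by simp
  qed
  have "cyclic_sieving dyck_parts N (rotate_partition N) (q_Cat a b)"
    unfolding cyclic_sieving_def cyclic_action_def
    using finite_dyck_parts N_pos rotate_dyck_parts rotate_dyck_parts_funpow q_Cat_eq[OF assms(1) F(1)] nonneg eval
    by (intro conjI exI[of _ "map_poly nat F"]) auto
  then show ?thesis unfolding HNC_eq N_def .
qed

end
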